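(* Let $m\ge1$ and let $a,b_1,\ldots,b_m,c,d\in\mathbb{C}$ satisfy, for $j=1,\ldots,m$, $$2a,\ a+b_j,\ a+c,\ a+d,\ 2b_j,\ b_j+c,\ b_j+d,\ 2c,\ c+d,\ 2d\notin\{0,-1,-2,\ldots\},\qquad a+b_j+c+d\notin\{0,-1,-2,\ldots\},$$ and $b_\ell-b_k\notin\mathbb{Z}$ for $\ell\neq k$. Then the Wilson measures $\mu^{(a,b_j,c,d)}$, $j=1,\ldots,m$, form a perfect system. If in addition $\Re(a)>0$ and $\Re(c+d)>0$, then for every multi-index $\vec n=(n_1,\ldots,n_m)$ the formal multiple Wilson polynomial $p_{\vec n}(\cdot\,;a,\vec b,c,d)$ with multi-index $\vec n$ (that is, the multiple orthogonal polynomial of type II for the system $\mu^{(a,b_1,c,d)},\ldots,\mu^{(a,b_m,c,d)}$, suitably normalized) can be written as $$p_{\vec n}(t^2;a,\vec b,c,d)=k_{\vec n}\int_0^1P^{(\vec\alpha,\beta)}_{\vec n}(u)\,w^{(a-1,\beta)}(u)\,K(u,t;a,0,c,d)\,du$$ for all $t\in\mathbb{C}$ with $0<|\Re(t)|<\Re(a)$, where $\vec\alpha=(a+b_1-1,\ldots,a+b_m-1)$, $\beta=c+d-1$, and $k_{\vec n}=\vec n!\,\Gamma(a+c+|\vec n|)\,\Gamma(a+d+|\vec n|)$.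
   Context: Notation: $|\vec n|=n_1+\cdots+n_m$, $\vec n!=\prod_{j=1}^m n_j!$, $\vec b=(b_1,\ldots,b_m)$, multi-indices have nonnegative integer entries. Wilson weight: $$w(t;a,b,c,d)=\frac{\Gamma(a+t)\Gamma(a-t)\Gamma(b+t)\Gamma(b-t)\Gamma(c+t)\Gamma(c-t)\Gamma(d+t)\Gamma(d-t)}{\Gamma(2t)\Gamma(-2t)}.$$ The Wilson measure $\mu^{(a,b,c,d)}$ is the functional on polynomials $h$ given by $\int h(t)\,d\mu^{(a,b,c,d)}(t)=\int_{\mathcal{C}}h(t^2)\,w(t;a,b,c,d)\,dt$, where $\mathcal{C}$ is the imaginary axis deformed so as to separate the increasing sequences of poles $\{a+k\},\{b+k\},\{c+k\},\{d+k\}$ ($k=0,1,2,\ldots$) from the decreasing ones $\{-a-k\},\{-b-k\},\{-c-k\},\{-d-k\}$. Jacobi-Piñeiro polynomial: $$P_{\vec n}^{(\vec\alpha,\beta)}(u)=\frac{1}{\vec n!}(1-u)^{-\beta}\prod_{j=1}^m\left(u^{-\alpha_j}\frac{d^{n_j}}{du^{n_j}}u^{n_j+\alpha_j}\right)(1-u)^{|\vec n|+\beta},$$ where the product is a composition of operators (multiply by $u^{n_j+\alpha_j}$, differentiate $n_j$ times, multiply by $u^{-\alpha_j}$; the order is irrelevant) applied to $(1-u)^{|\vec n|+\beta}$. Jacobi weight: $w^{(\alpha,\beta)}(u)=u^\alpha(1-u)^\beta$ on $(0,1)$. Kernel: $$K(u,t;a,b,c,d)=\frac{u^{-b-t}}{\Gamma(a-t)\Gamma(a+t)\Gamma(c+d)}\;{}_2F_1\!\left(\left.{c-t,\,d-t\atop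 c+d}\right|1-u\right).$$ For (possibly complex) measures $\mu_1,\ldots,\mu_m$ with finite moments and a multi-index $\vec n$, a (formal) multiple orthogonal polynomial of type II with respect to $\vec n$ is a nontrivial polynomial $p_{\vec n}$ of degree $\le|\vec n|$ with $\int p_{\vec n}(t)t^k\,d\mu_j(t)=0$ for $k=0,\ldots,n_j-1$, $j=1,\ldots,m$. The multi-index $\vec n$ is normal if every such polynomial has exact degree $|\vec n|$ (which implies uniqueness up to a multiplicative constant). The system is perfect if every multi-index is normal. *)

theory Defs
  imports "HOL-Complex_Analysis.Complex_Analysis" "HOL-Library.Nonpos_Ints"
begin

text \<open>
  A multi-index with \<open>m\<close> entries is a function \<open>n :: nat \<Rightarrow> nat\<close> of which only the values on
  \<open>{1..m}\<close> are used; the same convention applies to parameter vectors.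
\<close>

definition mi_size :: "nat \<Rightarrow> (nat \<Rightarrow> nat) \<Rightarrow> nat" where
  "mi_size m n = (\<Sum>j=1..m. n j)"

definition mi_fact :: "nat \<Rightarrow> (nat \<Rightarrow> nat) \<Rightarrow> complex" where
  "mi_fact m n = (\<Prod>j=1..m. fact (n j))"


section \<open>Formal multiple orthogonality of type II\<close>

text \<open>
  A measure enters only through its integration functional on polynomials, so a system
  of measures is a family \<open>L\<close> of functionals, indexed by \<open>{1..m}\<close>.
\<close>

definition is_type_II_mop ::
    "nat \<Rightarrow> (nat \<Rightarrow> complex poly \<Rightarrow> complex) \<Rightarrow> (nat \<Rightarrow> nat) \<Rightarrow> complex poly \<Rightarrow> bool" where
  "is_type_II_mop m L n p \<longleftrightarrow>
     p \<noteq> 0 \<and> degree p \<le> mi_size m n \<and>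
     (\<forall>j\<in>{1..m}. \<forall>k<n j. L j (p * monom 1 k) = 0)"

definition normal_index ::
    "nat \<Rightarrow> (nat \<Rightarrow> complex poly \<Rightarrow> complex) \<Rightarrow> (nat \<Rightarrow> nat) \<Rightarrow> bool" where
  "normal_index m L n \<longleftrightarrow> (\<forall>p. is_type_II_mop m L n p \<longrightarrow> degree p = mi_size m n)"

definition perfect_system :: "nat \<Rightarrow> (nat \<Rightarrow> complex poly \<Rightarrow> complex) \<Rightarrow> bool" where
  "perfect_system m L \<longleftrightarrow> (\<forall>n. normal_index m L n)"


section \<open>Wilson measures\<close>

text \<open>
  At the zeros of \<open>1 / (\<Gamma>(2t) \<Gamma>(-2t))\<close>, i.e. for \<open>2t\<close> an integer, \<^const>\<open>Gamma\<close> takes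
  the value 0 in one of the two factors, so that the quotient below is 0, as it should be.
\<close>

definition wilson_weight :: "complex \<Rightarrow> complex \<Rightarrow> complex \<Rightarrow> complex \<Rightarrow> complex \<Rightarrow> complex" where
  "wilson_weight a b c d t =
     (Gamma (a + t) * Gamma (a - t) * Gamma (b + t) * Gamma (b - t) *
      Gamma (c + t) * Gamma (c - t) * Gamma (d + t) * Gamma (d - t)) /
     (Gamma (2 * t) * Gamma (- 2 * t))"

text \<open>
  An admissible contour is an upward parametrisation \<open>\<gamma>\<close> of the imaginary axis that has been
  changed on a bounded parameter interval. That a point off \<open>\<gamma>\<close> lies to the left (right)
  of \<open>\<gamma>\<close> is expressed by closing \<open>\<gamma>\<close>, restricted to \<open>[-R, R]\<close>, by the semicircle of radius
  \<open>R\<close> in the left half plane: for all large \<open>R\<close> the resulting counterclockwise loop has winding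
  number 1 (0) around the point. Self-intersections are not excluded; by Cauchy's theorem
  only these winding numbers around the poles matter for the integral.
\<close>

definition left_of_contour :: "(real \<Rightarrow> complex) \<Rightarrow> complex \<Rightarrow> bool" where
  "left_of_contour \<gamma> z \<longleftrightarrow> z \<notin> range \<gamma> \<and>
     (\<forall>\<^sub>F R in at_top.
        winding_number (subpath (- R) R \<gamma> +++ part_circlepath 0 R (pi / 2) (3 * pi / 2)) z = 1)"

definition right_of_contour :: "(real \<Rightarrow> complex) \<Rightarrow> complex \<Rightarrow> bool" where
  "right_of_contour \<gamma> z \<longleftrightarrow> z \<notin> range \<gamma> \<and>
     (\<forall>\<^sub>F R in at_top.
        winding_number (subpath (- R) R \<gamma> +++ part_circlepath 0 R (pi / 2) (3 * pi / 2)) z = 0)"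

definition wilson_contour ::
    "complex \<Rightarrow> complex \<Rightarrow> complex \<Rightarrow> complex \<Rightarrow> (real \<Rightarrow> complex) \<Rightarrow> bool" where
  "wilson_contour a b c d \<gamma> \<longleftrightarrow>
     (\<exists>R>0. (\<forall>s. \<bar>s\<bar> \<ge> R \<longrightarrow> \<gamma> s = \<i> * of_real s) \<and>
            \<gamma> piecewise_C1_differentiable_on {- R..R}) \<and>
     (\<forall>x\<in>{a, b, c, d}. \<forall>k::nat.
        right_of_contour \<gamma> (x + of_nat k) \<and> left_of_contour \<gamma> (- x - of_nat k))"

text \<open>The choice of the admissible contour is immaterial, again by Cauchy's theorem.\<close>

definition wilson_functional ::
    "complex \<Rightarrow> complex \<Rightarrow> complex \<Rightarrow> complex \<Rightarrow> complex poly \<Rightarrow> complex" where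
  "wilson_functional a b c d h =
     (let \<gamma> = (SOME \<gamma>. wilson_contour a b c d \<gamma>) in
      integral UNIV (\<lambda>s::real. poly h ((\<gamma> s)\<^sup>2) * wilson_weight a b c d (\<gamma> s) *
                               vector_derivative \<gamma> (at s)))"


section \<open>Jacobi-Pineiro polynomials and the kernel\<close>

text \<open>
  The Rodrigues formula is read with complex derivatives and principal powers; these are
  holomorphic near the interval \<open>(0, 1)\<close>, the only place where the polynomial is evaluated.
\<close>

definition rodrigues_op :: "complex \<Rightarrow> nat \<Rightarrow> (complex \<Rightarrow> complex) \<Rightarrow> complex \<Rightarrow> complex" where
  "rodrigues_op \<alpha> k f =
     (\<lambda>u. u powr (- \<alpha>) * (deriv ^^ k) (\<lambda>v. v powr (of_nat k + \<alpha>) * f v) u)"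

definition jacobi_pineiro ::
    "nat \<Rightarrow> (nat \<Rightarrow> nat) \<Rightarrow> (nat \<Rightarrow> complex) \<Rightarrow> complex \<Rightarrow> complex \<Rightarrow> complex" where
  "jacobi_pineiro m n \<alpha> \<beta> u =
     1 / mi_fact m n * (1 - u) powr (- \<beta>) *
     foldr (\<lambda>j. rodrigues_op (\<alpha> j) (n j)) [1..<Suc m]
           (\<lambda>v. (1 - v) powr (of_nat (mi_size m n) + \<beta>)) u"

definition jacobi_weight :: "complex \<Rightarrow> complex \<Rightarrow> complex \<Rightarrow> complex" where
  "jacobi_weight \<alpha> \<beta> u = u powr \<alpha> * (1 - u) powr \<beta>"

definition hyp2F1 :: "complex \<Rightarrow> complex \<Rightarrow> complex \<Rightarrow> complex \<Rightarrow> complex" where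
  "hyp2F1 A B C z = eval_fps (fps_hypergeo [A, B] [C] 1) z"

definition wilson_kernel ::
    "complex \<Rightarrow> complex \<Rightarrow> complex \<Rightarrow> complex \<Rightarrow> complex \<Rightarrow> complex \<Rightarrow> complex" where
  "wilson_kernel a b c d u t =
     u powr (- b - t) / (Gamma (a - t) * Gamma (a + t) * Gamma (c + d)) *
     hyp2F1 (c - t) (d - t) (c + d) (1 - u)"

end

theory Submission
  imports Defs "HOL-Probability.Probability" "HOL-Real_Asymp.Real_Asymp"
begin

text \<open>
  Everything rests on the fact that a factor \<open>x\<^sup>2 - t\<^sup>2\<close> in front of the Wilson weight is the same
  as raising the parameter \<open>x\<close> by one. Hence moments against the polynomials
  \<open>\<phi>\<^sub>k(t\<^sup>2) = (a - t)\<^sub>k (a + t)\<^sub>k\<close> (\<open>wilson_basis a k\<close>) are total masses of Wilson weights with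
  shifted parameters, and two facts about total masses carry the proof.

  The first is the contiguous relation \<open>wilson_contiguous\<close> between the masses for \<open>a\<close> and \<open>a + 1\<close>.
  Let \<open>H(t) = sin (2\<pi>t) \<Prod>\<^sub>x \<Gamma>(x + 1/2 + t) \<Gamma>(x + 1/2 - t)\<close>. The difference
  \<open>H(t + 1/2) - H(t - 1/2)\<close> is the weight times a polynomial of degree one in \<open>t\<^sup>2\<close> whose coefficients are
  elementary symmetric functions of the parameters. Its integral vanishes, because no pole of
  \<open>H\<close> lies between the two translates of an admissible contour by \<open>1/2\<close> to the right and to the
  left (\<open>contour_int_shift_invariant\<close>).

  The second fact is that the total mass is not zero (\<open>wilson_mass_nonzero\<close>). If it were, the
  contiguous relation would annihilate all moments, also those for parameters raised so far that
  the contour can be moved to the imaginary axis. The weight on the axis would then be a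
  continuous function of exponential decay all of whose moments vanish; its Fourier
  transform is zero, and so is the function, by the uniqueness theorem for characteristic functions.

  Both facts together give the integrals of all products \<open>\<phi>\<^sub>k \<psi>\<^sub>l\<close> up to a common factor that is not zero; here \<open>\<psi>\<^sub>l\<close> belongs to \<open>b\<close> as \<open>\<phi>\<^sub>k\<close> belongs to
  \<open>a\<close> (\<open>wilson_int_basis_product\<close>). For \<open>p = \<Sum> e\<^sub>k \<phi>\<^sub>k\<close> with \<open>k \<le> N\<close>, orthogonality up to order \<open>n\<^sub>j\<close> for the
  weight with parameter \<open>b\<^sub>j\<close> turns out to mean that the polynomial
  \<open>Q(z) = \<Sum> x\<^sub>k (z)\<^sub>k (z + c + d + k)\<^sub>N\<^sub>-\<^sub>k\<close>, \<open>x\<^sub>k = e\<^sub>k (a + c)\<^sub>k (a + d)\<^sub>k\<close>, vanishes at the points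
  \<open>a + b\<^sub>j + l\<close>, \<open>l < n\<^sub>j\<close> (\<open>wilson_functional_orthogonality\<close>). These points are distinct because the \<open>b\<^sub>j\<close> are
  incongruent modulo the integers. If \<open>p\<close> had degree below the size of the multi-index, then \<open>Q\<close> would have more
  zeros than its degree permits; so \<open>Q = 0\<close>, and evaluation at \<open>0, -1, -2, \<dots>\<close> gives \<open>x\<^sub>k = 0\<close>. This is
  perfectness.

  Up to Gamma factors, \<open>Q(z)\<close> is the integral of \<open>u\<^bsup>z - 1\<^esup> (1 - u)\<^bsup>c + d - 1\<^esup> \<Sum> x\<^sub>k u\<^sup>k\<close> over \<open>(0, 1)\<close>. On
  such integrals a differential operator of the Rodrigues formula acts as multiplication by a linear
  factor per derivative (\<open>jacobi_moment_rodrigues_step\<close>). With the coefficients of a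
  Jacobi-Pineiro polynomial as \<open>x\<^sub>k\<close>, the polynomial \<open>Q\<close> is therefore a constant times \<open>\<Prod>\<^sub>j (a + b\<^sub>j - z)\<close> with subscripts \<open>n\<^sub>j\<close>, which has
  exactly the required zeros (\<open>jacobi_pineiro_moments\<close>). Finally, the kernel sends \<open>u\<^sup>k\<close> to
  \<open>\<phi>\<^sub>k(t\<^sup>2) / (\<Gamma>(a + c + k) \<Gamma>(a + d + k))\<close> (\<open>wilson_kernel_moment\<close>, from Gauss's theorem), and these
  denominators turn the coefficients \<open>x\<^sub>k\<close> into the \<open>e\<^sub>k\<close>, up to a common factor.
\<close>

section \<open>Exponential decay of the Gamma function along vertical lines\<close>

lemma nonpos_Int_Re_pos: "Re z > 0 \<Longrightarrow> z \<notin> \<int>\<^sub>\<le>\<^sub>0"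
  by (auto elim!: nonpos_Ints_cases)

text \<open>
  In Gauss's product the ratio \<open>\<bar>\<Gamma>(x + \<i>y)\<bar> / \<Gamma>(x)\<close> becomes a product of factors
  \<open>(x + k) / \<bar>x + k + \<i>y\<bar>\<close>, each of which increases with \<open>x\<close>. A bound on one vertical line thus
  bounds \<open>\<Gamma>\<close> on all vertical lines to the left of it.
\<close>

lemma Gamma_vertical_quotient_mono:
  fixes x X y :: real
  assumes "0 < x" "x \<le> X"
  shows "norm (Gamma (Complex x y)) * Gamma X \<le> Gamma x * norm (Gamma (Complex X y))"
proof -
  have series_le: "norm (Gamma_series (Complex x y) n) * norm (Gamma_series (complex_of_real X) n)
      \<le> norm (Gamma_series (complex_of_real x) n) * norm (Gamma_series (Complex X y) n)" for n
  proof -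
    define L where "L = ln (real n)"
    have prods: "(\<Prod>k\<le>n. norm (complex_of_real x + of_nat k)) * (\<Prod>k\<le>n. norm (Complex X y + of_nat k))
       \<le> (\<Prod>k\<le>n. norm (Complex x y + of_nat k)) * (\<Prod>k\<le>n. norm (complex_of_real X + of_nat k))"
      unfolding prod.distrib[symmetric]
    proof (intro prod_mono conjI)
      fix k
      have "((x + k) * cmod (Complex X y + of_nat k))\<^sup>2 \<le> (cmod (Complex x y + of_nat k) * (X + k))\<^sup>2"
      proof -
        have "y\<^sup>2 * (x + k)\<^sup>2 \<le> y\<^sup>2 * (X + k)\<^sup>2"
          using assms by (intro mult_left_mono power_mono) auto
        thus ?thesis
          unfolding power_mult_distrib cmod_power2 by (simp add: algebra_simps)
      qed
      hence "(x + k) * cmod (Complex X y + of_nat k) \<le> cmod (Complex x y + of_nat k) * (X + k)"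
        by (rule power2_le_imp_le) (use assms in auto)
      moreover have "norm (complex_of_real x + of_nat k) = x + k" "norm (complex_of_real X + of_nat k) = X + k"
        using assms by (metis abs_of_nonneg add_nonneg_nonneg norm_of_real of_nat_0_le_iff of_real_add of_real_of_nat_eq order_less_imp_le order_trans)+
      ultimately show "norm (complex_of_real x + of_nat k) * norm (Complex X y + of_nat k)
          \<le> norm (Complex x y + of_nat k) * norm (complex_of_real X + of_nat k)"
        by simp
    qed auto
    have pos: "(\<Prod>k\<le>n. norm (complex_of_real x + of_nat k)) > 0" "(\<Prod>k\<le>n. norm (Complex X y + of_nat k)) > 0"
      "(\<Prod>k\<le>n. norm (Complex x y + of_nat k)) > 0" "(\<Prod>k\<le>n. norm (complex_of_real X + of_nat k)) > 0"
      using assms by (auto intro!: prod_pos simp: complex_eq_iff)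
    have norms: "norm (Gamma_series z n) = fact n * exp (Re z * L) / (\<Prod>k\<le>n. norm (z + of_nat k))" for z :: complex
      by (simp add: Gamma_series_def norm_mult norm_divide L_def pochhammer_Suc_prod prod_norm
           atLeast0AtMost norm_exp_eq_Re)
    show ?thesis
      unfolding norms using pos mult_left_mono[OF prods, of "(fact n)^2 * exp (x * L) * exp (X * L)"]
      by (simp add: divide_simps mult_ac power2_eq_square)
  qed
  have "norm (Gamma (Complex x y)) * norm (Gamma (complex_of_real X))
      \<le> norm (Gamma (complex_of_real x)) * norm (Gamma (Complex X y))"
    by (rule LIMSEQ_le[OF tendsto_mult tendsto_mult])
       (use series_le in \<open>auto intro!: tendsto_norm Gamma_series_LIMSEQ\<close>)
  moreover have "norm (Gamma (complex_of_real r)) = Gamma r" if "r > 0" for r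
    using that by (simp add: Gamma_complex_of_real)
  ultimately show ?thesis using assms by simp
qed

text \<open>On the line \<open>Re z = 1/2\<close> the reflection formula gives \<open>\<bar>\<Gamma>(z)\<bar>\<^sup>2 = \<pi> / cosh (\<pi>y)\<close>.\<close>

lemma norm_Gamma_half_line: "norm (Gamma (Complex (1/2) y)) \<le> sqrt (2 * pi) * exp (- pi * \<bar>y\<bar> / 2)"
proof -
  define z where "z = Complex (1/2) y"
  have c: "1 - z = cnj z" by (simp add: z_def complex_eq_iff)
  have "Gamma z * Gamma (1 - z) = of_real pi / sin (of_real pi * z)"
    by (rule Gamma_reflection_complex)
  hence "norm (Gamma z) ^ 2 = pi / norm (sin (of_real pi * z))"
    unfolding c cnj_Gamma[symmetric]
    by (metis complex_mod_mult_cnj norm_divide norm_of_real abs_of_nonneg pi_ge_zero)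
  moreover have "norm (sin (of_real pi * z)) \<ge> exp (pi * \<bar>y\<bar>) / 2"
  proof -
    have s: "sin (of_real pi * z) = of_real (cosh (pi * y))"
    proof -
      have "of_real pi * z = of_real (pi/2) + \<i> * of_real (pi * y)"
        by (simp add: z_def complex_eq_iff)
      also have "sin \<dots> = cos (\<i> * of_real (pi * y))"
        by (simp only: sin_add) (simp add: sin_of_real cos_of_real)
      also have "\<dots> = cosh (of_real (pi * y))"
        by (simp add: cosh_conv_cos)
      finally show ?thesis by (simp add: cosh_def scaleR_conv_of_real flip: exp_of_real)
    qed
    have "exp (pi * \<bar>y\<bar>) / 2 \<le> cosh (pi * y)"
      by (cases "y \<ge> 0") (auto simp: cosh_def)
    thus ?thesis unfolding s by (simp add: cosh_real_nonneg)
  qed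
  moreover have "pi / norm (sin (of_real pi * z)) \<le> pi / (exp (pi * \<bar>y\<bar>) / 2)"
    using calculation(2) by (intro divide_left_mono mult_pos_pos) (auto intro: less_le_trans[rotated])
  ultimately have "norm (Gamma z) ^ 2 \<le> pi / (exp (pi * \<bar>y\<bar>) / 2)"
    by simp
  also have "\<dots> = (sqrt (2 * pi) * exp (- pi * \<bar>y\<bar> / 2)) ^ 2"
    by (simp add: power_mult_distrib exp_minus field_simps flip: exp_double)
  finally show ?thesis unfolding z_def by (rule power2_le_imp_le) auto
qed

lemma power_times_exp_bounded:
  fixes e :: real
  assumes "e > 0"
  shows "\<exists>C\<ge>0. \<forall>x\<ge>0. (x + r) ^ N * exp (- e * x) \<le> C"
proof -
  have "((\<lambda>x. (x + r) ^ N * exp (- e * x)) \<longlongrightarrow> 0) at_top"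
    using assms by real_asymp
  hence "eventually (\<lambda>x. (x + r) ^ N * exp (- e * x) < 1) at_top"
    by (rule order_tendstoD) simp
  then obtain X where X: "\<And>x. x \<ge> X \<Longrightarrow> (x + r) ^ N * exp (- e * x) < 1"
    by (auto simp: eventually_at_top_linorder)
  have "compact ((\<lambda>x. (x + r) ^ N * exp (- e * x)) ` {0..max 0 X})"
    by (intro compact_continuous_image continuous_intros) auto
  then obtain C where C: "\<And>x. x \<in> {0..max 0 X} \<Longrightarrow> \<bar>(x + r) ^ N * exp (- e * x)\<bar> \<le> C"
    using compact_imp_bounded bounded_iff by (metis (no_types, lifting) image_eqI real_norm_def)
  have "(x + r) ^ N * exp (- e * x) \<le> max 1 C" if "x \<ge> 0" for x
  proof (cases "x \<ge> X")
    case True thus ?thesis using X[of x] by linarith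
  next
    case False thus ?thesis using C[of x] that by auto
  qed
  thus ?thesis by (intro exI[of _ "max 1 C"]) auto
qed

text \<open>
  The true rate is \<open>\<pi>/2\<close> up to a power of \<open>\<bar>Im z\<bar>\<close>; the smaller rate \<open>3/2\<close> absorbs the power. The strip is moved
  to the right by \<open>M\<close>, which does not decrease \<open>\<bar>\<Gamma>\<bar>\<close> for \<open>\<bar>Im z\<bar> \<ge> 1\<close>, and is then compared with the line
  \<open>Re z = X\<close>, where \<open>X\<close> is a half-integer so that the recurrence connects it to the line \<open>Re z = 1/2\<close>.
\<close>

lemma Gamma_strip_decay:
  "\<exists>C\<ge>0. \<forall>z. \<bar>Re z\<bar> \<le> A \<and> \<bar>Im z\<bar> \<ge> 1 \<longrightarrow> norm (Gamma z) \<le> C * exp (- (3/2) * \<bar>Im z\<bar>)"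
proof -
  obtain M :: nat where M: "real M \<ge> \<bar>A\<bar> + 1" using real_arch_simple by blast
  define N where "N = 2 * M"
  \<comment> \<open>a half-integer to the right of the shifted strip\<close>
  define X where "X = real N + 1/2"
  have "compact (Gamma ` {1..X})"
    by (intro compact_continuous_image continuous_on_Gamma) (auto simp: nonpos_Ints_def)
  then obtain G where G: "\<And>x. x \<in> {1..X} \<Longrightarrow> \<bar>Gamma x\<bar> \<le> G"
    using compact_imp_bounded bounded_iff by (metis (no_types, lifting) image_eqI real_norm_def)
  have G0: "G \<ge> 0" 
  proof -
    have "1 \<le> X" using M by (simp add: X_def N_def)
    hence "\<bar>Gamma 1\<bar> \<le> G" by (intro G) auto
    thus ?thesis by linarith
  qed
  obtain C where C: "C \<ge> 0" "\<And>x. x \<ge> 0 \<Longrightarrow> (x + X) ^ N * exp (- (pi/2 - 3/2) * x) \<le> C"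
    using power_times_exp_bounded[of "pi/2 - 3/2" X N] pi_gt3 by auto
  have X0: "X > 0" "Gamma X > 0" by (auto simp: X_def)
  define K where "K = G / Gamma X * sqrt (2 * pi) * C"
  have "norm (Gamma z) \<le> K * exp (- (3/2) * \<bar>Im z\<bar>)" if z: "\<bar>Re z\<bar> \<le> A" "\<bar>Im z\<bar> \<ge> 1" for z
  proof -
    define y where "y = Im z"
    have zn: "z \<notin> \<int>\<^sub>\<le>\<^sub>0" using z by (auto elim!: nonpos_Ints_cases)
    have ge1: "norm (pochhammer z M) \<ge> 1"
    proof -
      have "norm (z + of_nat k) \<ge> 1" for k
        using abs_Im_le_cmod[of "z + of_nat k"] z by simp
      thus ?thesis by (simp add: pochhammer_prod prod_norm[symmetric] prod_ge_1)
    qed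
    have "norm (Gamma z) \<le> norm (Gamma z) * norm (pochhammer z M)"
      using ge1 by (simp add: mult_le_cancel_left1)
    also have "\<dots> = norm (Gamma (z + of_nat M))"
      using zn by (simp add: pochhammer_Gamma Gamma_eq_zero_iff norm_divide)
    finally have 1: "norm (Gamma z) \<le> norm (Gamma (z + of_nat M))" .
    define x where "x = Re z + M"
    have zz: "z + of_nat M = Complex x y" by (simp add: complex_eq_iff x_def y_def)
    have x: "1 \<le> x" "x \<le> X" using z M by (auto simp: x_def X_def N_def)
    have 2: "norm (Gamma (Complex x y)) * Gamma X \<le> G * norm (Gamma (Complex X y))"
      using Gamma_vertical_quotient_mono[of x X y] x G[of x]
      by (meson abs_le_D1 atLeastAtMost_iff less_le_trans mult_right_mono norm_ge_zero order_trans zero_less_one)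
    have 3: "norm (Gamma (Complex X y)) \<le> (\<bar>y\<bar> + X) ^ N * (sqrt (2 * pi) * exp (- pi * \<bar>y\<bar> / 2))"
    proof -
      have n: "Complex (1/2) y \<notin> \<int>\<^sub>\<le>\<^sub>0" by (auto elim!: nonpos_Ints_cases simp: complex_eq_iff)
      have "Complex X y = Complex (1/2) y + of_nat N" by (simp add: complex_eq_iff X_def)
      hence "Gamma (Complex X y) = pochhammer (Complex (1/2) y) N * Gamma (Complex (1/2) y)"
        using n by (simp add: pochhammer_Gamma Gamma_eq_zero_iff)
      moreover have "norm (pochhammer (Complex (1/2) y) N) \<le> (\<bar>y\<bar> + X) ^ N"
      proof -
        have "norm (pochhammer (Complex (1/2) y) N) = (\<Prod>k<N. norm (Complex (1/2) y + of_nat k))"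
          by (simp add: pochhammer_prod prod_norm atLeast0LessThan)
        also have "\<dots> \<le> (\<Prod>k<N. \<bar>y\<bar> + X)"
        proof (intro prod_mono conjI)
          fix k assume "k \<in> {..<N}"
          hence "real k + 1/2 \<le> X" by (simp add: X_def)
          thus "norm (Complex (1/2) y + of_nat k) \<le> \<bar>y\<bar> + X"
            using cmod_le[of "Complex (1/2) y + of_nat k"] by (simp)
        qed auto
        finally show ?thesis by simp
      qed
      ultimately show ?thesis
        using norm_Gamma_half_line[of y] X0 by (auto simp: norm_mult intro!: mult_mono)
    qed
    have 4: "(\<bar>y\<bar> + X) ^ N * exp (- pi * \<bar>y\<bar> / 2) \<le> C * exp (- (3/2) * \<bar>y\<bar>)"
    proof -
      have "(\<bar>y\<bar> + X) ^ N * exp (- pi * \<bar>y\<bar> / 2) =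
         ((\<bar>y\<bar> + X) ^ N * exp (- (pi/2 - 3/2) * \<bar>y\<bar>)) * exp (- (3/2) * \<bar>y\<bar>)"
        by (simp add: mult.assoc flip: exp_add) (simp add: algebra_simps)
      also have "\<dots> \<le> C * exp (- (3/2) * \<bar>y\<bar>)"
        using C(2)[of "\<bar>y\<bar>"] by (intro mult_right_mono) auto
      finally show ?thesis .
    qed
    have "norm (Gamma (Complex x y)) \<le> G / Gamma X * norm (Gamma (Complex X y))"
      using 2 X0 by (simp add: field_simps)
    also have "\<dots> \<le> G / Gamma X * ((\<bar>y\<bar> + X) ^ N * (sqrt (2 * pi) * exp (- pi * \<bar>y\<bar> / 2)))"
      using 3 G0 X0 by (intro mult_left_mono) auto
    also have "\<dots> = G / Gamma X * sqrt (2 * pi) * ((\<bar>y\<bar> + X) ^ N * exp (- pi * \<bar>y\<bar> / 2))"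
      by simp
    also have "\<dots> \<le> G / Gamma X * sqrt (2 * pi) * (C * exp (- (3/2) * \<bar>y\<bar>))"
      using 4 G0 X0 by (intro mult_left_mono) auto
    finally show ?thesis using 1 unfolding zz K_def y_def by (simp add: mult_ac)
  qed
  moreover have "K \<ge> 0" using G0 X0 C by (auto simp: K_def)
  ultimately show ?thesis by blast
qed

lemma Gamma_pair_strip_decay:
  "\<exists>C\<ge>0. \<exists>T\<ge>1. \<forall>t. \<bar>Re t\<bar> \<le> A \<and> \<bar>Im t\<bar> \<ge> T \<longrightarrow>
      norm (Gamma (x + t) * Gamma (x - t)) \<le> C * exp (- 3 * \<bar>Im t\<bar>)"
proof -
  obtain C where C: "C \<ge> 0"
    "\<And>z. \<bar>Re z\<bar> \<le> A + norm x \<Longrightarrow> \<bar>Im z\<bar> \<ge> 1 \<Longrightarrow> norm (Gamma z) \<le> C * exp (- (3/2) * \<bar>Im z\<bar>)"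
    using Gamma_strip_decay[of "A + norm x"] by auto
  define D where "D = (C * exp (3/2 * \<bar>Im x\<bar>))\<^sup>2"
  have "norm (Gamma (x + t) * Gamma (x - t)) \<le> D * exp (- 3 * \<bar>Im t\<bar>)"
    if t: "\<bar>Re t\<bar> \<le> A" "\<bar>Im t\<bar> \<ge> 1 + \<bar>Im x\<bar>" for t
  proof -
    have le: "C * exp (- (3/2) * \<bar>Im z\<bar>) \<le> C * exp (3/2 * \<bar>Im x\<bar>) * exp (- (3/2) * \<bar>Im t\<bar>)"
      if "\<bar>Im z\<bar> \<ge> \<bar>Im t\<bar> - \<bar>Im x\<bar>" for z
      using that C(1) by (auto simp flip: exp_add simp: mult.assoc intro!: mult_left_mono)
    have "norm (Gamma (x + t)) \<le> C * exp (3/2 * \<bar>Im x\<bar>) * exp (- (3/2) * \<bar>Im t\<bar>)"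
      using t abs_Re_le_cmod[of x] by (intro order_trans[OF C(2) le]) auto
    moreover have "norm (Gamma (x - t)) \<le> C * exp (3/2 * \<bar>Im x\<bar>) * exp (- (3/2) * \<bar>Im t\<bar>)"
      using t abs_Re_le_cmod[of x] by (intro order_trans[OF C(2) le]) auto
    ultimately have "norm (Gamma (x + t)) * norm (Gamma (x - t)) \<le>
       (C * exp (3/2 * \<bar>Im x\<bar>) * exp (- (3/2) * \<bar>Im t\<bar>)) * (C * exp (3/2 * \<bar>Im x\<bar>) * exp (- (3/2) * \<bar>Im t\<bar>))"
      by (intro mult_mono) (use C in auto)
    also have "\<dots> = D * (exp (- (3/2) * \<bar>Im t\<bar>) * exp (- (3/2) * \<bar>Im t\<bar>))"
      by (simp add: D_def power2_eq_square)
    also have "exp (- (3/2) * \<bar>Im t\<bar>) * exp (- (3/2) * \<bar>Im t\<bar>) = exp (- 3 * \<bar>Im t\<bar>)"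
      by (simp flip: exp_add)
    finally show ?thesis by (simp add: norm_mult)
  qed
  thus ?thesis by (intro exI[of _ D] conjI exI[of _ "1 + \<bar>Im x\<bar>"]) (auto simp: D_def)
qed

section \<open>Paths that follow the imaginary axis\<close>

definition axis_contour :: "(real \<Rightarrow> complex) \<Rightarrow> real \<Rightarrow> bool" where
  "axis_contour \<gamma> R0 \<longleftrightarrow> R0 > 0 \<and> (\<forall>s. \<bar>s\<bar> \<ge> R0 \<longrightarrow> \<gamma> s = \<i> * of_real s) \<and>
     \<gamma> piecewise_C1_differentiable_on {- R0..R0}"

lemma axis_C1: "(\<lambda>s. \<i> * of_real s) piecewise_C1_differentiable_on {u..v}"
  by (rule C1_differentiable_imp_piecewise)
     (auto simp: C1_differentiable_on_def intro!: exI[of _ "\<lambda>_. \<i>"] derivative_eq_intros has_vector_derivative_real_field)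

lemma axis_contour_C1:
  assumes "axis_contour \<gamma> R0" "R \<ge> R0"
  shows "\<gamma> piecewise_C1_differentiable_on {- R..R}"
proof -
  have R0: "R0 > 0" and ax: "\<And>s. \<bar>s\<bar> \<ge> R0 \<Longrightarrow> \<gamma> s = \<i> * of_real s"
    and C1: "\<gamma> piecewise_C1_differentiable_on {- R0..R0}"
    using assms by (auto simp: axis_contour_def)
  have "(\<lambda>x. if x \<le> - R0 then \<i> * of_real x else \<gamma> x) piecewise_C1_differentiable_on {- R..R0}"
    using assms R0 ax[of "- R0"] by (intro piecewise_C1_differentiable_cases axis_C1 C1) auto
  also have "(\<lambda>x. if x \<le> - R0 then \<i> * of_real x else \<gamma> x) = \<gamma>"
    using ax R0 by (auto simp: fun_eq_iff)
  finally have 1: "\<gamma> piecewise_C1_differentiable_on {- R..R0}" .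
  have "(\<lambda>x. if x \<le> R0 then \<gamma> x else \<i> * of_real x) piecewise_C1_differentiable_on {- R..R}"
    using assms R0 ax[of "R0"] by (intro piecewise_C1_differentiable_cases axis_C1 1) auto
  also have "(\<lambda>x. if x \<le> R0 then \<gamma> x else \<i> * of_real x) = \<gamma>"
    using ax R0 by (auto simp: fun_eq_iff)
  finally show ?thesis .
qed

lemma axis_contour_valid_path:
  assumes "axis_contour \<gamma> R0" "R \<ge> R0"
  shows "valid_path (subpath (- R) R \<gamma>)"
proof -
  have R: "R > 0" using assms by (auto simp: axis_contour_def)
  have "(\<lambda>x. (2 * R) * x + - R) ` {0..1} \<subseteq> {- R..R}"
    using R by (auto simp: mult_le_cancel_left1) 
  hence "(\<gamma> \<circ> (\<lambda>x. (2 * R) *\<^sub>R x + - R)) piecewise_C1_differentiable_on {0..1}"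
    by (intro piecewise_C1_differentiable_affine piecewise_C1_differentiable_on_subset[OF axis_contour_C1[OF assms]])
  moreover have "(\<gamma> \<circ> (\<lambda>x. (2 * R) *\<^sub>R x + - R)) = subpath (- R) R \<gamma>"
    by (simp add: fun_eq_iff subpath_def)
  ultimately show ?thesis by (simp add: valid_path_def)
qed

lemma path_image_axis_contour:
  assumes "axis_contour \<gamma> R0" "R \<ge> R0"
  shows "path_image (subpath (- R) R \<gamma>) = \<gamma> ` {- R..R}"
  using assms by (auto simp: path_image_subpath axis_contour_def)

text \<open>
  Enlarging the truncation height \<open>R\<close> only adds two segments of the axis, so the part of the contour off the
  axis contributes a winding number that does not depend on \<open>R\<close>.
\<close>

lemma axis_contour_winding_split:
  assumes ax: "axis_contour \<gamma> R0" and R: "R > R0" and z: "z \<notin> range \<gamma>"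
  shows "winding_number (subpath (- R) R \<gamma>) z =
     winding_number (linepath (- (\<i> * R)) (- (\<i> * R0))) z +
     winding_number (subpath (- R0) R0 \<gamma>) z +
     winding_number (linepath (\<i> * R0) (\<i> * R)) z"
proof -
  have R0: "R0 > 0" and on_axis: "\<And>s. \<bar>s\<bar> \<ge> R0 \<Longrightarrow> \<gamma> s = \<i> * of_real s"
    using ax by (auto simp: axis_contour_def)
  define g where "g = subpath (- R) R \<gamma>"
  define u where "u = (R - R0) / (2 * R)"
  define v where "v = (R + R0) / (2 * R)"
  have uv: "0 < u" "u < v" "v < 1" "2 * R * u = R - R0" "2 * R * v = R + R0" "2 * R * (v - u) = 2 * R0"
    using R R0 by (auto simp: u_def v_def field_simps)
  have g: "path g" using axis_contour_valid_path[OF ax, of R] R by (simp add: g_def valid_path_imp_path)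
  have zg: "z \<notin> path_image g" using z by (auto simp: g_def path_image_def subpath_def)
  have "winding_number g z = winding_number (subpath 0 u g) z + winding_number (subpath u 1 g) z"
    using winding_number_subpath_combine[OF g zg, of 0 u 1] uv by simp
  also have "winding_number (subpath u 1 g) z = winding_number (subpath u v g) z + winding_number (subpath v 1 g) z"
    using winding_number_subpath_combine[OF g zg, of u v 1] uv by simp
  also have "winding_number (subpath 0 u g) z = winding_number (linepath (- (\<i> * R)) (- (\<i> * R0))) z"
  proof (rule winding_number_cong)
    fix t :: real assume t: "0 \<le> t" "t \<le> 1"
    have e: "2 * R * (u * t) - R = (R - R0) * t - R" using uv(4) by (simp add: mult.assoc[symmetric])
    have "(R - R0) * t \<le> (R - R0) * 1" using t R by (intro mult_left_mono) auto
    hence "\<bar>(R - R0) * t - R\<bar> \<ge> R0" using R0 by simp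
    hence "\<gamma> ((R - R0) * t - R) = linepath (- (\<i> * R)) (- (\<i> * R0)) t"
      using on_axis by (simp add: linepath_def scaleR_conv_of_real algebra_simps)
    thus "subpath 0 u g t = linepath (- (\<i> * R)) (- (\<i> * R0)) t"
      unfolding e[symmetric] by (simp add: subpath_def g_def)
  qed
  also have "winding_number (subpath v 1 g) z = winding_number (linepath (\<i> * R0) (\<i> * R)) z"
  proof (rule winding_number_cong)
    fix t :: real assume t: "0 \<le> t" "t \<le> 1"
    have e: "2 * R * ((1 - v) * t + v) - R = R0 + (R - R0) * t"
    proof -
      have "2 * R * ((1 - v) * t + v) - R = 2 * R * t - (2 * R * v) * t + 2 * R * v - R"
        by (simp add: algebra_simps)
      thus ?thesis unfolding uv(5) by (simp add: algebra_simps)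
    qed
    have "(R - R0) * t \<ge> 0" using t R by auto
    hence "\<bar>R0 + (R - R0) * t\<bar> \<ge> R0" using R0 by simp
    hence "\<gamma> (R0 + (R - R0) * t) = linepath (\<i> * R0) (\<i> * R) t"
      using on_axis by (simp add: linepath_def scaleR_conv_of_real algebra_simps)
    thus "subpath v 1 g t = linepath (\<i> * R0) (\<i> * R) t"
      unfolding e[symmetric] by (simp add: subpath_def g_def)
  qed
  also have "winding_number (subpath u v g) z = winding_number (subpath (- R0) R0 \<gamma>) z"
  proof (rule winding_number_cong)
    fix t :: real assume t: "0 \<le> t" "t \<le> 1"
    have e: "2 * R * ((v - u) * t + u) - R = 2 * R0 * t - R0"
      using uv(4,6) by (simp add: distrib_left mult.assoc[symmetric])
    show "subpath u v g t = subpath (- R0) R0 \<gamma> t"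
      unfolding subpath_def g_def using e by simp
  qed
  finally show ?thesis by (simp add: g_def)
qed

section \<open>Winding numbers of a loop with a semicircular detour\<close>

lemma winding_number_part_circlepath_centre:
  assumes "s < t" "r \<noteq> 0"
  shows "winding_number (part_circlepath z r s t) z = of_real ((t - s) / (2 * pi))"
proof -
  have z: "z \<notin> path_image (part_circlepath z r s t)"
    using assms by (auto simp: path_image_part_circlepath')
  have "contour_integral (part_circlepath z r s t) (\<lambda>w. 1 / (w - z)) = integral {s..t} (\<lambda>x. \<i>)"
    unfolding contour_integral_part_circlepath_eq[OF assms(1)]
    using assms(2) by (intro integral_cong) simp
  also have "\<dots> = of_real (t - s) * \<i>" using assms by (simp add: scaleR_conv_of_real)
  finally have I: "contour_integral (part_circlepath z r s t) (\<lambda>w. 1 / (w - z)) = of_real (t - s) * \<i>" .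
  have "winding_number (part_circlepath z r s t) z =
      1 / (2 * pi * \<i>) * contour_integral (part_circlepath z r s t) (\<lambda>w. 1 / (w - z))"
    using z by (intro winding_number_valid_path) auto
  thus ?thesis unfolding I by (simp add: field_simps del: of_real_diff)
qed

definition right_arc :: "real \<Rightarrow> real \<Rightarrow> complex" where
  "right_arc R = part_circlepath 0 R (- pi / 2) (pi / 2)"

definition left_arc :: "real \<Rightarrow> real \<Rightarrow> complex" where
  "left_arc R = part_circlepath 0 R (pi / 2) (3 * pi / 2)"

lemma valid_path_arcs [simp]: "valid_path (right_arc R)" "valid_path (left_arc R)"
  by (simp_all add: right_arc_def left_arc_def)

lemma path_arcs [simp]: "path (right_arc R)" "path (left_arc R)"
  by (simp_all add: right_arc_def left_arc_def)

text \<open>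
  The loop that results if the axis is deformed into the semicircle of radius \<open>R0\<close> on the right and closed by
  the semicircle of radius \<open>R\<close> on the left has all points of norm less than \<open>R0\<close> on its left.
\<close>

definition base_loop :: "real \<Rightarrow> real \<Rightarrow> real \<Rightarrow> complex" where
  "base_loop R0 R = linepath (- (\<i> * R)) (- (\<i> * R0)) +++
     (right_arc R0 +++
     (linepath (\<i> * R0) (\<i> * R) +++ left_arc R))"

lemma exp_quarter_turns:
  "exp (\<i> * of_real (pi / 2)) = \<i>" "exp (- (\<i> * of_real (pi / 2))) = - \<i>"
  "exp (\<i> * of_real (3 * pi / 2)) = - \<i>"
proof -
  show "exp (\<i> * of_real (pi / 2)) = \<i>" "exp (- (\<i> * of_real (pi / 2))) = - \<i>"
    by (simp_all add: exp_eq_polar cis.ctr complex_eq_iff Re_exp Im_exp)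
  have "cos (3 * pi / 2) = 0" "sin (3 * pi / 2) = - 1"
    using cos_3over2_pi sin_3over2_pi by (auto simp: mult.commute)
  thus "exp (\<i> * of_real (3 * pi / 2)) = - \<i>"
    by (simp add: complex_eq_iff Re_exp Im_exp)
qed

lemma semicircle_ends [simp]:
  "pathstart (left_arc R) = \<i> * R"
  "pathfinish (left_arc R) = - (\<i> * R)"
  "pathstart (right_arc R) = - (\<i> * R)"
  "pathfinish (right_arc R) = \<i> * R"
proof -
  have ends: "pathstart (part_circlepath 0 R s t) = of_real R * exp (\<i> * of_real s)"
    "pathfinish (part_circlepath 0 R s t) = of_real R * exp (\<i> * of_real t)" for s t
    by simp_all
  have e: "exp (\<i> * of_real (- pi / 2)) = - \<i>" using exp_quarter_turns(2) by simp
  show "pathstart (left_arc R) = \<i> * R" "pathfinish (left_arc R) = - (\<i> * R)"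
    "pathstart (right_arc R) = - (\<i> * R)" "pathfinish (right_arc R) = \<i> * R"
    unfolding left_arc_def right_arc_def ends exp_quarter_turns e by simp_all
qed

lemma left_semicircle_image:
  assumes "w \<in> path_image (left_arc R)" "R > 0"
  shows "norm w = R" "Re w \<le> 0"
proof -
  obtain x where x: "x \<in> closed_segment (pi / 2) (3 * pi / 2)" "w = R * cis x"
    using assms unfolding right_arc_def left_arc_def path_image_part_circlepath' by auto
  have "cos (x - pi) \<ge> 0"
    using x by (intro cos_ge_zero) (auto simp: closed_segment_eq_real_ivl split: if_splits)
  hence "cos x \<le> 0" by (simp add: cos_diff)
  thus "norm w = R" "Re w \<le> 0" using assms x by (auto simp: norm_mult mult_nonneg_nonpos)
qed

lemma right_semicircle_image:
  assumes "w \<in> path_image (right_arc R)" "R > 0"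
  shows "norm w = R" "Re w \<ge> 0"
proof -
  obtain x where x: "x \<in> closed_segment (- pi / 2) (pi / 2)" "w = R * cis x"
    using assms unfolding right_arc_def left_arc_def path_image_part_circlepath' by auto
  have "cos x \<ge> 0"
    using x by (intro cos_ge_zero) (auto simp: closed_segment_eq_real_ivl split: if_splits)
  thus "norm w = R" "Re w \<ge> 0" using assms x by (auto simp: norm_mult)
qed

lemma axis_segment:
  assumes "w \<in> closed_segment (\<i> * of_real r) (\<i> * of_real s)"
  shows "\<exists>t \<in> closed_segment r s. w = \<i> * of_real t"
proof -
  obtain x where x: "0 \<le> x" "x \<le> 1" "w = (1 - x) *\<^sub>R (\<i> * of_real r) + x *\<^sub>R (\<i> * of_real s)"
    using assms by (auto simp: in_segment)
  thus ?thesis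
    by (intro bexI[of _ "(1 - x) *\<^sub>R r + x *\<^sub>R s"])
       (auto simp: in_segment scaleR_conv_of_real algebra_simps)
qed

lemma base_loop_image:
  assumes "0 < R0" "R0 < R" "w \<in> path_image (base_loop R0 R)"
  shows "R0 \<le> norm w \<and> norm w \<le> R" and "Re w > 0 \<Longrightarrow> norm w = R0" and "Re w < 0 \<Longrightarrow> norm w = R"
proof -
  have "w \<in> closed_segment (\<i> * of_real (- R)) (\<i> * of_real (- R0)) \<or>
        w \<in> closed_segment (\<i> * of_real R0) (\<i> * of_real R) \<or>
        w \<in> path_image (right_arc R0) \<or>
        w \<in> path_image (left_arc R)"
    using assms(3) by (auto simp: base_loop_def path_image_join)
  moreover have "R0 \<le> norm w \<and> norm w \<le> R \<and> Re w = 0"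
    if "w \<in> closed_segment (\<i> * of_real (- R)) (\<i> * of_real (- R0))"
    using axis_segment[OF that] assms(1,2)
    by (auto simp: closed_segment_eq_real_ivl norm_mult split: if_splits)
  moreover have "R0 \<le> norm w \<and> norm w \<le> R \<and> Re w = 0"
    if "w \<in> closed_segment (\<i> * of_real R0) (\<i> * of_real R)"
    using axis_segment[OF that] assms(1,2)
    by (auto simp: closed_segment_eq_real_ivl norm_mult split: if_splits)
  ultimately show "R0 \<le> norm w \<and> norm w \<le> R" "Re w > 0 \<Longrightarrow> norm w = R0" "Re w < 0 \<Longrightarrow> norm w = R"
    using left_semicircle_image[of w R] right_semicircle_image[of w R0] assms by force+
qed

lemma path_base_loop: "path (base_loop R0 R)"
  and loop_base_loop: "pathfinish (base_loop R0 R) = pathstart (base_loop R0 R)"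
  by (auto simp: base_loop_def)

text \<open>
  Stated in this form because the same four pieces, with the semicircle replaced by a more complicated path,
  occur for the contours constructed below.
\<close>

lemma winding_base_loop_split:
  assumes "0 < R0" "R0 < R" "z \<notin> path_image (base_loop R0 R)"
  shows "winding_number (base_loop R0 R) z =
     winding_number (linepath (- (\<i> * R)) (- (\<i> * R0))) z +
     winding_number (right_arc R0) z +
     winding_number (linepath (\<i> * R0) (\<i> * R)) z +
     winding_number (left_arc R) z"
  using assms(3) unfolding base_loop_def
  by (subst winding_number_join | simp add: path_image_join)+

text \<open>
  The region on the left is connected, so it suffices to look at the origin. There the two segments cancel by
  symmetry and each semicircle contributes \<open>1/2\<close>.
\<close>

lemma winding_base_loop_left:
  assumes "0 < R0" "R0 < R" "norm z < R0 \<or> Re z < 0 \<and> norm z < R"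
  shows "winding_number (base_loop R0 R) z = 1"
proof -
  define D where "D = ball 0 R0 \<union> ({z. Re z < 0} \<inter> ball 0 R)"
  have "connected D" unfolding D_def
  proof (rule connected_Un)
    have "complex_of_real (- R0 / 2) \<in> ball 0 R0 \<inter> ({z. Re z < 0} \<inter> ball 0 R)"
      using assms by (auto simp: dist_norm)
    thus "ball 0 R0 \<inter> ({z. Re z < 0} \<inter> ball 0 R) \<noteq> {}" by blast
  qed (auto intro!: convex_connected convex_Int convex_halfspace_Re_lt)
  moreover have disj: "D \<inter> path_image (base_loop R0 R) = {}"
    using base_loop_image[OF assms(1,2)] by (fastforce simp: D_def)
  moreover have "z \<in> D" "0 \<in> D" using assms by (auto simp: D_def)
  ultimately have "winding_number (base_loop R0 R) z = winding_number (base_loop R0 R) 0"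
    using winding_number_eq[OF path_base_loop loop_base_loop] by blast
  also have "\<dots> = 1"
  proof -
    have "0 \<notin> path_image (base_loop R0 R)" using disj \<open>0 \<in> D\<close> by blast
    note split = winding_base_loop_split[OF assms(1,2) this]
    define l where "l = linepath (\<i> * of_real R0) (\<i> * of_real R)"
    have 0: "0 \<notin> path_image l"
      using axis_segment[of 0 R0 R] assms by (auto simp: l_def closed_segment_eq_real_ivl)
    have "uminus \<circ> l = linepath (- (\<i> * R0)) (- (\<i> * R))"
      by (simp add: l_def fun_eq_iff linepath_def algebra_simps scaleR_conv_of_real)
    hence "uminus \<circ> l = reversepath (linepath (- (\<i> * R)) (- (\<i> * R0)))"
      by (simp only: reversepath_linepath)
    moreover have off: "0 \<notin> path_image (linepath (- (\<i> * R)) (- (\<i> * R0)))"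
      using axis_segment[of 0 "- R" "- R0"] assms by (auto simp: closed_segment_eq_real_ivl)
    ultimately have "winding_number l 0 = - winding_number (linepath (- (\<i> * R)) (- (\<i> * R0))) 0"
      using winding_number_negatepath[of l] winding_number_reversepath[OF path_linepath off] 0
      by (simp add: l_def)
    thus ?thesis unfolding split l_def[symmetric] using assms
      by (simp add: right_arc_def left_arc_def winding_number_part_circlepath_centre field_simps)
  qed
  finally show ?thesis .
qed

lemma winding_base_loop_right:
  assumes "0 < R0" "R0 < R" "Re z > 0" "norm z > R0"
  shows "winding_number (base_loop R0 R) z = 0"
proof -
  define T where "T = (\<lambda>t. of_real t * z) ` {1..}"
  have "connected T" unfolding T_def
    by (intro connected_continuous_image continuous_intros) auto
  moreover have "T \<inter> path_image (base_loop R0 R) = {}"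
  proof -
    have False if "w \<in> T" "w \<in> path_image (base_loop R0 R)" for w
    proof -
      obtain t where t: "t \<ge> 1" "w = of_real t * z" using \<open>w \<in> T\<close> by (auto simp: T_def)
      have "norm z \<le> norm w" using t by (auto simp: norm_mult mult_le_cancel_right1)
      moreover have "Re w > 0" using t assms by auto
      ultimately show False using base_loop_image(2)[OF assms(1,2) that(2)] assms by simp
    qed
    thus ?thesis by blast
  qed
  moreover have "z \<in> T" unfolding T_def by (rule image_eqI[of _ _ 1]) auto
  moreover have far: "of_real (1 + R / norm z) * z \<in> T"
    unfolding T_def by (rule imageI) (use assms in auto)
  ultimately have "winding_number (base_loop R0 R) z = winding_number (base_loop R0 R) (of_real (1 + R / norm z) * z)"
    using winding_number_eq[OF path_base_loop loop_base_loop] by blast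
  also have "\<dots> = 0"
  proof (rule winding_number_zero_outside[OF path_base_loop convex_cball loop_base_loop])
    show "path_image (base_loop R0 R) \<subseteq> cball 0 R"
      using base_loop_image(1)[OF assms(1,2)] by auto
    have "norm (of_real (1 + R / norm z) * z) = norm z + R"
      unfolding norm_mult norm_of_real using assms by (auto simp: field_simps)
    thus "of_real (1 + R / norm z) * z \<notin> cball 0 R" using assms by auto
  qed
  finally show ?thesis .
qed

section \<open>Construction of separating contours\<close>

text \<open>The loop runs from \<open>z0\<close> to a small circle around \<open>p\<close>, once around it clockwise, and back on the same way.\<close>

lemma lasso_exists:
  assumes S: "open S" "connected S" and z0: "z0 \<in> S" and e: "e > 0" "ball p e - {p} \<subseteq> S" and p: "p \<notin> S"
  shows "\<exists>L. valid_path L \<and> pathstart L = z0 \<and> pathfinish L = z0 \<and> path_image L \<subseteq> S \<and>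
     winding_number L p = - 1 \<and> (\<forall>w. w \<notin> S \<and> w \<noteq> p \<longrightarrow> winding_number L w = 0)"
proof -
  define r where "r = e / 2"
  have r: "r > 0" "r < e" using e by (auto simp: r_def)
  have sph: "sphere p r \<subseteq> S" using e r by (force simp: dist_norm norm_minus_commute)
  have "p + of_real r \<in> sphere p r" using r by (simp add: dist_norm)
  hence "p + of_real r \<in> S" using sph by blast
  then obtain g where g: "polynomial_function g" "path_image g \<subseteq> S" "pathstart g = z0" "pathfinish g = p + of_real r"
    using connected_open_polynomial_connected[OF S z0] by blast
  have vg: "valid_path g" by (simp add: valid_path_polynomial_function g)
  define C where "C = reversepath (circlepath p r)"
  define L where "L = g +++ (C +++ reversepath g)"
  have C: "valid_path C" "pathstart C = p + of_real r" "pathfinish C = p + of_real r" "path_image C \<subseteq> S"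
    using r sph by (auto simp: C_def)
  have L: "valid_path L" "pathstart L = z0" "pathfinish L = z0" "path_image L \<subseteq> S"
    using g vg C by (auto simp: L_def path_image_join)
  have W: "winding_number L w = - winding_number (circlepath p r) w" if "w \<notin> S" for w
  proof -
    have wn: "w \<notin> path_image g" "w \<notin> path_image C" "w \<notin> path_image (circlepath p r)"
      using that g C sph r by auto
    have "winding_number L w = winding_number g w + (winding_number C w + winding_number (reversepath g) w)"
      unfolding L_def using wn g C vg
      by (subst winding_number_join | simp add: valid_path_imp_path path_image_join)+
    thus ?thesis using wn vg by (simp add: C_def winding_number_reversepath valid_path_imp_path)
  qed
  have "winding_number L w = 0" if w: "w \<notin> S" "w \<noteq> p" for w
  proof -
    have "w \<notin> cball p r" using w e r by (force simp: dist_norm norm_minus_commute)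
    hence "winding_number (circlepath p r) w = 0"
      using r by (intro winding_number_zero_outside[of _ "cball p r"]) auto
    thus ?thesis using W[OF w(1)] by simp
  qed
  moreover have "winding_number L p = - 1" using W[OF p] r by (simp add: winding_number_circlepath_centre)
  ultimately show ?thesis using L by blast
qed

lemma correcting_loop_exists:
  assumes S: "open S" "connected S" and z0: "z0 \<in> S" and "finite B"
    and iso: "\<And>p. p \<in> B \<Longrightarrow> p \<notin> S \<and> (\<exists>e>0. ball p e - {p} \<subseteq> S)"
  shows "\<exists>L. valid_path L \<and> pathstart L = z0 \<and> pathfinish L = z0 \<and> path_image L \<subseteq> S \<and>
     (\<forall>w. w \<notin> S \<longrightarrow> winding_number L w = (if w \<in> B then - 1 else 0))"
  using assms(4) iso
proof (induction B rule: finite_induct)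
  case empty
  show ?case
  proof (intro exI[of _ "linepath z0 z0"] conjI allI impI)
    fix w assume "w \<notin> S"
    hence "z0 \<noteq> w" using z0 by auto
    thus "winding_number (linepath z0 z0) w = (if w \<in> {} then - 1 else 0)"
      by (simp only: winding_number_trivial) simp
  qed (rule valid_path_linepath pathstart_linepath pathfinish_linepath | simp add: z0)+
next
  case (insert p B)
  then obtain L where L: "valid_path L" "pathstart L = z0" "pathfinish L = z0" "path_image L \<subseteq> S"
    "\<And>w. w \<notin> S \<Longrightarrow> winding_number L w = (if w \<in> B then - 1 else 0)" by (metis insertCI)
  obtain e where e: "e > 0" "ball p e - {p} \<subseteq> S" "p \<notin> S" using insert.prems by blast
  obtain L' where L': "valid_path L'" "pathstart L' = z0" "pathfinish L' = z0" "path_image L' \<subseteq> S"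
    "winding_number L' p = - 1" "\<And>w. w \<notin> S \<Longrightarrow> w \<noteq> p \<Longrightarrow> winding_number L' w = 0"
    using lasso_exists[OF S z0 e] by blast
  have "winding_number (L +++ L') w = winding_number L w + winding_number L' w" if "w \<notin> S" for w
    using that L L' by (intro winding_number_join) (auto simp: valid_path_imp_path)
  hence "winding_number (L +++ L') w = (if w \<in> insert p B then - 1 else 0)" if "w \<notin> S" for w
    using that L(5)[of w] L'(5,6) insert.hyps by (cases "w = p") auto
  thus ?case using L L' by (intro exI[of _ "L +++ L'"]) (auto simp: path_image_join)
qed

text \<open>
  Far away the poles are on their proper side of the axis. The detour along the semicircle of radius \<open>R0\<close> puts
  all poles of norm less than \<open>R0\<close> on the left; loops of winding number \<open>-1\<close> around those of them that belong on the right
  correct this. Self-intersections do no harm, since only winding numbers are prescribed.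
\<close>

theorem separating_contour_exists:
  assumes fin: "\<And>r. finite (PL \<inter> cball 0 r)" "\<And>r. finite (PR \<inter> cball 0 r)"
    and disj: "PL \<inter> PR = {}"
    and far: "\<And>z. z \<in> PR \<Longrightarrow> norm z \<ge> M \<Longrightarrow> Re z > 0" "\<And>z. z \<in> PL \<Longrightarrow> norm z \<ge> M \<Longrightarrow> Re z < 0"
  shows "\<exists>\<gamma> R0. axis_contour \<gamma> R0 \<and> (\<forall>z\<in>PR. right_of_contour \<gamma> z) \<and> (\<forall>z\<in>PL. left_of_contour \<gamma> z)"
proof -
  define P where "P = PL \<union> PR"
  have finP: "finite (P \<inter> cball 0 r)" for r using fin[of r] by (simp add: P_def Int_Un_distrib2)
  define N where "N = max 0 M"
  have "infinite ({N<..<N + 1} - norm ` (P \<inter> cball 0 (N + 1)))"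
    using finP by (intro Diff_infinite_finite) (auto intro: infinite_Ioo)
  \<comment> \<open>a radius that is not the norm of any pole\<close>
  then obtain R0 where R0: "N < R0" "R0 < N + 1" "R0 \<notin> norm ` (P \<inter> cball 0 (N + 1))"
    by (metis Diff_iff all_not_in_conv finite.emptyI greaterThanLessThan_iff)
  have R0pos: "R0 > 0" "R0 > M" using R0 by (auto simp: N_def)
  have on: "norm z \<noteq> R0" if "z \<in> P" for z using R0 that by force
  define S where "S = ball 0 (R0 + 1) - P"
  have S_alt: "S = ball 0 (R0 + 1) - P \<inter> cball 0 (R0 + 1)" by (auto simp: S_def)
  have S: "open S" "connected S"
    unfolding S_alt using finP[of "R0 + 1"] convex_connected[OF convex_ball[of 0 "R0 + 1"]]
    by (auto intro!: open_Diff finite_imp_closed connected_open_delete_finite)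
  define z0 where "z0 = \<i> * complex_of_real R0"
  have z0: "z0 \<in> S" using R0pos on[of z0] by (auto simp: S_def z0_def norm_mult)
  \<comment> \<open>the poles that the semicircular detour puts on the wrong side\<close>
  define B where "B = PR \<inter> ball 0 R0"
  have B: "finite B" using fin(2)[of R0] by (rule finite_subset[rotated]) (auto simp: B_def)
  have iso: "p \<notin> S \<and> (\<exists>e>0. ball p e - {p} \<subseteq> S)" if "p \<in> B" for p
  proof
    show "p \<notin> S" using that by (auto simp: B_def S_def P_def)
    have "open (ball 0 (R0 + 1) - (P \<inter> cball 0 (R0 + 1) - {p}))"
      using finP by (auto intro!: open_Diff finite_imp_closed)
    moreover have "p \<in> ball 0 (R0 + 1) - (P \<inter> cball 0 (R0 + 1) - {p})" using that by (auto simp: B_def)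
    ultimately obtain e where "e > 0" "ball p e \<subseteq> ball 0 (R0 + 1) - (P \<inter> cball 0 (R0 + 1) - {p})"
      using open_contains_ball by blast
    thus "\<exists>e>0. ball p e - {p} \<subseteq> S" by (intro exI[of _ e]) (auto simp: S_alt)
  qed
  obtain L where L: "valid_path L" "pathstart L = z0" "pathfinish L = z0" "path_image L \<subseteq> S"
    "\<And>w. w \<notin> S \<Longrightarrow> winding_number L w = (if w \<in> B then - 1 else 0)"
    using correcting_loop_exists[OF S z0 B iso] by blast
  \<comment> \<open>the part of the contour off the axis\<close>
  define G where "G = right_arc R0 +++ L"
  have G: "valid_path G" "pathstart G = - (\<i> * R0)" "pathfinish G = \<i> * R0"
    using L by (auto simp: G_def z0_def)
  have Gim: "path_image G \<inter> P = {}"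
    using L right_semicircle_image(1)[of _ R0] on R0pos
    by (auto simp: G_def path_image_join z0_def S_def)
  define \<gamma> where "\<gamma> = (\<lambda>s. if \<bar>s\<bar> \<le> R0 then G ((1 / (2 * R0)) * s + 1 / 2) else \<i> * of_real s)"
  have ends: "\<gamma> R0 = \<i> * R0" "\<gamma> (- R0) = - (\<i> * R0)"
    using G R0pos by (auto simp: \<gamma>_def pathstart_def pathfinish_def)
  have axis: "axis_contour \<gamma> R0"
    unfolding axis_contour_def
  proof (intro conjI allI impI)
    fix s assume "\<bar>s\<bar> \<ge> R0"
    thus "\<gamma> s = \<i> * of_real s" using ends R0pos by (cases "\<bar>s\<bar> = R0") (auto simp: \<gamma>_def abs_if split: if_splits)
  next
    have "(\<lambda>x. (1 / (2 * R0)) * x + 1 / 2) ` {- R0..R0} \<subseteq> {0..1}"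
      using R0pos by (auto simp: field_simps)
    hence "(G \<circ> (\<lambda>x. (1 / (2 * R0)) *\<^sub>R x + 1 / 2)) piecewise_C1_differentiable_on {- R0..R0}"
      by (intro piecewise_C1_differentiable_affine
           piecewise_C1_differentiable_on_subset[OF G(1)[unfolded valid_path_def]])
    hence mid: "(\<lambda>x. G ((1 / (2 * R0)) * x + 1 / 2)) piecewise_C1_differentiable_on {- R0..R0}"
      by (simp add: o_def)
    have mid_right: "(\<lambda>x. if x \<le> R0 then G ((1 / (2 * R0)) * x + 1 / 2) else \<i> * of_real x)
        piecewise_C1_differentiable_on {- R0..R0 + 1}"
      using R0pos G by (intro piecewise_C1_differentiable_cases mid axis_C1) (auto simp: pathfinish_def)
    have "G ((1 / (2 * R0)) * (- R0) + 1 / 2) = - (\<i> * of_real R0)"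
      using R0pos G by (auto simp: pathstart_def)
    hence "(\<lambda>x. if x \<le> - R0 then \<i> * of_real x else
             if x \<le> R0 then G ((1 / (2 * R0)) * x + 1 / 2) else \<i> * of_real x)
        piecewise_C1_differentiable_on {- R0 - 1..R0 + 1}"
      using R0pos by (intro piecewise_C1_differentiable_cases axis_C1 mid_right) simp_all
    also have "(\<lambda>x. if x \<le> - R0 then \<i> * of_real x else
             if x \<le> R0 then G ((1 / (2 * R0)) * x + 1 / 2) else \<i> * of_real x) = \<gamma>"
    proof
      fix x
      consider "x < - R0" | "x = - R0" | "- R0 < x" "x \<le> R0" | "x > R0" by linarith
      thus "(if x \<le> - R0 then \<i> * of_real x else
             if x \<le> R0 then G ((1 / (2 * R0)) * x + 1 / 2) else \<i> * of_real x) = \<gamma> x"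
        by cases (use R0pos ends in \<open>auto simp: \<gamma>_def\<close>)
    qed
    finally show "\<gamma> piecewise_C1_differentiable_on {- R0..R0}"
      by (rule piecewise_C1_differentiable_on_subset) auto
  qed (use R0pos in auto)
  have range: "z \<notin> range \<gamma>" if "z \<in> P" for z
  proof
    assume "z \<in> range \<gamma>"
    then obtain s where s: "z = \<gamma> s" by auto
    show False
    proof (cases "\<bar>s\<bar> \<le> R0")
      case True
      have "(1 / (2 * R0)) * s + 1 / 2 \<in> {0..1}" using True R0pos by (auto simp: field_simps)
      hence "z \<in> path_image G" using True s by (simp add: \<gamma>_def path_image_def)
      thus False using Gim that by blast
    next
      case False
      hence "Re z = 0" "norm z > M" using s R0pos by (auto simp: \<gamma>_def norm_mult)
      thus False using far[of z] that by (auto simp: P_def)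
    qed
  qed
  have W: "winding_number (subpath (- R) R \<gamma> +++ left_arc R) z =
      winding_number (base_loop R0 R) z + winding_number L z"
    if z: "z \<in> P" and R: "R > R0" "R > norm z" for z R
  proof -
    have zn: "norm z \<noteq> R0" "norm z \<noteq> R" using on z R by auto
    have z_base: "z \<notin> path_image (base_loop R0 R)"
    proof
      assume "z \<in> path_image (base_loop R0 R)"
      from base_loop_image[OF R0pos(1) R(1) this] zn have "Re z = 0" "norm z \<ge> M"
        using R0pos by fastforce+
      thus False using far[of z] z by (auto simp: P_def)
    qed
    have z_left: "z \<notin> path_image (left_arc R)" using left_semicircle_image(1)[of z R] R R0pos zn by auto
    have vp: "valid_path (subpath (- R) R \<gamma>)" using axis_contour_valid_path[OF axis] R by simp
    have z_sub: "z \<notin> path_image (subpath (- R) R \<gamma>)" using range[OF z] by (auto simp: path_image_def subpath_def)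
    have "winding_number (subpath (- R) R \<gamma> +++ left_arc R) z =
       winding_number (subpath (- R) R \<gamma>) z + winding_number (left_arc R) z"
      using z_left z_sub vp axis R by (intro winding_number_join) (auto simp: valid_path_imp_path axis_contour_def)
    also have "winding_number (subpath (- R) R \<gamma>) z =
       winding_number (linepath (- (\<i> * R)) (- (\<i> * R0))) z +
       winding_number (subpath (- R0) R0 \<gamma>) z + winding_number (linepath (\<i> * R0) (\<i> * R)) z"
      by (rule axis_contour_winding_split[OF axis R(1) range[OF z]])
    also have "winding_number (subpath (- R0) R0 \<gamma>) z = winding_number G z"
    proof (rule winding_number_cong)
      fix t :: real assume t: "0 \<le> t" "t \<le> 1"
      have "\<bar>2 * R0 * t - R0\<bar> \<le> R0" using t R0pos by (auto simp: abs_le_iff mult_le_cancel_left1)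
      moreover have "(1 / (2 * R0)) * (2 * R0 * t - R0) + 1 / 2 = t" using R0pos by (simp add: field_simps)
      ultimately have "\<gamma> (2 * R0 * t - R0) = G t" by (simp only: \<gamma>_def if_True)
      thus "subpath (- R0) R0 \<gamma> t = G t" by (simp add: subpath_def)
    qed
    also have "winding_number G z = winding_number (right_arc R0) z + winding_number L z"
      unfolding G_def using L z Gim
      by (intro winding_number_join) (auto simp: valid_path_imp_path z0_def G_def path_image_join)
    finally show ?thesis
      using winding_base_loop_split[OF R0pos(1) R(1) z_base] by simp
  qed
  have notS: "z \<notin> S" if "z \<in> P" for z using that by (auto simp: S_def)
  show ?thesis
  proof (intro exI[of _ \<gamma>] exI[of _ R0] conjI ballI axis)
    fix z assume z: "z \<in> PR"
    hence zP: "z \<in> P" by (simp add: P_def)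
    have "eventually (\<lambda>R. winding_number (subpath (- R) R \<gamma> +++ left_arc R) z = 0) at_top"
      using eventually_gt_at_top[of "max R0 (norm z)"]
    proof eventually_elim
      case (elim R)
      show ?case
      proof (cases "norm z < R0")
        case True
        thus ?thesis using W[OF zP, of R] elim L(5)[OF notS[OF zP]] winding_base_loop_left[of R0 R z] R0pos z
          by (auto simp: B_def)
      next
        case False
        hence "norm z > R0" using on[OF zP] by auto
        thus ?thesis using W[OF zP, of R] elim L(5)[OF notS[OF zP]] winding_base_loop_right[of R0 R z] R0pos z far(1)[of z]
          by (auto simp: B_def)
      qed
    qed
    thus "right_of_contour \<gamma> z" using range[OF zP] unfolding right_of_contour_def left_arc_def by blast
  next
    fix z assume z: "z \<in> PL"
    hence zP: "z \<in> P" by (simp add: P_def)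
    have nB: "z \<notin> B" using z disj by (auto simp: B_def)
    have "eventually (\<lambda>R. winding_number (subpath (- R) R \<gamma> +++ left_arc R) z = 1) at_top"
      using eventually_gt_at_top[of "max R0 (norm z)"]
    proof eventually_elim
      case (elim R)
      have "norm z < R0 \<or> Re z < 0 \<and> norm z < R" using elim far(2)[OF z] on[OF zP] R0pos by force
      thus ?case using W[OF zP, of R] elim L(5)[OF notS[OF zP]] nB winding_base_loop_left[of R0 R z] R0pos
        by auto
    qed
    thus "left_of_contour \<gamma> z" using range[OF zP] unfolding left_of_contour_def left_arc_def by blast
  qed
qed

text \<open>The two families of poles are disjoint exactly because no sum of two parameters is a nonpositive integer.\<close>

lemma wilson_contour_exists:
  assumes "\<And>x y. x \<in> {a, b, c, d} \<Longrightarrow> y \<in> {a, b, c, d} \<Longrightarrow> x + y \<notin> \<int>\<^sub>\<le>\<^sub>0"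
  shows "\<exists>\<gamma>. wilson_contour a b c d \<gamma>"
proof -
  define X where "X = {a, b, c, d}"
  define PR where "PR = (\<Union>x\<in>X. range (\<lambda>k::nat. x + of_nat k))"
  define PL where "PL = (\<Union>x\<in>X. range (\<lambda>k::nat. - x - of_nat k))"
  define K where "K = Max (norm ` X)"
  have K: "norm x \<le> K" if "x \<in> X" for x using that by (auto simp: K_def X_def)
  have PL_eq: "PL = uminus ` PR" by (auto simp: PL_def PR_def image_iff) (metis minus_add_distrib diff_conv_add_uminus)+
  have finR: "finite (PR \<inter> cball 0 r)" for r
  proof (rule finite_subset)
    show "PR \<inter> cball 0 r \<subseteq> (\<Union>x\<in>X. (\<lambda>k::nat. x + of_nat k) ` {..nat \<lceil>r + K\<rceil>})"
    proof
      fix z assume "z \<in> PR \<inter> cball 0 r"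
      then obtain x k where xk: "x \<in> X" "z = x + of_nat k" "norm z \<le> r" by (auto simp: PR_def)
      have "real k = norm (z - x)" using xk by simp
      also have "\<dots> \<le> r + K" using norm_triangle_ineq4[of z x] xk K by fastforce
      finally have "k \<le> nat \<lceil>r + K\<rceil>" by linarith
      thus "z \<in> (\<Union>x\<in>X. (\<lambda>k::nat. x + of_nat k) ` {..nat \<lceil>r + K\<rceil>})" using xk by blast
    qed
  qed (auto simp: X_def)
  have finL: "finite (PL \<inter> cball 0 r)" for r
  proof -
    have "PL \<inter> cball 0 r = uminus ` (PR \<inter> cball 0 r)" unfolding PL_eq by force
    thus ?thesis using finR by simp
  qed
  have farR: "Re z > 0" if z: "z \<in> PR" "norm z \<ge> 2 * K + 1" for z
  proof (rule ccontr)
    assume neg: "\<not> Re z > 0"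
    obtain x k where xk: "x \<in> X" "z = x + of_nat k" using z by (auto simp: PR_def)
    have "real k \<le> K" using neg xk K[of x] abs_Re_le_cmod[of x] by simp
    moreover have "norm z \<le> norm x + real k" using norm_triangle_ineq[of x "of_nat k"] xk by simp
    ultimately show False using z K[OF xk(1)] by linarith
  qed
  have farL: "Re z < 0" if "z \<in> PL" "norm z \<ge> 2 * K + 1" for z
    using that farR[of "- z"] by (auto simp: PL_eq)
  have disj: "PL \<inter> PR = {}"
  proof -
    have False if eq: "- x - of_nat k = y + of_nat l" and "x \<in> X" "y \<in> X" for x y :: complex and k l :: nat
    proof -
      have "x + y = - of_nat (k + l)" using eq by (simp add: algebra_simps) (metis add.commute add.left_commute add_diff_cancel_right' minus_add_cancel)
      hence "x + y \<in> \<int>\<^sub>\<le>\<^sub>0" by (simp only: minus_of_nat_in_nonpos_Ints)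
      thus False using assms[of x y] that by (auto simp: X_def)
    qed
    thus ?thesis by (auto simp: PL_def PR_def)
  qed
  obtain \<gamma> R0 where \<gamma>: "axis_contour \<gamma> R0" "\<And>z. z \<in> PR \<Longrightarrow> right_of_contour \<gamma> z" "\<And>z. z \<in> PL \<Longrightarrow> left_of_contour \<gamma> z"
    using separating_contour_exists[OF finL finR disj farR farL] by blast
  have "right_of_contour \<gamma> (x + of_nat k) \<and> left_of_contour \<gamma> (- x - of_nat k)" if "x \<in> X" for x k
    using that by (intro conjI \<gamma>) (auto simp: PR_def PL_def)
  thus ?thesis using \<gamma>(1) unfolding wilson_contour_def axis_contour_def X_def by blast
qed

section \<open>Integrals along the imaginary axis and its deformations\<close>

definition contour_int :: "(real \<Rightarrow> complex) \<Rightarrow> (complex \<Rightarrow> complex) \<Rightarrow> complex" where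
  "contour_int \<gamma> f = integral UNIV (\<lambda>s. f (\<gamma> s) * vector_derivative \<gamma> (at s))"

text \<open>Connects the parametrisation by \<open>s \<in> {- R..R}\<close> with path integrals, for which paths are parametrised by \<open>{0..1}\<close>.\<close>

lemma axis_contour_has_integral:
  assumes ax: "axis_contour \<gamma> R0" "R \<ge> R0" and f: "f holomorphic_on S" "open S" "\<gamma> ` {- R..R} \<subseteq> S"
  shows "((\<lambda>s. f (\<gamma> s) * vector_derivative \<gamma> (at s)) has_integral
            contour_integral (subpath (- R) R \<gamma>) f) {- R..R}"
proof -
  have R: "R > 0" using ax by (auto simp: axis_contour_def)
  define g where "g = subpath (- R) R \<gamma>"
  define h where "h = (\<lambda>s. f (\<gamma> s) * vector_derivative \<gamma> (at s))"
  define I where "I = contour_integral g f"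
  have "f contour_integrable_on g"
    using axis_contour_valid_path[OF ax] path_image_axis_contour[OF ax] f
    by (intro contour_integrable_holomorphic_simple[OF f(1,2)]) (auto simp: g_def)
  hence "(f has_contour_integral I) g" unfolding I_def by (rule has_contour_integral_integral)
  hence 1: "((\<lambda>x. f (g x) * vector_derivative g (at x)) has_integral I) {0..1}"
    by (simp add: has_contour_integral)
  obtain T where T: "finite T" "\<gamma> C1_differentiable_on {- R..R} - T"
    using axis_contour_C1[OF ax] by (auto simp: piecewise_C1_differentiable_on_def)
  define T' where "T' = (\<lambda>s. (s + R) / (2 * R)) ` T"
  have "((\<lambda>x. (2 * R) *\<^sub>R h (2 * R * x - R)) has_integral I) {0..1}"
  proof (rule has_integral_spike_finite[OF _ _ 1])
    show "finite T'" using T by (simp add: T'_def)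
    fix x assume x: "x \<in> {0..1} - T'"
    define s where "s = 2 * R * x - R"
    have "x = (s + R) / (2 * R)" using R by (simp add: s_def)
    hence "s \<notin> T" using x by (auto simp: T'_def)
    moreover have "2 * R * x \<le> 2 * R * 1" using x R by (intro mult_left_mono) auto
    hence "s \<in> {- R..R}" using x R by (auto simp: s_def)
    ultimately have "\<gamma> differentiable (at s)" using T(2) by (auto simp: C1_differentiable_on_eq)
    hence "(\<gamma> has_vector_derivative vector_derivative \<gamma> (at s)) (at (2 * R * x - R))"
      by (simp add: vector_derivative_works s_def)
    moreover have "((\<lambda>x. 2 * R * x - R) has_real_derivative 2 * R) (at x)"
      by (auto intro!: derivative_eq_intros)
    hence "((\<lambda>x. 2 * R * x - R) has_vector_derivative 2 * R) (at x)"
      by (simp only: has_real_derivative_iff_has_vector_derivative)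
    ultimately have "((\<gamma> \<circ> (\<lambda>x. 2 * R * x - R)) has_vector_derivative (2 * R) *\<^sub>R vector_derivative \<gamma> (at s)) (at x)"
      by (intro vector_diff_chain_at)
    moreover have "\<gamma> \<circ> (\<lambda>x. 2 * R * x - R) = g" by (simp add: g_def subpath_def fun_eq_iff)
    ultimately have "vector_derivative g (at x) = (2 * R) *\<^sub>R vector_derivative \<gamma> (at s)"
      by (simp add: vector_derivative_at)
    thus "(2 * R) *\<^sub>R h (2 * R * x - R) = f (g x) * vector_derivative g (at x)"
      by (simp add: h_def s_def g_def subpath_def)
  qed
  from has_integral_cmul[OF this, of "1 / (2 * R)"]
  have scaled: "((\<lambda>x. h ((2 * R) *\<^sub>R x + - R)) has_integral (1 / (2 * R)) *\<^sub>R I) {0..1}"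
    using R by simp
  have ends: "cbox ((- R - - R) /\<^sub>R (2 * R)) ((R - - R) /\<^sub>R (2 * R)) = {0..1}"
    and jac: "I /\<^sub>R (2 * R) ^ DIM(real) = (1 / (2 * R)) *\<^sub>R I"
    using R by (simp_all add: inverse_eq_divide)
  have "((\<lambda>x. h ((2 * R) *\<^sub>R x + - R)) has_integral I /\<^sub>R (2 * R) ^ DIM(real)) (cbox ((- R - - R) /\<^sub>R (2 * R)) ((R - - R) /\<^sub>R (2 * R)))"
    unfolding ends jac by (rule scaled)
  hence "(h has_integral I) (cbox (- R) R)"
    using has_integral_affinity_iff[of "2 * R" h "- R" I "- R" R] R by simp
  thus ?thesis by (simp add: h_def I_def g_def)
qed

lemma has_integral_reflect_UNIV:
  fixes f :: "real \<Rightarrow> 'a::banach"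
  assumes "(f has_integral i) UNIV"
  shows "((\<lambda>x. f (- x)) has_integral i) UNIV"
proof -
  from assms have int: "\<And>a b. f integrable_on {a..b}"
    and lim: "\<And>e. e > 0 \<Longrightarrow> \<exists>B>0. \<forall>a b. ball 0 B \<subseteq> {a..b} \<longrightarrow> norm (integral {a..b} f - i) < e"
    by (auto simp: has_integral_alt'[of f])
  show ?thesis
    unfolding has_integral_alt'[of "\<lambda>x. f (- x)"]
  proof (intro conjI allI impI)
    fix a b :: real
    have "(\<lambda>x. f (- x)) integrable_on {- (- a).. - (- b)}"
      using int[of "- b" "- a"] Henstock_Kurzweil_Integration.integrable_reflect_real[where f = f and a = "- b" and b = "- a"] by simp
    thus "(\<lambda>x. if x \<in> UNIV then f (- x) else 0) integrable_on cbox a b" by simp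
  next
    fix e :: real assume "e > 0"
    then obtain B where B: "B > 0" "\<And>a b. ball 0 B \<subseteq> {a..b} \<Longrightarrow> norm (integral {a..b} f - i) < e"
      using lim by blast
    have "norm (integral (cbox a b) (\<lambda>x. if x \<in> UNIV then f (- x) else 0) - i) < e"
      if "ball 0 B \<subseteq> cbox a b" for a b
    proof -
      have "ball 0 B \<subseteq> {- b..- a}"
      proof
        fix x :: real assume "x \<in> ball 0 B"
        hence "- x \<in> ball 0 B" by simp
        hence "- x \<in> cbox a b" using that by blast
        hence "a \<le> - x \<and> - x \<le> b" by simp
        thus "x \<in> {- b..- a}" by auto
      qed
      thus ?thesis using B(2)[of "- b" "- a"] Henstock_Kurzweil_Integration.integral_reflect_real[where f = f and a = "- b" and b = "- a"] by simp
    qed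
    thus "\<exists>B>0. \<forall>a b. ball 0 B \<subseteq> cbox a b \<longrightarrow>
        norm (integral (cbox a b) (\<lambda>x. if x \<in> UNIV then f (- x) else 0) - i) < e"
      using B(1) by blast
  qed
qed

lemma has_integral_exp_left: "((\<lambda>x::real. exp x) has_integral exp (- c)) {..- c}"
proof -
  have "((\<lambda>x. if x \<in> {c..} then exp (- 1 * x) else 0) has_integral exp (- 1 * c) / 1) UNIV"
    unfolding has_integral_restrict_UNIV by (rule has_integral_exp_minus_to_infinity) simp
  from has_integral_reflect_UNIV[OF this]
  have "((\<lambda>x. if - x \<in> {c..} then exp (- 1 * - x) else 0) has_integral exp (- c)) UNIV"
    by simp
  also have "(\<lambda>x. if - x \<in> {c..} then exp (- 1 * - x) else 0) = (\<lambda>x::real. if x \<in> {..- c} then exp x else 0)"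
    by auto
  finally have "((\<lambda>x. if x \<in> {..- c} then exp x else 0) has_integral exp (- c)) UNIV" .
  thus ?thesis unfolding has_integral_restrict_UNIV .
qed

lemma axis_contour_tails:
  assumes ax: "axis_contour \<gamma> R0" and f: "f holomorphic_on S" "open S" "range \<gamma> \<subseteq> S"
    and decay: "\<forall>s. \<bar>s\<bar> \<ge> R1 \<longrightarrow> norm (f (\<i> * of_real s)) \<le> C * exp (- \<bar>s\<bar>)"
    and R: "R > R0" "R \<ge> R1"
  defines "h \<equiv> \<lambda>s. f (\<gamma> s) * vector_derivative \<gamma> (at s)"
  shows "h integrable_on {R..}" "norm (integral {R..} h) \<le> C * exp (- R)"
    and "h integrable_on {..- R}" "norm (integral {..- R} h) \<le> C * exp (- R)"
proof -
  have R0: "R0 > 0" and on_axis: "\<And>s. \<bar>s\<bar> \<ge> R0 \<Longrightarrow> \<gamma> s = \<i> * of_real s" using ax by (auto simp: axis_contour_def)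
  have vd: "vector_derivative \<gamma> (at s) = \<i>" if "\<bar>s\<bar> > R0" for s
  proof (rule vector_derivative_at)
    have "open {s::real. \<bar>s\<bar> > R0}" by (intro open_Collect_less continuous_intros)
    moreover have "((\<lambda>s. \<i> * of_real s) has_vector_derivative \<i>) (at s)"
      by (auto intro!: derivative_eq_intros has_vector_derivative_real_field)
    ultimately show "(\<gamma> has_vector_derivative \<i>) (at s)"
      using that on_axis by (auto intro: has_vector_derivative_transform_within_open)
  qed
  have hb: "norm (h s) \<le> C * exp (- \<bar>s\<bar>)" if "\<bar>s\<bar> \<ge> R" for s
    using that vd[of s] on_axis[of s] decay[rule_format, of s] R R0 by (auto simp: h_def norm_mult)
  have hbr: "norm (h s) \<le> C * exp (- 1 * s)" if "s \<in> {R..}" for s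
    using hb[of s] that R R0 by auto
  have hbl: "norm (h s) \<le> C * exp s" if "s \<in> {..- R}" for s
    using hb[of s] that R R0 by auto
  have int: "h integrable_on {a..b}" for a b
  proof -
    define N where "N = Max {R, \<bar>a\<bar>, \<bar>b\<bar>}"
    have N: "N \<ge> R0" "\<bar>a\<bar> \<le> N" "\<bar>b\<bar> \<le> N" using R by (auto simp: N_def)
    have "h integrable_on {- N..N}"
      using axis_contour_has_integral[OF ax N(1) f(1,2)] f(3) unfolding h_def by blast
    thus ?thesis by (rule integrable_on_subinterval) (use N in auto)
  qed
  have e1: "((\<lambda>x. C * exp (- 1 * x)) has_integral C * (exp (- 1 * R) / 1)) {R..}"
    by (intro has_integral_mult_right has_integral_exp_minus_to_infinity) simp
  show r: "h integrable_on {R..}"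
  proof (rule integrable_on_all_intervals_integrable_bound)
    show "(\<lambda>x. C * exp (- 1 * x)) integrable_on {R..}" using e1 by blast
    show "(\<lambda>x. if x \<in> {R..} then h x else 0) integrable_on cbox a b" for a b
      unfolding integrable_restrict_Int[of "{R..}" h "cbox a b"] using int[of "max R a" b]
      by (simp add: Int_atLeastAtMostL1 inf_commute Int_atLeastAtMost)
  qed (rule hbr)
  show "norm (integral {R..} h) \<le> C * exp (- R)"
  proof -
    have "norm (integral {R..} h) \<le> integral {R..} (\<lambda>x. C * exp (- 1 * x))"
      by (rule integral_norm_bound_integral[OF r has_integral_integrable[OF e1] hbr])
    thus ?thesis unfolding integral_unique[OF e1] by simp
  qed
  have e2: "((\<lambda>x. C * exp x) has_integral C * exp (- R)) {..- R}"
    by (intro has_integral_mult_right has_integral_exp_left)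
  show l: "h integrable_on {..- R}"
  proof (rule integrable_on_all_intervals_integrable_bound)
    show "(\<lambda>x. C * exp x) integrable_on {..- R}" using e2 by blast
    show "(\<lambda>x. if x \<in> {..- R} then h x else 0) integrable_on cbox a b" for a b
      unfolding integrable_restrict_Int[of "{..- R}" h "cbox a b"] using int[of a "min b (- R)"]
      by (simp add: Int_atLeastAtMostR1 inf_commute Int_atLeastAtMost)
  qed (rule hbl)
  show "norm (integral {..- R} h) \<le> C * exp (- R)"
  proof -
    have "norm (integral {..- R} h) \<le> integral {..- R} (\<lambda>x. C * exp x)"
      by (rule integral_norm_bound_integral[OF l has_integral_integrable[OF e2] hbl])
    thus ?thesis unfolding integral_unique[OF e2] by simp
  qed
qed

lemma contour_int_limit:
  assumes ax: "axis_contour \<gamma> R0" and f: "f holomorphic_on S" "open S" "range \<gamma> \<subseteq> S"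
    and decay: "\<forall>s. \<bar>s\<bar> \<ge> R1 \<longrightarrow> norm (f (\<i> * of_real s)) \<le> C * exp (- \<bar>s\<bar>)"
  shows "(\<lambda>s. f (\<gamma> s) * vector_derivative \<gamma> (at s)) integrable_on UNIV"
    and "((\<lambda>R. contour_integral (subpath (- R) R \<gamma>) f) \<longlongrightarrow> contour_int \<gamma> f) at_top"
proof -
  define h where "h = (\<lambda>s. f (\<gamma> s) * vector_derivative \<gamma> (at s))"
  note tails = axis_contour_tails[OF ax f decay, folded h_def]
  have mid: "(h has_integral contour_integral (subpath (- R) R \<gamma>) f) {- R..R}" if "R \<ge> R0" for R
    using axis_contour_has_integral[OF ax that f(1,2)] f(3) by (auto simp: h_def)
  have split: "h integrable_on UNIV \<and> norm (contour_integral (subpath (- R) R \<gamma>) f - integral UNIV h) \<le> 2 * C * exp (- R)"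
    if R: "R > R0" "R \<ge> R1" for R
  proof -
    have R0: "R > 0" using R ax by (auto simp: axis_contour_def)
    have m: "h integrable_on {- R..R}" using mid[of R] R by auto
    have "{..- R} \<inter> {- R..R} = {- R}" using R0 by auto
    hence inter: "negligible ({..- R} \<inter> {- R..R})" by (metis negligible_sing)
    have "h integrable_on {..- R} \<union> {- R..R}"
      by (intro integrable_Un tails(3)[OF R] m inter)
    moreover have "{..- R} \<union> {- R..R} = {..R}" using R0 by auto
    moreover have "integral ({..- R} \<union> {- R..R}) h = integral {..- R} h + integral {- R..R} h"
      by (intro integral_Un tails(3)[OF R] m inter)
    ultimately have 1: "h integrable_on {..R}" "integral {..R} h = integral {..- R} h + integral {- R..R} h" by auto
    have sing: "{..R} \<inter> {R..} = {R}" by auto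
    have "h integrable_on {..R} \<union> {R..}"
      by (intro integrable_Un tails(1)[OF R] 1) (simp add: sing)
    moreover have "{..R} \<union> {R..} = UNIV" by auto
    moreover have "integral ({..R} \<union> {R..}) h = integral {..R} h + integral {R..} h"
      by (intro integral_Un tails(1)[OF R] 1) (simp add: sing)
    ultimately have 2: "h integrable_on UNIV" "integral UNIV h = integral {..- R} h + integral {- R..R} h + integral {R..} h"
      using 1 by auto
    have "contour_integral (subpath (- R) R \<gamma>) f - integral UNIV h = - integral {..- R} h - integral {R..} h"
      unfolding 2 using mid[of R] R by (simp add: integral_unique)
    also have "norm \<dots> \<le> norm (integral {..- R} h) + norm (integral {R..} h)"
      using norm_triangle_ineq4[of "- integral {..- R} h" "integral {R..} h"] by simp
    also have "\<dots> \<le> C * exp (- R) + C * exp (- R)" by (intro add_mono tails R)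
    finally show ?thesis using 2 by simp
  qed
  show "(\<lambda>s. f (\<gamma> s) * vector_derivative \<gamma> (at s)) integrable_on UNIV"
    using split[of "max R0 R1 + 1"] by (simp add: h_def)
  have "((\<lambda>R. contour_integral (subpath (- R) R \<gamma>) f - integral UNIV h) \<longlongrightarrow> 0) at_top"
  proof (rule Lim_null_comparison)
    show "\<forall>\<^sub>F R in at_top. norm (contour_integral (subpath (- R) R \<gamma>) f - integral UNIV h) \<le> 2 * C * exp (- R)"
      using eventually_gt_at_top[of "max R0 R1"]
    proof eventually_elim
      case (elim R)
      thus ?case using split[of R] by linarith
    qed
    have "((\<lambda>R::real. exp (- R)) \<longlongrightarrow> 0) at_top" by real_asymp
    thus "((\<lambda>R. 2 * C * exp (- R)) \<longlongrightarrow> 0) at_top" by (rule tendsto_mult_right_zero)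
  qed
  from tendsto_add[OF this tendsto_const[of "integral UNIV h"]]
  show "((\<lambda>R. contour_integral (subpath (- R) R \<gamma>) f) \<longlongrightarrow> contour_int \<gamma> f) at_top"
    by (simp add: contour_int_def h_def)
qed

section \<open>Shifting the contour by one unit\<close>

abbreviation upper_edge :: "real \<Rightarrow> real \<Rightarrow> complex" where
  "upper_edge R \<equiv> linepath (\<i> * of_real R + 1/2) (\<i> * of_real R - 1/2)"

abbreviation lower_edge :: "real \<Rightarrow> real \<Rightarrow> complex" where
  "lower_edge R \<equiv> linepath (- (\<i> * of_real R) - 1/2) (- (\<i> * of_real R) + 1/2)"

text \<open>
  This is the integral of \<open>f\<close> over the loop that goes up along \<open>\<gamma> + 1/2\<close> and down along \<open>\<gamma> - 1/2\<close>, both truncated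
  at height \<open>R\<close>; see \<open>contour_integral_shift_loop\<close>. In this form it can be compared for different \<open>R\<close>.
\<close>

definition shift_defect :: "(real \<Rightarrow> complex) \<Rightarrow> (complex \<Rightarrow> complex) \<Rightarrow> real \<Rightarrow> complex" where
  "shift_defect \<gamma> f R =
     contour_integral (subpath (- R) R \<gamma>) (\<lambda>t. f (t + 1/2) - f (t - 1/2)) +
     contour_integral (upper_edge R) f +
     contour_integral (lower_edge R) f"

definition end_strips :: "real \<Rightarrow> complex set" where
  "end_strips T = {z. \<bar>Re z\<bar> < 1 \<and> \<bar>Im z\<bar> > T}"

lemma unit_segment:
  assumes "z \<in> closed_segment (p + 1/2) (p - 1/2)"
  shows "Im z = Im p" "\<bar>Re z - Re p\<bar> \<le> 1/2"
proof -
  obtain u where u: "0 \<le> u" "u \<le> 1" "z = (1 - u) *\<^sub>R (p + 1/2) + u *\<^sub>R (p - 1/2)"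
    using assms unfolding in_segment by blast
  have "Re z = Re p + 1/2 - u" "Im z = Im p" unfolding u(3) by (simp_all add: algebra_simps)
  thus "Im z = Im p" "\<bar>Re z - Re p\<bar> \<le> 1/2" using u(1,2) by linarith+
qed

lemma shift_domain:
  assumes "f holomorphic_on S" "open S"
  shows "(\<lambda>t. f (t + 1/2) - f (t - 1/2)) holomorphic_on {t. t + 1/2 \<in> S \<and> t - 1/2 \<in> S}"
    and "open {t. t + 1/2 \<in> S \<and> t - 1/2 \<in> S}"
proof -
  show "(\<lambda>t. f (t + 1/2) - f (t - 1/2)) holomorphic_on {t. t + 1/2 \<in> S \<and> t - 1/2 \<in> S}"
    by (intro holomorphic_intros holomorphic_on_compose_gen[OF _ assms(1), unfolded o_def]) auto
  have "{t. t + 1/2 \<in> S \<and> t - 1/2 \<in> S} = (\<lambda>t. t + 1/2) -` S \<inter> (\<lambda>t. t - 1/2) -` S" by auto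
  moreover have "open ((\<lambda>t::complex. t + 1/2) -` S)" "open ((\<lambda>t::complex. t - 1/2) -` S)"
    by (intro open_vimage assms(2) continuous_intros)+
  ultimately show "open {t. t + 1/2 \<in> S \<and> t - 1/2 \<in> S}" by auto
qed

text \<open>
  Between the heights \<open>Rs\<close> and \<open>R\<close> the two translates bound rectangles on which \<open>f\<close> is holomorphic, and
  the integrals over their boundaries vanish. Primitives on the upper and the lower half strip make this explicit.
\<close>

lemma shift_defect_constant:
  assumes ax: "axis_contour \<gamma> R0" and f: "f holomorphic_on S" "open S" and strips: "end_strips T \<subseteq> S"
    and range: "\<And>s. \<gamma> s + 1/2 \<in> S \<and> \<gamma> s - 1/2 \<in> S"
    and R: "R0 < Rs" "0 \<le> T" "T < Rs" "Rs \<le> R"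
  shows "shift_defect \<gamma> f R = shift_defect \<gamma> f Rs"
proof -
  have R0: "R0 > 0" and on_axis: "\<And>s. \<bar>s\<bar> \<ge> R0 \<Longrightarrow> \<gamma> s = \<i> * of_real s" using ax by (auto simp: axis_contour_def)
  define D where "D = (\<lambda>t. f (t + 1/2) - f (t - 1/2))"
  define h where "h = (\<lambda>s. D (\<gamma> s) * vector_derivative \<gamma> (at s))"
  have h_int: "(h has_integral contour_integral (subpath (- r) r \<gamma>) D) {- r..r}" if "r \<ge> Rs" for r
    unfolding h_def D_def
    using axis_contour_has_integral[OF ax _ shift_domain[OF f], of r] that R range by auto
  have half: "\<exists>F. \<forall>z\<in>U. (F has_field_derivative f z) (at z)"
    if "U = {z. \<bar>Re z\<bar> < 1 \<and> Im z > T} \<or> U = {z. \<bar>Re z\<bar> < 1 \<and> Im z < - T}" for U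
  proof -
    have eq: "{z. \<bar>Re z\<bar> < 1 \<and> Im z > T} = {z. Re z > - 1} \<inter> {z. Re z < 1} \<inter> {z. Im z > T}"
      "{z. \<bar>Re z\<bar> < 1 \<and> Im z < - T} = {z. Re z > - 1} \<inter> {z. Re z < 1} \<inter> {z. Im z < - T}" by auto
    have U: "convex U" "open U"
      using that unfolding eq
      by (auto intro!: convex_Int convex_halfspace_Re_lt convex_halfspace_Re_gt convex_halfspace_Im_lt convex_halfspace_Im_gt
           open_Int open_halfspace_Re_lt open_halfspace_Re_gt open_halfspace_Im_lt open_halfspace_Im_gt)
    have "U \<subseteq> S" using strips that R by (auto simp: end_strips_def)
    hence "f holomorphic_on U" using f holomorphic_on_subset by blast
    from holomorphic_convex_primitive'[OF U this]
    obtain F where "\<And>z. z \<in> U \<Longrightarrow> (F has_field_derivative f z) (at z within U)" by blast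
    moreover have "at z within U = at z" if "z \<in> U" for z using at_within_open[OF that U(2)] .
    ultimately show ?thesis by (intro exI[of _ F] ballI) metis
  qed
  obtain F where F: "\<And>z. \<bar>Re z\<bar> < 1 \<Longrightarrow> Im z > T \<Longrightarrow> (F has_field_derivative f z) (at z)"
    using half[of "{z. \<bar>Re z\<bar> < 1 \<and> Im z > T}"] by auto
  obtain G where G: "\<And>z. \<bar>Re z\<bar> < 1 \<Longrightarrow> Im z < - T \<Longrightarrow> (G has_field_derivative f z) (at z)"
    using half[of "{z. \<bar>Re z\<bar> < 1 \<and> Im z < - T}"] by auto
  have top: "contour_integral (upper_edge r) f = F (\<i> * r - 1/2) - F (\<i> * r + 1/2)"
    if "r \<ge> Rs" for r
  proof -
    have "(f has_contour_integral F (pathfinish (upper_edge r)) - F (pathstart (upper_edge r)))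
       (upper_edge r)"
    proof (rule contour_integral_primitive[of "{z. \<bar>Re z\<bar> < 1 \<and> Im z > T}"])
      show "path_image (upper_edge r) \<subseteq> {z. \<bar>Re z\<bar> < 1 \<and> Im z > T}"
        using that R unit_segment[of _ "\<i> * r"] by fastforce
    qed (auto intro: has_field_derivative_at_within F)
    thus ?thesis by (simp add: contour_integral_unique)
  qed
  have bot: "contour_integral (lower_edge r) f = G (- (\<i> * r) + 1/2) - G (- (\<i> * r) - 1/2)"
    if "r \<ge> Rs" for r
  proof -
    have "(f has_contour_integral G (pathfinish (lower_edge r)) - G (pathstart (lower_edge r)))
       (lower_edge r)"
    proof (rule contour_integral_primitive[of "{z. \<bar>Re z\<bar> < 1 \<and> Im z < - T}"])
      show "path_image (lower_edge r) \<subseteq> {z. \<bar>Re z\<bar> < 1 \<and> Im z < - T}"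
        using that R unit_segment(1,2)[of _ "- (\<i> * r)"] by (fastforce simp: closed_segment_commute)
    qed (auto intro: has_field_derivative_at_within G)
    thus ?thesis by (simp add: contour_integral_unique)
  qed
  have vd: "(\<gamma> has_vector_derivative \<i>) (at s)" if "\<bar>s\<bar> > R0" for s
  proof -
    have "open {s::real. \<bar>s\<bar> > R0}" by (intro open_Collect_less continuous_intros)
    moreover have "((\<lambda>s. \<i> * of_real s) has_vector_derivative \<i>) (at s)"
      by (auto intro!: derivative_eq_intros has_vector_derivative_real_field)
    ultimately show ?thesis
      using that on_axis by (auto intro: has_vector_derivative_transform_within_open)
  qed
  have prim: "((\<lambda>s. P (\<gamma> s + 1/2) - P (\<gamma> s - 1/2)) has_vector_derivative h s) (at s)"
    if "\<bar>s\<bar> > R0" "(P has_field_derivative f (\<gamma> s + 1/2)) (at (\<gamma> s + 1/2))"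
       "(P has_field_derivative f (\<gamma> s - 1/2)) (at (\<gamma> s - 1/2))" for s P
  proof -
    have v: "((\<lambda>s. \<gamma> s + c) has_vector_derivative \<i>) (at s)" for c
      using vd[OF that(1)] by (auto intro!: derivative_eq_intros)
    have "((P \<circ> (\<lambda>s. \<gamma> s + 1/2)) has_vector_derivative \<i> * f (\<gamma> s + 1/2)) (at s)"
      by (intro field_vector_diff_chain_at v that(2))
    moreover have "((P \<circ> (\<lambda>s. \<gamma> s - 1/2)) has_vector_derivative \<i> * f (\<gamma> s - 1/2)) (at s)"
      using v[of "- 1/2"] by (intro field_vector_diff_chain_at that(3)) simp
    ultimately have "((\<lambda>s. P (\<gamma> s + 1/2) - P (\<gamma> s - 1/2)) has_vector_derivative
        (\<i> * f (\<gamma> s + 1/2) - \<i> * f (\<gamma> s - 1/2))) (at s)"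
      unfolding o_def by (rule has_vector_derivative_diff)
    moreover have "h s = \<i> * f (\<gamma> s + 1/2) - \<i> * f (\<gamma> s - 1/2)"
      using vector_derivative_at[OF vd[OF that(1)]] by (simp add: h_def D_def algebra_simps)
    ultimately show ?thesis by simp
  qed
  have up: "(h has_integral (F (\<i> * R + 1/2) - F (\<i> * R - 1/2)) - (F (\<i> * Rs + 1/2) - F (\<i> * Rs - 1/2))) {Rs..R}"
  proof -
    have "(h has_integral (F (\<gamma> R + 1/2) - F (\<gamma> R - 1/2)) - (F (\<gamma> Rs + 1/2) - F (\<gamma> Rs - 1/2))) {Rs..R}"
    proof (rule fundamental_theorem_of_calculus[OF R(4)])
      fix s assume s: "s \<in> {Rs..R}"
      have far: "R0 < \<bar>s\<bar>" using s R R0 by auto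
      hence "\<gamma> s = \<i> * of_real s" using on_axis[of s] by simp
      hence strip: "\<bar>Re (\<gamma> s + 1/2)\<bar> < 1" "T < Im (\<gamma> s + 1/2)" "\<bar>Re (\<gamma> s - 1/2)\<bar> < 1" "T < Im (\<gamma> s - 1/2)"
        using s R by simp_all
      show "((\<lambda>s. F (\<gamma> s + 1/2) - F (\<gamma> s - 1/2)) has_vector_derivative h s) (at s within {Rs..R})"
        by (rule has_vector_derivative_at_within[OF prim[OF far F[OF strip(1,2)] F[OF strip(3,4)]]])
    qed
    thus ?thesis using on_axis[of R] on_axis[of Rs] R R0 by simp
  qed
  have down: "(h has_integral (G (- (\<i> * Rs) + 1/2) - G (- (\<i> * Rs) - 1/2)) - (G (- (\<i> * R) + 1/2) - G (- (\<i> * R) - 1/2))) {- R..- Rs}"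
  proof -
    have "(h has_integral (G (\<gamma> (- Rs) + 1/2) - G (\<gamma> (- Rs) - 1/2)) - (G (\<gamma> (- R) + 1/2) - G (\<gamma> (- R) - 1/2))) {- R..- Rs}"
    proof (rule fundamental_theorem_of_calculus)
      fix s assume s: "s \<in> {- R..- Rs}"
      have far: "R0 < \<bar>s\<bar>" using s R R0 by auto
      hence "\<gamma> s = \<i> * of_real s" using on_axis[of s] by simp
      hence strip: "\<bar>Re (\<gamma> s + 1/2)\<bar> < 1" "Im (\<gamma> s + 1/2) < - T" "\<bar>Re (\<gamma> s - 1/2)\<bar> < 1" "Im (\<gamma> s - 1/2) < - T"
        using s R by simp_all
      show "((\<lambda>s. G (\<gamma> s + 1/2) - G (\<gamma> s - 1/2)) has_vector_derivative h s) (at s within {- R..- Rs})"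
        by (rule has_vector_derivative_at_within[OF prim[OF far G[OF strip(1,2)] G[OF strip(3,4)]]])
    qed (use R in auto)
    thus ?thesis using on_axis[of "- R"] on_axis[of "- Rs"] R R0 by simp
  qed
  have "(h has_integral ((G (- (\<i> * Rs) + 1/2) - G (- (\<i> * Rs) - 1/2)) - (G (- (\<i> * R) + 1/2) - G (- (\<i> * R) - 1/2))) +
      contour_integral (subpath (- Rs) Rs \<gamma>) D + ((F (\<i> * R + 1/2) - F (\<i> * R - 1/2)) - (F (\<i> * Rs + 1/2) - F (\<i> * Rs - 1/2)))) {- R..R}"
    using has_integral_combine[OF _ _ has_integral_combine[OF _ _ down h_int[of Rs]] up] R R0 by simp
  hence "contour_integral (subpath (- R) R \<gamma>) D =
      ((G (- (\<i> * Rs) + 1/2) - G (- (\<i> * Rs) - 1/2)) - (G (- (\<i> * R) + 1/2) - G (- (\<i> * R) - 1/2))) +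
      contour_integral (subpath (- Rs) Rs \<gamma>) D + ((F (\<i> * R + 1/2) - F (\<i> * R - 1/2)) - (F (\<i> * Rs + 1/2) - F (\<i> * Rs - 1/2)))"
    using h_int[OF R(4)] has_integral_unique by blast
  thus ?thesis unfolding shift_defect_def D_def[symmetric]
    using top[of R] top[of Rs] bot[of R] bot[of Rs] R by simp
qed

definition shift_loop :: "(real \<Rightarrow> complex) \<Rightarrow> real \<Rightarrow> real \<Rightarrow> complex" where
  "shift_loop \<gamma> R = ((+) (1/2) \<circ> subpath (- R) R \<gamma>) +++
     (upper_edge R +++
     (reversepath ((+) (- 1/2) \<circ> subpath (- R) R \<gamma>) +++
      lower_edge R))"

lemma shift_loop_closed:
  assumes ax: "axis_contour \<gamma> R0" and R: "R \<ge> R0"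
  shows "valid_path (shift_loop \<gamma> R)" "pathfinish (shift_loop \<gamma> R) = pathstart (shift_loop \<gamma> R)"
    and "path_image (shift_loop \<gamma> R) \<subseteq> (\<lambda>t. t + 1/2) ` range \<gamma> \<union> (\<lambda>t. t - 1/2) ` range \<gamma> \<union>
           {z. \<bar>Re z\<bar> \<le> 1/2 \<and> \<bar>Im z\<bar> = R}"
proof -
  have R0: "R > 0" and ends: "\<gamma> R = \<i> * of_real R" "\<gamma> (- R) = - (\<i> * of_real R)"
    using ax R by (auto simp: axis_contour_def)
  note vp = axis_contour_valid_path[OF ax R]
  have e: "pathstart ((+) c \<circ> subpath (- R) R \<gamma>) = c + \<gamma> (- R)"
    "pathfinish ((+) c \<circ> subpath (- R) R \<gamma>) = c + \<gamma> R" for c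
    by (simp_all add: pathstart_compose pathfinish_compose)
  show "valid_path (shift_loop \<gamma> R)" "pathfinish (shift_loop \<gamma> R) = pathstart (shift_loop \<gamma> R)"
    unfolding shift_loop_def using vp
    by (auto intro!: valid_path_join simp: e ends valid_path_translation_eq)
  have img: "path_image ((+) c \<circ> subpath (- R) R \<gamma>) \<subseteq> (\<lambda>t. t + c) ` range \<gamma>" for c
    by (auto simp: path_image_def subpath_def)
  have top: "path_image (upper_edge R) \<subseteq> {z. \<bar>Re z\<bar> \<le> 1/2 \<and> \<bar>Im z\<bar> = R}"
    using unit_segment[of _ "\<i> * of_real R"] R0 by fastforce
  have bot: "path_image (lower_edge R) \<subseteq> {z. \<bar>Re z\<bar> \<le> 1/2 \<and> \<bar>Im z\<bar> = R}"
    using unit_segment[of _ "- (\<i> * of_real R)"] R0 by (fastforce simp: closed_segment_commute)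
  have "path_image (shift_loop \<gamma> R) \<subseteq> path_image ((+) (1/2) \<circ> subpath (- R) R \<gamma>) \<union>
      (path_image (upper_edge R) \<union> (path_image ((+) (- 1/2) \<circ> subpath (- R) R \<gamma>) \<union>
       path_image (lower_edge R)))"
    unfolding shift_loop_def
    by (intro order_trans[OF path_image_join_subset] Un_mono order_refl) (simp add: path_image_reversepath)
  also have "\<dots> \<subseteq> (\<lambda>t. t + 1/2) ` range \<gamma> \<union> (\<lambda>t. t - 1/2) ` range \<gamma> \<union> {z. \<bar>Re z\<bar> \<le> 1/2 \<and> \<bar>Im z\<bar> = R}"
    using img[of "1/2"] img[of "- 1/2"] top bot by auto
  finally show "path_image (shift_loop \<gamma> R) \<subseteq> (\<lambda>t. t + 1/2) ` range \<gamma> \<union> (\<lambda>t. t - 1/2) ` range \<gamma> \<union>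
           {z. \<bar>Re z\<bar> \<le> 1/2 \<and> \<bar>Im z\<bar> = R}" .
qed

lemma contour_integral_shift_loop:
  assumes ax: "axis_contour \<gamma> R0" and R: "R \<ge> R0"
    and f: "f holomorphic_on S" "open S" "path_image (shift_loop \<gamma> R) \<subseteq> S"
  shows "contour_integral (shift_loop \<gamma> R) f = shift_defect \<gamma> f R"
proof -
  have R0: "R > 0" and ends: "\<gamma> R = \<i> * of_real R" "\<gamma> (- R) = - (\<i> * of_real R)"
    using ax R by (auto simp: axis_contour_def)
  define g where "g = subpath (- R) R \<gamma>"
  have vg: "valid_path g" using axis_contour_valid_path[OF ax R] by (simp add: g_def)
  have g_ends: "pathstart g = - (\<i> * of_real R)" "pathfinish g = \<i> * of_real R" using ends by (auto simp: g_def)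
  define l1 where "l1 = upper_edge R"
  define l2 where "l2 = lower_edge R"
  define p where "p = (+) (1/2) \<circ> g"
  define q where "q = (+) (- 1/2) \<circ> g"
  have loop: "shift_loop \<gamma> R = p +++ (l1 +++ (reversepath q +++ l2))"
    by (simp add: shift_loop_def p_def q_def l1_def l2_def g_def)
  have vp: "valid_path p" "valid_path q" "valid_path l1" "valid_path l2"
    by (auto simp: p_def q_def l1_def l2_def valid_path_translation_eq vg)
  have pe: "pathstart p = - (\<i> * R) + 1/2" "pathfinish p = \<i> * R + 1/2"
    "pathstart q = - (\<i> * R) - 1/2" "pathfinish q = \<i> * R - 1/2"
    "pathstart l1 = \<i> * R + 1/2" "pathfinish l1 = \<i> * R - 1/2"
    "pathstart l2 = - (\<i> * R) - 1/2" "pathfinish l2 = - (\<i> * R) + 1/2"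
    by (auto simp: p_def q_def l1_def l2_def pathstart_compose pathfinish_compose g_ends)
  have im: "path_image p \<subseteq> S" "path_image q \<subseteq> S" "path_image l1 \<subseteq> S" "path_image l2 \<subseteq> S"
    using f(3) by (auto simp: loop path_image_join pe)
  have ci: "f contour_integrable_on x" if "valid_path x" "path_image x \<subseteq> S" for x
    by (rule contour_integrable_holomorphic_simple[OF f(1,2) that])
  have "contour_integral (shift_loop \<gamma> R) f =
      contour_integral p f + (contour_integral l1 f + (- contour_integral q f + contour_integral l2 f))"
    unfolding loop using vp im ci
    by (simp add: contour_integral_join contour_integrable_join contour_integral_reversepath
          contour_integrable_reversepath pe valid_path_join)
  also have "contour_integral p f = contour_integral g (\<lambda>t. f (t + 1/2))"
    by (simp add: p_def contour_integral_translate)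
  also have "contour_integral q f = contour_integral g (\<lambda>t. f (t - 1/2))"
    by (simp add: q_def contour_integral_translate)
  finally have 1: "contour_integral (shift_loop \<gamma> R) f =
      contour_integral g (\<lambda>t. f (t + 1/2)) - contour_integral g (\<lambda>t. f (t - 1/2)) + contour_integral l1 f + contour_integral l2 f"
    by simp
  have "(\<lambda>t. f (t + 1/2)) contour_integrable_on g" "(\<lambda>t. f (t - 1/2)) contour_integrable_on g"
    using ci[OF vp(1) im(1)] ci[OF vp(2) im(2)] contour_integrable_translate[of f "- 1/2" g]
    by (auto simp: p_def q_def contour_integrable_translate)
  hence "contour_integral g (\<lambda>t. f (t + 1/2) - f (t - 1/2)) =
      contour_integral g (\<lambda>t. f (t + 1/2)) - contour_integral g (\<lambda>t. f (t - 1/2))"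
    by (rule contour_integral_diff)
  thus ?thesis using 1 by (simp add: shift_defect_def g_def l1_def l2_def)
qed

text \<open>
  The condition on a pole \<open>z\<close> of \<open>f\<close> that the loop does not wind around it: \<open>z\<close> lies to the same side of
  both \<open>\<gamma> + 1/2\<close> and \<open>\<gamma> - 1/2\<close>.
\<close>

definition same_side :: "(real \<Rightarrow> complex) \<Rightarrow> complex \<Rightarrow> bool" where
  "same_side \<gamma> z \<longleftrightarrow> right_of_contour \<gamma> (z - 1/2) \<and> right_of_contour \<gamma> (z + 1/2) \<or>
                     left_of_contour \<gamma> (z - 1/2) \<and> left_of_contour \<gamma> (z + 1/2)"

lemma contour_integral_reciprocal_valid:
  assumes "valid_path g" "p \<notin> path_image g"
  shows "contour_integral g (\<lambda>w. 1 / (w - p)) = 2 * of_real pi * \<i> * winding_number g p"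
    and "(\<lambda>w. 1 / (w - p)) contour_integrable_on g"
proof -
  show "contour_integral g (\<lambda>w. 1 / (w - p)) = 2 * of_real pi * \<i> * winding_number g p"
    using winding_number_valid_path[OF assms] by simp
  show "(\<lambda>w. 1 / (w - p)) contour_integrable_on g"
    by (rule contour_integrable_holomorphic_simple[of _ "- {p}"])
       (use assms in \<open>auto intro!: holomorphic_intros\<close>)
qed

text \<open>
  The value is \<open>2\<pi>\<i>\<close> times the winding number of the loop around \<open>z\<close>. It does not depend on the height, so it
  is enough to see that it tends to zero: closing both translates by the left semicircle, the winding numbers cancel since
  \<open>z - 1/2\<close> and \<open>z + 1/2\<close> are on the same side of \<open>\<gamma>\<close>. What remains is the integral of
  \<open>1 / ((t - q) (t - p))\<close> over the semicircle, of order \<open>1/R\<close>, and the two edges.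
\<close>

lemma shift_defect_reciprocal_zero:
  assumes ax: "axis_contour \<gamma> R0" and side: "same_side \<gamma> z" and z: "z \<notin> end_strips T"
    and Rs: "R0 < Rs" "0 \<le> T" "T < Rs"
  shows "shift_defect \<gamma> (\<lambda>w. 1 / (w - z)) Rs = 0"
proof -
  define f where "f = (\<lambda>w. 1 / (w - z))"
  define p where "p = z - 1/2"
  define q where "q = z + 1/2"
  have R0: "R0 > 0" using ax by (simp add: axis_contour_def)
  have off: "p \<notin> range \<gamma>" "q \<notin> range \<gamma>"
    using side by (auto simp: same_side_def right_of_contour_def left_of_contour_def p_def q_def)
  have hol: "f holomorphic_on - {z}" by (auto simp: f_def intro!: holomorphic_intros)
  have rg: "\<gamma> s + 1/2 \<in> - {z} \<and> \<gamma> s - 1/2 \<in> - {z}" for s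
    using off by (auto simp: p_def q_def)
  have const: "shift_defect \<gamma> f R = shift_defect \<gamma> f Rs" if "R \<ge> Rs" for R
    by (rule shift_defect_constant[OF ax hol _ _ rg Rs that]) (use z in auto)
  obtain \<sigma> where \<sigma>: "\<And>y. y \<in> {p, q} \<Longrightarrow> eventually (\<lambda>R. winding_number (subpath (- R) R \<gamma> +++ left_arc R) y = \<sigma>) at_top"
  proof -
    from side consider "right_of_contour \<gamma> p \<and> right_of_contour \<gamma> q" | "left_of_contour \<gamma> p \<and> left_of_contour \<gamma> q"
      by (auto simp: same_side_def p_def q_def)
    thus ?thesis
    proof cases
      case 1
      hence sided: "\<forall>y\<in>{p, q}. right_of_contour \<gamma> y" by simp
      have "eventually (\<lambda>R. winding_number (subpath (- R) R \<gamma> +++ left_arc R) y = 0) at_top"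
        if "y \<in> {p, q}" for y
        using bspec[OF sided that] unfolding right_of_contour_def left_arc_def by (rule conjunct2)
      thus ?thesis by (rule that)
    next
      case 2
      hence sided: "\<forall>y\<in>{p, q}. left_of_contour \<gamma> y" by simp
      have "eventually (\<lambda>R. winding_number (subpath (- R) R \<gamma> +++ left_arc R) y = 1) at_top"
        if "y \<in> {p, q}" for y
        using bspec[OF sided that] unfolding left_of_contour_def left_arc_def by (rule conjunct2)
      thus ?thesis by (rule that)
    qed
  qed
  \<comment> \<open>the semicircle has length \<open>\<pi>R\<close>, and both \<open>z - 1/2\<close> and \<open>z + 1/2\<close> have distance at least \<open>R - norm z - 1\<close> from it\<close>
  define B where "B = (\<lambda>R. 1 / (R - norm z - 1)\<^sup>2 * R * pi + 2 / (R - norm z - 1))"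
  have "eventually (\<lambda>R. norm (shift_defect \<gamma> f Rs) \<le> B R) at_top"
    using \<sigma>[of p, simplified] \<sigma>[of q, simplified] eventually_ge_at_top[of Rs] eventually_gt_at_top[of "norm z + 1"]
  proof eventually_elim
    case (elim R)
    have Rpos: "R > 0" using elim norm_ge_zero[of z] by linarith
    have R: "R \<ge> R0" using elim Rs by auto
    define g where "g = subpath (- R) R \<gamma>"
    have vg: "valid_path g" using axis_contour_valid_path[OF ax R] by (simp add: g_def)
    have gf: "pathfinish g = \<i> * R" using ax R by (auto simp: g_def axis_contour_def)
    have g_off: "y \<notin> path_image g" if "y \<in> {p, q}" for y
      using off that by (auto simp: g_def path_image_def subpath_def)
    have small: "norm y \<le> norm z + 1/2" if "y \<in> {p, q}" for y
      using that norm_triangle_ineq4[of z "1/2"] norm_triangle_ineq[of z "1/2"] by (auto simp: p_def q_def)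
    have arc_off: "y \<notin> path_image (left_arc R)" if "y \<in> {p, q}" for y
      using left_semicircle_image(1)[of y R] small[OF that] elim Rpos by auto
    have wn: "winding_number g y = \<sigma> - winding_number (left_arc R) y" if "y \<in> {p, q}" for y
    proof -
      have "winding_number (g +++ left_arc R) y = winding_number g y + winding_number (left_arc R) y"
        using vg g_off[OF that] arc_off[OF that] gf by (intro winding_number_join) (auto simp: valid_path_imp_path)
      moreover have "winding_number (g +++ left_arc R) y = \<sigma>" using elim that by (auto simp: g_def)
      ultimately show ?thesis by simp
    qed
    have "contour_integral g (\<lambda>t. f (t + 1/2) - f (t - 1/2)) = contour_integral g (\<lambda>t. 1 / (t - p) - 1 / (t - q))"
    proof -
      have "f (t + 1/2) = 1 / (t - p)" "f (t - 1/2) = 1 / (t - q)" for t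
        unfolding f_def p_def q_def by (rule arg_cong[where f = "\<lambda>x. 1 / x"], simp)+
      thus ?thesis by (simp only:)
    qed
    also have "\<dots> = contour_integral g (\<lambda>t. 1 / (t - p)) - contour_integral g (\<lambda>t. 1 / (t - q))"
      by (intro contour_integral_diff contour_integral_reciprocal_valid vg g_off) auto
    also have "\<dots> = 2 * of_real pi * \<i> * (winding_number (left_arc R) q - winding_number (left_arc R) p)"
    proof -
      have "contour_integral g (\<lambda>w. 1 / (w - y)) = 2 * of_real pi * \<i> * (\<sigma> - winding_number (left_arc R) y)"
        if "y \<in> {p, q}" for y
        using contour_integral_reciprocal_valid(1)[OF vg g_off[OF that]] wn[OF that] by simp
      from this[of p] this[of q] show ?thesis by (simp only: insertI1 insertI2) (simp add: right_diff_distrib)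
    qed
    also have "\<dots> = contour_integral (left_arc R) (\<lambda>t. 1 / (t - q)) - contour_integral (left_arc R) (\<lambda>t. 1 / (t - p))"
      using contour_integral_reciprocal_valid(1)[OF valid_path_arcs(2) arc_off[of p]]
            contour_integral_reciprocal_valid(1)[OF valid_path_arcs(2) arc_off[of q]]
      by (simp only: insertI1 insertI2 right_diff_distrib)
    also have "\<dots> = contour_integral (left_arc R) (\<lambda>t. 1 / (t - q) - 1 / (t - p))"
      by (intro contour_integral_diff[symmetric] contour_integral_reciprocal_valid valid_path_arcs arc_off) auto
    finally have mid: "contour_integral g (\<lambda>t. f (t + 1/2) - f (t - 1/2)) = contour_integral (left_arc R) (\<lambda>t. 1 / (t - q) - 1 / (t - p))" .
    have Rz: "R - norm z - 1 > 0" using elim by simp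
    have "norm (contour_integral (left_arc R) (\<lambda>t. 1 / (t - q) - 1 / (t - p))) \<le> 1 / (R - norm z - 1)\<^sup>2 * R * \<bar>3 * pi / 2 - pi / 2\<bar>"
      unfolding left_arc_def
    proof (rule contour_integral_bound_part_circlepath)
      show "(\<lambda>t. 1 / (t - q) - 1 / (t - p)) contour_integrable_on part_circlepath 0 R (pi / 2) (3 * pi / 2)"
        unfolding left_arc_def[symmetric]
        by (intro contour_integrable_diff contour_integral_reciprocal_valid valid_path_arcs arc_off) auto
      fix t assume "t \<in> path_image (part_circlepath 0 R (pi / 2) (3 * pi / 2))"
      hence t: "norm t = R" using left_semicircle_image(1)[of t R] Rpos by (simp add: left_arc_def)
      have d: "norm (t - y) \<ge> R - norm z - 1" if "y \<in> {p, q}" for y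
        using norm_triangle_ineq2[of t y] small[OF that] t by simp
      have nz: "t \<noteq> p" "t \<noteq> q" using d[of p] d[of q] Rz by auto
      have "1 / (t - q) - 1 / (t - p) = (q - p) / ((t - q) * (t - p))"
        using nz by (simp add: divide_simps)
      also have "q - p = 1" by (simp add: p_def q_def)
      finally have "1 / (t - q) - 1 / (t - p) = 1 / ((t - q) * (t - p))" .
      hence "norm (1 / (t - q) - 1 / (t - p)) = 1 / (norm (t - q) * norm (t - p))"
        by (simp add: norm_divide norm_mult)
      also have "\<dots> \<le> 1 / (R - norm z - 1)\<^sup>2"
        unfolding power2_eq_square using d[of p] d[of q] Rz nz
        by (intro divide_left_mono mult_mono mult_pos_pos) auto
      finally show "norm (1 / (t - q) - 1 / (t - p)) \<le> 1 / (R - norm z - 1)\<^sup>2" .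
    qed (use Rpos in auto)
    hence b1: "norm (contour_integral g (\<lambda>t. f (t + 1/2) - f (t - 1/2))) \<le> 1 / (R - norm z - 1)\<^sup>2 * R * pi"
      unfolding mid by simp
    have seg: "norm (contour_integral (linepath u v) f) \<le> 1 / (R - norm z - 1)"
      if uv: "norm (v - u) = 1" "\<And>w. w \<in> closed_segment u v \<Longrightarrow> norm w \<ge> R" for u v
    proof -
      have far: "norm (w - z) \<ge> R - norm z - 1" if "w \<in> closed_segment u v" for w
        using norm_triangle_ineq2[of w z] uv(2)[OF that] by simp
      hence "z \<notin> closed_segment u v" using Rz by fastforce
      hence "f contour_integrable_on linepath u v"
        unfolding f_def by (intro contour_integral_reciprocal_valid) auto
      moreover have "norm (f w) \<le> 1 / (R - norm z - 1)" if "w \<in> closed_segment u v" for w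
        unfolding f_def norm_divide using far[OF that] Rz by (simp add: frac_le)
      ultimately have "norm (contour_integral (linepath u v) f) \<le> 1 / (R - norm z - 1) * norm (v - u)"
        using Rz by (intro contour_integral_bound_linepath) auto
      thus ?thesis using uv by simp
    qed
    have b2: "norm (contour_integral (upper_edge R) f) \<le> 1 / (R - norm z - 1)"
    proof (rule seg)
      fix w assume "w \<in> closed_segment (\<i> * R + 1/2) (\<i> * R - 1/2)"
      thus "norm w \<ge> R" using unit_segment(1)[of w "\<i> * R"] abs_Im_le_cmod[of w] Rpos by auto
    qed auto
    have b3: "norm (contour_integral (lower_edge R) f) \<le> 1 / (R - norm z - 1)"
    proof (rule seg)
      fix w assume "w \<in> closed_segment (- (\<i> * R) - 1/2) (- (\<i> * R) + 1/2)"
      thus "norm w \<ge> R" using unit_segment(1)[of w "- (\<i> * R)"] abs_Im_le_cmod[of w] Rpos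
        by (auto simp: closed_segment_commute)
    qed auto
    have triangle: "norm (x + y + v) \<le> norm x + norm y + norm v" for x y v :: complex
      using norm_triangle_ineq[of "x + y" v] norm_triangle_ineq[of x y] by linarith
    have "norm (shift_defect \<gamma> f R) \<le> 1 / (R - norm z - 1)\<^sup>2 * R * pi + 1 / (R - norm z - 1) + 1 / (R - norm z - 1)"
      unfolding shift_defect_def g_def[symmetric]
      by (rule order_trans[OF triangle]) (intro add_mono b1 b2 b3)
    hence "norm (shift_defect \<gamma> f R) \<le> B R" by (simp add: B_def)
    thus ?case using const[OF elim(3)] by simp
  qed
  moreover have "(B \<longlongrightarrow> 0) at_top"
  proof -
    have "((\<lambda>R::real. 1 / (R - c - 1)\<^sup>2 * R * pi + 2 / (R - c - 1)) \<longlongrightarrow> 0) at_top" for c :: real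
      by real_asymp
    thus ?thesis unfolding B_def .
  qed
  ultimately have "((\<lambda>_. shift_defect \<gamma> f Rs) \<longlongrightarrow> 0) (at_top :: real filter)"
    by (rule Lim_null_comparison)
  from tendsto_unique[OF trivial_limit_at_top_linorder tendsto_const this]
  show ?thesis by (simp add: f_def)
qed

text \<open>
  Cauchy's theorem for the loop between the two translates: by assumption it winds around no singularity,
  and the horizontal edges contribute less and less by the decay of \<open>H\<close>.
\<close>

theorem contour_int_shift_invariant:
  assumes ax: "axis_contour \<gamma> R0" and H: "H holomorphic_on S" "open S"
    and strips: "end_strips T \<subseteq> S" and T: "T \<ge> 0"
    and poles: "\<And>z. z \<notin> S \<Longrightarrow> same_side \<gamma> z"
    and decay: "\<And>t. \<bar>Re t\<bar> \<le> 1/2 \<Longrightarrow> \<bar>Im t\<bar> \<ge> T \<Longrightarrow> norm (H t) \<le> C * exp (- \<bar>Im t\<bar>)"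
  shows "contour_int \<gamma> (\<lambda>t. H (t + 1/2) - H (t - 1/2)) = 0"
proof -
  define D where "D = (\<lambda>t. H (t + 1/2) - H (t - 1/2))"
  define Rs where "Rs = max R0 T + 1"
  have Rs: "R0 < Rs" "T < Rs" by (auto simp: Rs_def)
  have R0: "R0 > 0" using ax by (simp add: axis_contour_def)
  have range: "\<gamma> s + 1/2 \<in> S \<and> \<gamma> s - 1/2 \<in> S" for s
    using poles[of "\<gamma> s + 1/2"] poles[of "\<gamma> s - 1/2"]
    by (auto simp: same_side_def right_of_contour_def left_of_contour_def)
  have image: "path_image (shift_loop \<gamma> Rs) \<subseteq> S"
  proof -
    have "{z. \<bar>Re z\<bar> \<le> 1/2 \<and> \<bar>Im z\<bar> = Rs} \<subseteq> S" using strips Rs by (auto simp: end_strips_def)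
    moreover have "(\<lambda>t. t + 1/2) ` range \<gamma> \<subseteq> S" "(\<lambda>t. t - 1/2) ` range \<gamma> \<subseteq> S"
      using range by auto
    ultimately show ?thesis using shift_loop_closed(3)[OF ax, of Rs] Rs(1) by (meson Un_least less_imp_le order_trans)
  qed
  have "(H has_contour_integral 0) (shift_loop \<gamma> Rs)"
  proof (rule Cauchy_theorem_global[OF H(2,1)])
    show "winding_number (shift_loop \<gamma> Rs) w = 0" if w: "w \<notin> S" for w
    proof -
      have off: "w \<notin> path_image (shift_loop \<gamma> Rs)" using image w by blast
      have "contour_integral (shift_loop \<gamma> Rs) (\<lambda>v. 1 / (v - w)) = shift_defect \<gamma> (\<lambda>v. 1 / (v - w)) Rs"
        by (rule contour_integral_shift_loop[OF ax, of _ _ "- {w}"])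
           (use Rs off in \<open>auto intro!: holomorphic_intros\<close>)
      also have "\<dots> = 0"
        by (rule shift_defect_reciprocal_zero[OF ax poles[OF w] _ Rs(1) T Rs(2)]) (use w strips in auto)
      finally show ?thesis
        using winding_number_valid_path[OF shift_loop_closed(1)[OF ax] off] Rs by simp
    qed
  qed (use shift_loop_closed(1,2)[OF ax, of Rs] Rs image in auto)
  hence "shift_defect \<gamma> H Rs = 0"
    using contour_integral_shift_loop[OF ax _ H image] Rs by (simp add: contour_integral_unique)
  hence zero: "shift_defect \<gamma> H R = 0" if "R \<ge> Rs" for R
    using shift_defect_constant[OF ax H strips range Rs(1) T Rs(2) that] by simp
  have C: "C \<ge> 0"
  proof -
    have "0 \<le> norm (H (\<i> * of_real T))" by simp
    also have "\<dots> \<le> C * exp (- \<bar>T\<bar>)" using decay[of "\<i> * of_real T"] T by simp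
    finally have "0 \<le> C * exp (- \<bar>T\<bar>)" .
    thus ?thesis by (simp add: zero_le_mult_iff)
  qed
  have bound: "norm (contour_integral (subpath (- R) R \<gamma>) D) \<le> 2 * C * exp (- R)" if R: "R \<ge> Rs" for R
  proof -
    have Rpos: "R > 0" "R \<ge> T" using R R0 Rs by auto
    have seg: "norm (contour_integral (linepath u v) H) \<le> C * exp (- R)"
      if uv: "norm (v - u) = 1" "\<And>w. w \<in> closed_segment u v \<Longrightarrow> \<bar>Im w\<bar> = R \<and> \<bar>Re w\<bar> \<le> 1/2" for u v
    proof -
      have "closed_segment u v \<subseteq> S" using uv(2) strips R Rs by (fastforce simp: end_strips_def)
      hence "H contour_integrable_on linepath u v"
        by (intro contour_integrable_holomorphic_simple[OF H]) auto
      moreover have "norm (H w) \<le> C * exp (- R)" if "w \<in> closed_segment u v" for w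
        using decay[of w] uv(2)[OF that] Rpos by auto
      ultimately have "norm (contour_integral (linepath u v) H) \<le> C * exp (- R) * norm (v - u)"
        using C by (intro contour_integral_bound_linepath) auto
      thus ?thesis using uv by simp
    qed
    have b2: "norm (contour_integral (upper_edge R) H) \<le> C * exp (- R)"
    proof (rule seg)
      fix w assume "w \<in> closed_segment (\<i> * R + 1/2) (\<i> * R - 1/2)"
      thus "\<bar>Im w\<bar> = R \<and> \<bar>Re w\<bar> \<le> 1/2" using unit_segment[of w "\<i> * R"] Rpos by auto
    qed auto
    have b3: "norm (contour_integral (lower_edge R) H) \<le> C * exp (- R)"
    proof (rule seg)
      fix w assume "w \<in> closed_segment (- (\<i> * R) - 1/2) (- (\<i> * R) + 1/2)"
      thus "\<bar>Im w\<bar> = R \<and> \<bar>Re w\<bar> \<le> 1/2" using unit_segment[of w "- (\<i> * R)"] Rpos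
        by (auto simp: closed_segment_commute)
    qed auto
    have "contour_integral (subpath (- R) R \<gamma>) D =
        - contour_integral (upper_edge R) H
        - contour_integral (lower_edge R) H"
    proof -
      have "x = - y - v" if "x + y + v = 0" for x y v :: complex using that by algebra
      thus ?thesis using zero[OF R] unfolding shift_defect_def D_def by blast
    qed
    also have "norm \<dots> \<le> C * exp (- R) + C * exp (- R)"
      by (rule order_trans[OF norm_triangle_ineq4]) (use b2 b3 in simp)
    finally show ?thesis by simp
  qed
  have lim0: "((\<lambda>R. contour_integral (subpath (- R) R \<gamma>) D) \<longlongrightarrow> 0) at_top"
  proof (rule Lim_null_comparison)
    show "\<forall>\<^sub>F R in at_top. norm (contour_integral (subpath (- R) R \<gamma>) D) \<le> 2 * C * exp (- R)"
      using eventually_ge_at_top[of Rs] by eventually_elim (rule bound)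
    have "((\<lambda>R::real. exp (- R)) \<longlongrightarrow> 0) at_top" by real_asymp
    thus "((\<lambda>R. 2 * C * exp (- R)) \<longlongrightarrow> 0) at_top" by (rule tendsto_mult_right_zero)
  qed
  have "((\<lambda>R. contour_integral (subpath (- R) R \<gamma>) D) \<longlongrightarrow> contour_int \<gamma> D) at_top"
  proof (rule contour_int_limit[OF ax])
    show "D holomorphic_on {t. t + 1/2 \<in> S \<and> t - 1/2 \<in> S}" "open {t. t + 1/2 \<in> S \<and> t - 1/2 \<in> S}"
      unfolding D_def by (rule shift_domain[OF H])+
    show "range \<gamma> \<subseteq> {t. t + 1/2 \<in> S \<and> t - 1/2 \<in> S}" using range by auto
    show "\<forall>s. \<bar>s\<bar> \<ge> T \<longrightarrow> norm (D (\<i> * of_real s)) \<le> 2 * C * exp (- \<bar>s\<bar>)"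
    proof (intro allI impI)
      fix s :: real assume s: "\<bar>s\<bar> \<ge> T"
      have "norm (D (\<i> * of_real s)) \<le> norm (H (\<i> * of_real s + 1/2)) + norm (H (\<i> * of_real s - 1/2))"
        unfolding D_def by (rule norm_triangle_ineq4)
      also have "\<dots> \<le> C * exp (- \<bar>s\<bar>) + C * exp (- \<bar>s\<bar>)"
        using decay[of "\<i> * of_real s + 1/2"] decay[of "\<i> * of_real s - 1/2"] s by (intro add_mono) auto
      finally show "norm (D (\<i> * of_real s)) \<le> 2 * C * exp (- \<bar>s\<bar>)" by simp
    qed
  qed
  with lim0 have "contour_int \<gamma> D = 0" using tendsto_unique by force
  thus ?thesis by (simp add: D_def)
qed

text \<open>
  If a convex domain of holomorphy contains the deformed part of the contour, a primitive on it shows that the deformation does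
  not change the integral.
\<close>

lemma contour_int_straighten:
  assumes ax: "axis_contour \<gamma> R0" and f: "f holomorphic_on S" "open S" "range \<gamma> \<subseteq> S"
    and U: "convex U" "open U" "U \<subseteq> S" "\<gamma> ` {- R0..R0} \<subseteq> U" and axis: "\<And>s. \<i> * of_real s \<in> S"
    and decay: "\<forall>s. \<bar>s\<bar> \<ge> R1 \<longrightarrow> norm (f (\<i> * of_real s)) \<le> C * exp (- \<bar>s\<bar>)"
  shows "contour_int \<gamma> f = contour_int (\<lambda>s. \<i> * of_real s) f"
proof -
  have R0: "R0 > 0" and on_axis: "\<And>s. \<bar>s\<bar> \<ge> R0 \<Longrightarrow> \<gamma> s = \<i> * of_real s"
    using ax by (auto simp: axis_contour_def)
  define \<delta> where "\<delta> = (\<lambda>s. \<i> * complex_of_real s)"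
  have ax\<delta>: "axis_contour \<delta> R0" unfolding axis_contour_def \<delta>_def using R0 axis_C1 by auto
  have "f holomorphic_on U" using f U holomorphic_on_subset by blast
  from holomorphic_convex_primitive'[OF U(1,2) this]
  obtain F where F: "\<And>z. z \<in> U \<Longrightarrow> (F has_field_derivative f z) (at z within U)" by blast
  have ends: "\<gamma> R0 = \<i> * of_real R0" "\<gamma> (- R0) = \<i> * of_real (- R0)" using on_axis R0 by auto
  have \<delta>_in: "\<delta> ` {- R0..R0} \<subseteq> U"
  proof
    fix z assume "z \<in> \<delta> ` {- R0..R0}"
    then obtain s where s: "- R0 \<le> s" "s \<le> R0" "z = \<i> * of_real s" by (auto simp: \<delta>_def)
    define u where "u = (s + R0) / (2 * R0)"
    have u: "0 \<le> u" "u \<le> 1" "s = (1 - u) * (- R0) + u * R0" using s R0 by (auto simp: u_def field_simps)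
    have "z = (1 - u) *\<^sub>R (\<i> * of_real (- R0)) + u *\<^sub>R (\<i> * of_real R0)"
      unfolding s(3) u(3) by (simp add: scaleR_conv_of_real algebra_simps)
    moreover have "\<i> * of_real R0 \<in> U" "\<i> * of_real (- R0) \<in> U"
      using U(4) ends R0 by (metis atLeastAtMost_iff image_subset_iff less_imp_le neg_le_0_iff_le order_refl order_trans)+
    ultimately show "z \<in> U" using convexD_alt[OF U(1), of "\<i> * of_real (- R0)" "\<i> * of_real R0" u] u by simp
  qed
  have prim: "contour_integral (subpath (- R0) R0 \<eta>) f = F (\<eta> R0) - F (\<eta> (- R0))"
    if "axis_contour \<eta> R0" "\<eta> ` {- R0..R0} \<subseteq> U" for \<eta>
  proof -
    have "(f has_contour_integral F (pathfinish (subpath (- R0) R0 \<eta>)) - F (pathstart (subpath (- R0) R0 \<eta>))) (subpath (- R0) R0 \<eta>)"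
      using axis_contour_valid_path[OF that(1)] path_image_axis_contour[OF that(1), of R0] that(2)
      by (intro contour_integral_primitive[OF F]) auto
    thus ?thesis by (simp add: contour_integral_unique)
  qed
  have mid: "contour_integral (subpath (- R0) R0 \<gamma>) f = contour_integral (subpath (- R0) R0 \<delta>) f"
    using prim[OF ax U(4)] prim[OF ax\<delta> \<delta>_in] ends by (simp add: \<delta>_def)
  define h where "h = (\<lambda>\<eta> s. f (\<eta> s) * vector_derivative \<eta> (at s))"
  have r\<delta>: "range \<delta> \<subseteq> S" using axis by (auto simp: \<delta>_def)
  have int: "h \<gamma> integrable_on UNIV" "h \<delta> integrable_on UNIV"
    unfolding h_def by (rule contour_int_limit(1)[OF ax f decay], rule contour_int_limit(1)[OF ax\<delta> f(1,2) r\<delta> decay])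
  have I: "(h \<gamma> has_integral contour_integral (subpath (- R0) R0 \<gamma>) f) {- R0..R0}"
    "(h \<delta> has_integral contour_integral (subpath (- R0) R0 \<delta>) f) {- R0..R0}"
    unfolding h_def using axis_contour_has_integral[OF ax order_refl f(1,2)] axis_contour_has_integral[OF ax\<delta> order_refl f(1,2)] f(3) r\<delta>
    by auto
  have inner: "((\<lambda>s. h \<gamma> s - h \<delta> s) has_integral 0) {- R0..R0}"
    using has_integral_diff[OF I] mid by simp
  have outer: "h \<gamma> s - h \<delta> s = 0" if "s \<notin> {- R0..R0}" for s
  proof -
    have "open {s::real. \<bar>s\<bar> > R0}" by (intro open_Collect_less continuous_intros)
    moreover have "s \<in> {s. \<bar>s\<bar> > R0}" using that by auto
    ultimately have "eventually (\<lambda>s. s \<in> {s. \<bar>s\<bar> > R0}) (nhds s)" by (intro eventually_nhds_in_open)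
    hence "eventually (\<lambda>s. \<gamma> s = \<delta> s) (nhds s)"
      by eventually_elim (use on_axis in \<open>auto simp: \<delta>_def\<close>)
    hence "vector_derivative \<gamma> (at s) = vector_derivative \<delta> (at s)"
      by (intro vector_derivative_cong_eq) auto
    moreover have "\<gamma> s = \<delta> s" using on_axis[of s] that by (auto simp: \<delta>_def)
    ultimately show ?thesis by (simp add: h_def)
  qed
  have "((\<lambda>s. h \<gamma> s - h \<delta> s) has_integral 0) UNIV"
    by (rule has_integral_on_superset[OF inner outer]) auto
  moreover have "((\<lambda>s. h \<gamma> s - h \<delta> s) has_integral (integral UNIV (h \<gamma>) - integral UNIV (h \<delta>))) UNIV"
    using int by (intro has_integral_diff integrable_integral)
  ultimately have "integral UNIV (h \<gamma>) - integral UNIV (h \<delta>) = 0" using has_integral_unique by blast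
  thus ?thesis by (simp add: contour_int_def h_def \<delta>_def)
qed

section \<open>The Wilson weight and its contiguous relation\<close>

definition gamma_pair :: "complex \<Rightarrow> complex \<Rightarrow> complex" where
  "gamma_pair x t = Gamma (x + t) * Gamma (x - t)"

abbreviation gamma_product :: "complex \<Rightarrow> complex \<Rightarrow> complex \<Rightarrow> complex \<Rightarrow> complex \<Rightarrow> complex" where
  "gamma_product a b c d t \<equiv> gamma_pair a t * gamma_pair b t * gamma_pair c t * gamma_pair d t"

definition gamma_domain :: "complex set \<Rightarrow> complex set" where
  "gamma_domain X = {t. \<forall>x\<in>X. x + t \<notin> \<int>\<^sub>\<le>\<^sub>0 \<and> x - t \<notin> \<int>\<^sub>\<le>\<^sub>0}"

text \<open>
  By the reflection formula the denominator of the weight is an elementary function, which shows that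
  the only singularities are the poles of the eight Gamma factors in the numerator.
\<close>

lemma wilson_weight_altdef:
  "wilson_weight a b c d t = - (2 * t * sin (2 * of_real pi * t) / of_real pi) *
     gamma_product a b c d t"
proof -
  have "rGamma (2 * t) * rGamma (1 - 2 * t) = sin (of_real pi * (2 * t)) / of_real pi"
    by (rule rGamma_reflection_complex)
  moreover have "rGamma (- 2 * t) = - 2 * t * rGamma (1 - 2 * t)"
    using rGamma_plus1[of "- 2 * t"] by (simp add: add.commute)
  ultimately have "rGamma (2 * t) * rGamma (- 2 * t) = - (2 * t * sin (2 * of_real pi * t) / of_real pi)"
    by (simp add: mult_ac)
  moreover have "wilson_weight a b c d t = (rGamma (2 * t) * rGamma (- 2 * t)) *
      gamma_product a b c d t"
    by (simp add: wilson_weight_def gamma_pair_def rGamma_inverse_Gamma divide_inverse mult_ac)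
  ultimately show ?thesis by simp
qed

lemma open_gamma_domain: "finite X \<Longrightarrow> open (gamma_domain X)"
proof -
  assume "finite X"
  have "gamma_domain X = (\<Inter>x\<in>X. - ((\<lambda>t. x + t) -` \<int>\<^sub>\<le>\<^sub>0) \<inter> - ((\<lambda>t. x - t) -` \<int>\<^sub>\<le>\<^sub>0))"
    by (auto simp: gamma_domain_def)
  also have "open \<dots>"
    using \<open>finite X\<close>
    by (intro open_INT open_Int ballI open_Compl closed_vimage continuous_intros closed_nonpos_Ints)
  finally show ?thesis .
qed

lemma holomorphic_gamma_pair: "x \<in> X \<Longrightarrow> gamma_pair x holomorphic_on gamma_domain X"
  unfolding gamma_pair_def by (intro holomorphic_intros) (auto simp: gamma_domain_def)

lemma gamma_pair_Suc:
  "x + t \<notin> \<int>\<^sub>\<le>\<^sub>0 \<Longrightarrow> x - t \<notin> \<int>\<^sub>\<le>\<^sub>0 \<Longrightarrow> gamma_pair (x + 1) t = (x\<^sup>2 - t\<^sup>2) * gamma_pair x t"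
proof -
  assume nz: "x + t \<notin> \<int>\<^sub>\<le>\<^sub>0" "x - t \<notin> \<int>\<^sub>\<le>\<^sub>0"
  have "x + 1 + t = (x + t) + 1" "x + 1 - t = (x - t) + 1" by simp_all
  hence "gamma_pair (x + 1) t = ((x + t) * Gamma (x + t)) * ((x - t) * Gamma (x - t))"
    unfolding gamma_pair_def by (simp only: Gamma_plus1[OF nz(1)] Gamma_plus1[OF nz(2)])
  also have "\<dots> = (x\<^sup>2 - t\<^sup>2) * gamma_pair x t"
    unfolding gamma_pair_def by (simp add: power2_eq_square algebra_simps)
  finally show ?thesis .
qed

lemma norm_sin_le_exp: "norm (sin z) \<le> exp \<bar>Im z\<bar>" for z :: complex
proof -
  have "norm (sin z) = norm (exp (\<i> * z) - exp (- (\<i> * z))) / 2"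
    by (simp add: sin_exp_eq norm_divide norm_mult)
  also have "norm (exp (\<i> * z) - exp (- (\<i> * z))) \<le> norm (exp (\<i> * z)) + norm (exp (- (\<i> * z)))"
    by (rule norm_triangle_ineq4)
  also have "\<dots> \<le> exp \<bar>Im z\<bar> + exp \<bar>Im z\<bar>"
    by (intro add_mono) (auto simp: norm_exp_eq_Re)
  finally show ?thesis by simp
qed

text \<open>The four pairs decay at least like \<open>exp (- 12 \<bar>Im t\<bar>)\<close>, while the sine grows like \<open>exp (2\<pi> \<bar>Im t\<bar>)\<close> with \<open>2\<pi> < 7\<close>.\<close>

lemma gamma_pairs_decay:
  "\<exists>C\<ge>0. \<exists>T\<ge>1. \<forall>t. \<bar>Re t\<bar> \<le> 1 \<and> \<bar>Im t\<bar> \<ge> T \<longrightarrow>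
     norm (sin (2 * of_real pi * t) * gamma_product a b c d t) \<le> C * exp (- 5 * \<bar>Im t\<bar>)"
proof -
  have "\<exists>C\<ge>0. \<exists>T\<ge>1. \<forall>t. \<bar>Re t\<bar> \<le> 1 \<and> \<bar>Im t\<bar> \<ge> T \<longrightarrow> norm (gamma_pair x t) \<le> C * exp (- 3 * \<bar>Im t\<bar>)" for x
    unfolding gamma_pair_def by (rule Gamma_pair_strip_decay)
  then obtain C T where CT: "\<And>x. C x \<ge> (0::real)" "\<And>x. T x \<ge> (1::real)"
    "\<And>x t. \<bar>Re t\<bar> \<le> 1 \<Longrightarrow> \<bar>Im t\<bar> \<ge> T x \<Longrightarrow> norm (gamma_pair x t) \<le> C x * exp (- 3 * \<bar>Im t\<bar>)"
    by metis
  define K where "K = C a * C b * C c * C d"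
  have "norm (sin (2 * of_real pi * t) * gamma_product a b c d t) \<le> K * exp (- 5 * \<bar>Im t\<bar>)"
    if t: "\<bar>Re t\<bar> \<le> 1" "\<bar>Im t\<bar> \<ge> T a + T b + T c + T d" for t
  proof -
    have le: "norm (gamma_pair x t) \<le> C x * exp (- 3 * \<bar>Im t\<bar>)" if "x \<in> {a, b, c, d}" for x
      using that t CT(2)[of a] CT(2)[of b] CT(2)[of c] CT(2)[of d] by (intro CT(3)) auto
    have "norm (gamma_product a b c d t) \<le>
        (C a * exp (- 3 * \<bar>Im t\<bar>)) * (C b * exp (- 3 * \<bar>Im t\<bar>)) * (C c * exp (- 3 * \<bar>Im t\<bar>)) * (C d * exp (- 3 * \<bar>Im t\<bar>))"
      unfolding norm_mult using CT(1) by (intro mult_mono le) auto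
    also have "\<dots> = K * exp (- 12 * \<bar>Im t\<bar>)"
      by (simp add: K_def flip: exp_add)
    finally have g: "norm (gamma_product a b c d t) \<le> K * exp (- 12 * \<bar>Im t\<bar>)" .
    have "norm (sin (2 * of_real pi * t)) \<le> exp \<bar>Im (2 * of_real pi * t)\<bar>" by (rule norm_sin_le_exp)
    also have "\<dots> \<le> exp (7 * \<bar>Im t\<bar>)"
    proof -
      have "\<bar>Im (2 * of_real pi * t)\<bar> = (2 * pi) * \<bar>Im t\<bar>" by (simp add: abs_mult)
      also have "\<dots> \<le> 7 * \<bar>Im t\<bar>" using pi_less_4 pi_approx by (intro mult_right_mono) auto
      finally show ?thesis by simp
    qed
    finally have s: "norm (sin (2 * of_real pi * t)) \<le> exp (7 * \<bar>Im t\<bar>)" .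
    have "norm (sin (2 * of_real pi * t) * gamma_product a b c d t) \<le>
        exp (7 * \<bar>Im t\<bar>) * (K * exp (- 12 * \<bar>Im t\<bar>))"
      unfolding norm_mult[of "sin _"] by (intro mult_mono s g) auto
    also have "\<dots> = K * exp (- 5 * \<bar>Im t\<bar>)" by (simp flip: exp_add)
    finally show ?thesis .
  qed
  moreover have "K \<ge> 0" using CT(1) by (simp add: K_def)
  moreover have "T a + T b + T c + T d \<ge> 1" using CT(2)[of a] CT(2)[of b] CT(2)[of c] CT(2)[of d] by linarith
  ultimately show ?thesis by blast
qed

lemma poly_exp_bound:
  fixes p :: "complex poly"
  shows "\<exists>K\<ge>0. \<forall>z. norm (poly p (z\<^sup>2)) \<le> K * exp (norm z)"
proof -
  have "\<exists>C\<ge>0. \<forall>x\<ge>0. (x + 0) ^ N * exp (- 1 * x) \<le> (C::real)" for N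
    by (rule power_times_exp_bounded) simp
  then obtain C where C: "\<And>N. C N \<ge> 0" "\<And>N x. x \<ge> 0 \<Longrightarrow> (x + 0) ^ N * exp (- 1 * x) \<le> (C N::real)"
    by metis
  have C': "x ^ N \<le> C N * exp x" if "x \<ge> 0" for N x
  proof -
    have "x ^ N = (x ^ N * exp (- x)) * exp x" by (simp add: exp_minus)
    also have "\<dots> \<le> C N * exp x" using C(2)[OF that, of N] by (intro mult_right_mono) auto
    finally show ?thesis .
  qed
  define K where "K = (\<Sum>i\<le>degree p. norm (coeff p i) * C (2 * i))"
  have "norm (poly p (z\<^sup>2)) \<le> K * exp (norm z)" for z
  proof -
    have "norm (poly p (z\<^sup>2)) \<le> (\<Sum>i\<le>degree p. norm (coeff p i * (z\<^sup>2) ^ i))"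
      unfolding poly_altdef by (rule norm_sum)
    also have "\<dots> = (\<Sum>i\<le>degree p. norm (coeff p i) * norm z ^ (2 * i))"
      by (simp add: norm_mult norm_power power_mult)
    also have "\<dots> \<le> (\<Sum>i\<le>degree p. norm (coeff p i) * (C (2 * i) * exp (norm z)))"
      by (intro sum_mono mult_left_mono C') auto
    also have "\<dots> = K * exp (norm z)" by (simp add: K_def sum_distrib_right mult.assoc)
    finally show ?thesis .
  qed
  moreover have "K \<ge> 0" using C(1) by (auto simp: K_def intro!: sum_nonneg)
  ultimately show ?thesis by blast
qed

lemma wilson_weight_decay:
  "\<exists>C\<ge>0. \<exists>T\<ge>1. \<forall>s. \<bar>s\<bar> \<ge> T \<longrightarrow> norm (wilson_weight a b c d (\<i> * of_real s)) \<le> C * exp (- 4 * \<bar>s\<bar>)"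
proof -
  obtain C T where CT: "C \<ge> 0" "T \<ge> 1"
    "\<And>t. \<bar>Re t\<bar> \<le> 1 \<Longrightarrow> \<bar>Im t\<bar> \<ge> T \<Longrightarrow>
      norm (sin (2 * of_real pi * t) * gamma_product a b c d t) \<le> C * exp (- 5 * \<bar>Im t\<bar>)"
    using gamma_pairs_decay[of a b c d] by blast
  have "norm (wilson_weight a b c d (\<i> * of_real s)) \<le> C * exp (- 4 * \<bar>s\<bar>)" if s: "\<bar>s\<bar> \<ge> T" for s
  proof -
    define t where "t = \<i> * complex_of_real s"
    have "wilson_weight a b c d t = - (2 * t / of_real pi) *
        (sin (2 * of_real pi * t) * gamma_product a b c d t)"
      by (simp add: wilson_weight_altdef)
    hence "norm (wilson_weight a b c d t) = norm (2 * t / of_real pi) *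
        norm (sin (2 * of_real pi * t) * gamma_product a b c d t)"
      by (metis norm_minus_cancel norm_mult)
    also have "\<dots> \<le> exp \<bar>s\<bar> * (C * exp (- 5 * \<bar>Im t\<bar>))"
    proof (intro mult_mono CT(3))
      have "norm (2 * t / of_real pi) = (2 / pi) * \<bar>s\<bar>" by (simp add: t_def norm_mult norm_divide)
      also have "\<dots> \<le> 1 * \<bar>s\<bar>" using pi_gt3 by (intro mult_right_mono) auto
      also have "\<dots> \<le> exp \<bar>s\<bar>" using exp_ge_add_one_self[of "\<bar>s\<bar>"] by linarith
      finally show "norm (2 * t / of_real pi) \<le> exp \<bar>s\<bar>" .
    qed (use s in \<open>auto simp: t_def\<close>)
    also have "\<dots> = C * exp (- 4 * \<bar>s\<bar>)" by (simp add: t_def flip: exp_add)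
    finally show ?thesis by (simp add: t_def)
  qed
  thus ?thesis using CT by blast
qed

section \<open>Integration against the Wilson weight\<close>

lemma wilson_contour_axis: "wilson_contour a b c d \<gamma> \<Longrightarrow> \<exists>R0. axis_contour \<gamma> R0"
  unfolding wilson_contour_def axis_contour_def by blast

lemma wilson_contour_sides:
  assumes "wilson_contour a b c d \<gamma>" "x \<in> {a, b, c, d}"
  shows "right_of_contour \<gamma> (x + of_nat k)" "left_of_contour \<gamma> (- x - of_nat k)"
  using assms unfolding wilson_contour_def by blast+

lemma wilson_contour_range:
  assumes "wilson_contour a b c d \<gamma>"
  shows "range \<gamma> \<subseteq> gamma_domain {a, b, c, d}"
proof
  fix t assume t: "t \<in> range \<gamma>"
  have "x + t \<notin> \<int>\<^sub>\<le>\<^sub>0 \<and> x - t \<notin> \<int>\<^sub>\<le>\<^sub>0" if x: "x \<in> {a, b, c, d}" for x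
  proof (intro conjI notI)
    assume "x + t \<in> \<int>\<^sub>\<le>\<^sub>0"
    then obtain k where "x + t = - of_nat k" by (elim nonpos_Ints_cases')
    hence "t = - x - of_nat k" by algebra
    thus False using wilson_contour_sides(2)[OF assms x, of k] t by (auto simp: left_of_contour_def)
  next
    assume "x - t \<in> \<int>\<^sub>\<le>\<^sub>0"
    then obtain k where "x - t = - of_nat k" by (elim nonpos_Ints_cases')
    hence "t = x + of_nat k" by (simp add: algebra_simps)
    thus False using wilson_contour_sides(1)[OF assms x, of k] t by (auto simp: right_of_contour_def)
  qed
  thus "t \<in> gamma_domain {a, b, c, d}" by (auto simp: gamma_domain_def)
qed

lemma wilson_contour_Suc:
  assumes "wilson_contour a b c d \<gamma>"
  shows "wilson_contour (a + 1) b c d \<gamma>"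
proof -
  have "right_of_contour \<gamma> (x + of_nat k) \<and> left_of_contour \<gamma> (- x - of_nat k)" if "x \<in> {a + 1, b, c, d}" for x k
  proof (cases "x = a + 1")
    case True
    have e: "x + of_nat k = a + of_nat (Suc k)" "- x - of_nat k = - a - of_nat (Suc k)"
      by (simp_all add: True)
    show ?thesis unfolding e using wilson_contour_sides[OF assms, of a "Suc k"] by blast
  next
    case False
    thus ?thesis using wilson_contour_sides[OF assms, of x k] that by auto
  qed
  thus ?thesis using assms unfolding wilson_contour_def by blast
qed

lemma wilson_contour_perm:
  "wilson_contour a b c d \<gamma> \<Longrightarrow> wilson_contour b a c d \<gamma>"
  "wilson_contour a b c d \<gamma> \<Longrightarrow> wilson_contour b c d a \<gamma>"
  by (auto simp: wilson_contour_def)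

lemma wilson_weight_perm:
  "wilson_weight b a c d = wilson_weight a b c d"
  "wilson_weight b c d a = wilson_weight a b c d"
  by (simp_all add: fun_eq_iff wilson_weight_altdef)

lemma contour_int_cong:
  assumes "\<And>t. t \<in> range \<gamma> \<Longrightarrow> f t = g t"
  shows "contour_int \<gamma> f = contour_int \<gamma> g"
  unfolding contour_int_def using assms by (intro integral_cong) auto

lemma holomorphic_wilson_weight:
  "(\<lambda>t. poly p (t\<^sup>2) * wilson_weight a b c d t) holomorphic_on gamma_domain {a, b, c, d}"
  unfolding wilson_weight_altdef
  by (intro holomorphic_intros holomorphic_gamma_pair) auto

lemma wilson_integrand_decay:
  "\<exists>C\<ge>0. \<exists>T. \<forall>s. \<bar>s\<bar> \<ge> T \<longrightarrow>
     norm (poly p ((\<i> * of_real s)\<^sup>2) * wilson_weight a b c d (\<i> * of_real s)) \<le> C * exp (- \<bar>s\<bar>)"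
proof -
  obtain C T where CT: "C \<ge> 0" "\<And>s. \<bar>s\<bar> \<ge> T \<Longrightarrow> norm (wilson_weight a b c d (\<i> * of_real s)) \<le> C * exp (- 4 * \<bar>s\<bar>)"
    using wilson_weight_decay[of a b c d] by blast
  obtain K where K: "K \<ge> 0" "\<And>z. norm (poly p (z\<^sup>2)) \<le> K * exp (norm z)" using poly_exp_bound by blast
  have "norm (poly p ((\<i> * of_real s)\<^sup>2) * wilson_weight a b c d (\<i> * of_real s)) \<le> (K * C) * exp (- \<bar>s\<bar>)"
    if s: "\<bar>s\<bar> \<ge> T" for s
  proof -
    have "norm (poly p ((\<i> * of_real s)\<^sup>2) * wilson_weight a b c d (\<i> * of_real s)) \<le>
      (K * exp \<bar>s\<bar>) * (C * exp (- 4 * \<bar>s\<bar>))"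
      unfolding norm_mult[of "poly p _"] using K(2)[of "\<i> * of_real s"] CT(2)[OF s] K(1)
      by (intro mult_mono) (auto simp: norm_mult)
    also have "\<dots> = (K * C) * exp (- 3 * \<bar>s\<bar>)" by (simp flip: exp_add)
    also have "\<dots> \<le> (K * C) * exp (- \<bar>s\<bar>)" using K(1) CT(1) by (intro mult_left_mono) auto
    finally show ?thesis .
  qed
  thus ?thesis using K(1) CT(1) by (intro exI[of _ "K * C"] conjI exI[of _ T]) auto
qed

text \<open>
  The functional with the contour as a parameter. Keeping \<open>\<gamma>\<close> fixed while \<open>a\<close>, \<open>b\<close>, \<open>c\<close>, \<open>d\<close> are raised by integers
  is possible because the poles for the raised parameters are among those for the original ones.
\<close>

definition wilson_int :: "(real \<Rightarrow> complex) \<Rightarrow> complex \<Rightarrow> complex \<Rightarrow> complex \<Rightarrow> complex \<Rightarrow> complex poly \<Rightarrow> complex" where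
  "wilson_int \<gamma> a b c d p = contour_int \<gamma> (\<lambda>t. poly p (t\<^sup>2) * wilson_weight a b c d t)"

lemma wilson_integrand_integrable:
  assumes "wilson_contour a b c d \<gamma>"
  shows "(\<lambda>s. poly p ((\<gamma> s)\<^sup>2) * wilson_weight a b c d (\<gamma> s) * vector_derivative \<gamma> (at s)) integrable_on UNIV"
proof -
  obtain R0 where R0: "axis_contour \<gamma> R0" using wilson_contour_axis[OF assms] by blast
  obtain C T where CT: "\<forall>s. \<bar>s\<bar> \<ge> T \<longrightarrow>
     norm (poly p ((\<i> * of_real s)\<^sup>2) * wilson_weight a b c d (\<i> * of_real s)) \<le> C * exp (- \<bar>s\<bar>)"
    using wilson_integrand_decay[of p a b c d] by blast
  show ?thesis
    by (rule contour_int_limit(1)[OF R0 holomorphic_wilson_weight open_gamma_domain wilson_contour_range[OF assms] CT]) simp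
qed

lemma wilson_int_add:
  assumes "wilson_contour a b c d \<gamma>"
  shows "wilson_int \<gamma> a b c d (p + q) = wilson_int \<gamma> a b c d p + wilson_int \<gamma> a b c d q"
  unfolding wilson_int_def contour_int_def
  using Henstock_Kurzweil_Integration.integral_add[OF wilson_integrand_integrable[OF assms, of p] wilson_integrand_integrable[OF assms, of q]]
  by (simp add: algebra_simps)

lemma wilson_int_smult:
  "wilson_int \<gamma> a b c d (smult k p) = k * wilson_int \<gamma> a b c d p"
  unfolding wilson_int_def contour_int_def
  by (simp add: mult.assoc)

lemma wilson_int_0 [simp]: "wilson_int \<gamma> a b c d 0 = 0"
  by (simp add: wilson_int_def contour_int_def)

lemma wilson_int_sum:
  assumes "wilson_contour a b c d \<gamma>"
  shows "wilson_int \<gamma> a b c d (\<Sum>i\<in>I. f i) = (\<Sum>i\<in>I. wilson_int \<gamma> a b c d (f i))"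
  by (induction I rule: infinite_finite_induct) (simp_all add: wilson_int_add[OF assms])

lemma wilson_int_perm:
  "wilson_int \<gamma> b a c d = wilson_int \<gamma> a b c d" "wilson_int \<gamma> b c d a = wilson_int \<gamma> a b c d"
  unfolding wilson_int_def by (simp_all add: wilson_weight_perm fun_eq_iff)

lemma wilson_int_Suc:
  assumes "wilson_contour a b c d \<gamma>"
  shows "wilson_int \<gamma> (a + 1) b c d p = wilson_int \<gamma> a b c d ([:a\<^sup>2, - 1:] * p)"
  unfolding wilson_int_def
proof (rule contour_int_cong)
  fix t assume "t \<in> range \<gamma>"
  hence "a + t \<notin> \<int>\<^sub>\<le>\<^sub>0" "a - t \<notin> \<int>\<^sub>\<le>\<^sub>0"
    using wilson_contour_range[OF assms] by (auto simp: gamma_domain_def)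
  thus "poly p (t\<^sup>2) * wilson_weight (a + 1) b c d t = poly ([:a\<^sup>2, - 1:] * p) (t\<^sup>2) * wilson_weight a b c d t"
    by (simp add: wilson_weight_altdef gamma_pair_Suc) (simp add: algebra_simps)
qed

text \<open>
  The function \<open>H\<close> has poles only at \<open>\<plusminus>(x + 1/2 + k)\<close>, halfway between two consecutive poles of the weight that lie on
  the same side of the contour. Therefore the difference of its two translates by \<open>1/2\<close> integrates to zero. The
  Gamma recurrence writes this difference as the weight times
  \<open>(a + t) (b + t) (c + t) (d + t) - (a - t) (b - t) (c - t) (d - t)\<close>, up to elementary factors. This odd polynomial
  is \<open>2t (e\<^sub>3 + e\<^sub>1 t\<^sup>2)\<close>, with the elementary symmetric functions \<open>e\<^sub>1\<close> and \<open>e\<^sub>3\<close> of the parameters.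
\<close>

lemma wilson_shift_identity:
  assumes wc: "wilson_contour a b c d \<gamma>"
  shows "wilson_int \<gamma> a b c d [:b * c * d + a * c * d + a * b * d + a * b * c, a + b + c + d:] = 0"
proof -
  define X where "X = {a, b, c, d}"
  define X' where "X' = (\<lambda>x. x + 1/2) ` X"
  define S where "S = gamma_domain X'"
  define G where "G = (\<lambda>t. gamma_pair (a + 1/2) t * gamma_pair (b + 1/2) t * gamma_pair (c + 1/2) t * gamma_pair (d + 1/2) t)"
  define H where "H = (\<lambda>t. sin (2 * of_real pi * t) * G t)"
  obtain R0 where ax: "axis_contour \<gamma> R0" using wilson_contour_axis[OF wc] by blast
  obtain C T0 where CT: "C \<ge> 0" "T0 \<ge> 1" "\<And>t. \<bar>Re t\<bar> \<le> 1 \<Longrightarrow> \<bar>Im t\<bar> \<ge> T0 \<Longrightarrow> norm (H t) \<le> C * exp (- 5 * \<bar>Im t\<bar>)"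
    using gamma_pairs_decay[of "a + 1/2" "b + 1/2" "c + 1/2" "d + 1/2"] unfolding H_def G_def by blast
  \<comment> \<open>above this height there are no poles, and the decay of \<open>H\<close> has set in\<close>
  define T where "T = T0 + (\<Sum>x\<in>X. norm x)"
  have T: "T \<ge> T0" "T \<ge> 0" and Tx: "\<And>x. x \<in> X \<Longrightarrow> T > norm x"
  proof -
    have nn: "(\<Sum>x\<in>X. norm x) \<ge> 0" by (intro sum_nonneg) auto
    thus "T \<ge> T0" "T \<ge> 0" using CT(2) by (auto simp: T_def)
    fix x assume "x \<in> X"
    hence "norm x \<le> (\<Sum>x\<in>X. norm x)" by (intro member_le_sum) (auto simp: X_def)
    thus "T > norm x" using CT(2) by (simp add: T_def)
  qed
  have S_open: "open S" unfolding S_def by (rule open_gamma_domain) (simp add: X'_def X_def)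
  have H_hol: "H holomorphic_on S" unfolding H_def G_def S_def
    by (intro holomorphic_intros holomorphic_gamma_pair) (auto simp: X'_def X_def)
  have "contour_int \<gamma> (\<lambda>t. H (t + 1/2) - H (t - 1/2)) = 0"
  proof (rule contour_int_shift_invariant[OF ax H_hol S_open _ T(2)])
    show "end_strips T \<subseteq> S"
    proof
      fix t assume "t \<in> end_strips T"
      hence t: "\<bar>Im t\<bar> > T" by (simp add: end_strips_def)
      have "x + 1/2 + t \<notin> \<int>\<^sub>\<le>\<^sub>0 \<and> x + 1/2 - t \<notin> \<int>\<^sub>\<le>\<^sub>0" if "x \<in> X" for x
      proof -
        have "\<bar>Im t\<bar> > \<bar>Im x\<bar>" using Tx[OF that] t abs_Im_le_cmod[of x] by linarith
        hence "Im (x + 1/2 + t) \<noteq> 0" "Im (x + 1/2 - t) \<noteq> 0" by auto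
        moreover have "Im y = 0" if "y \<in> \<int>\<^sub>\<le>\<^sub>0" for y :: complex
          using that by (auto elim!: nonpos_Ints_cases)
        ultimately show ?thesis by blast
      qed
      thus "t \<in> S" by (auto simp: S_def gamma_domain_def X'_def)
    qed
    show "same_side \<gamma> z" if "z \<notin> S" for z
    proof -
      obtain x where x: "x \<in> X" "x + 1/2 + z \<in> \<int>\<^sub>\<le>\<^sub>0 \<or> x + 1/2 - z \<in> \<int>\<^sub>\<le>\<^sub>0"
        using \<open>z \<notin> S\<close> by (auto simp: S_def gamma_domain_def X'_def)
      from x(2) show ?thesis
      proof
        assume "x + 1/2 + z \<in> \<int>\<^sub>\<le>\<^sub>0"
        then obtain k where "x + 1/2 + z = - of_nat k" by (elim nonpos_Ints_cases')
        hence z: "z = - of_nat k - x - 1/2" by (simp add: algebra_simps)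
        have "z + 1/2 = - x - of_nat k" "z - 1/2 = - x - of_nat (Suc k)" unfolding z by simp_all
        thus ?thesis using wilson_contour_sides(2)[OF wc] x(1) by (simp only: same_side_def X_def) blast
      next
        assume "x + 1/2 - z \<in> \<int>\<^sub>\<le>\<^sub>0"
        then obtain k where "x + 1/2 - z = - of_nat k" by (elim nonpos_Ints_cases')
        hence z: "z = x + 1/2 + of_nat k" by (simp add: algebra_simps)
        have "z + 1/2 = x + of_nat (Suc k)" "z - 1/2 = x + of_nat k" unfolding z by simp_all
        thus ?thesis using wilson_contour_sides(1)[OF wc] x(1) by (simp only: same_side_def X_def) blast
      qed
    qed
    fix t assume t: "\<bar>Re t\<bar> \<le> 1/2" "\<bar>Im t\<bar> \<ge> T"
    have "norm (H t) \<le> C * exp (- 5 * \<bar>Im t\<bar>)" using t T by (intro CT(3)) auto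
    also have "\<dots> \<le> C * exp (- \<bar>Im t\<bar>)" using CT(1) by (intro mult_left_mono) auto
    finally show "norm (H t) \<le> C * exp (- \<bar>Im t\<bar>)" .
  qed
  also have "contour_int \<gamma> (\<lambda>t. H (t + 1/2) - H (t - 1/2)) =
     contour_int \<gamma> (\<lambda>t. of_real pi * (poly [:b * c * d + a * c * d + a * b * d + a * b * c, a + b + c + d:] (t\<^sup>2) * wilson_weight a b c d t))"
  proof (rule contour_int_cong)
    fix t assume "t \<in> range \<gamma>"
    hence dom: "x + t \<notin> \<int>\<^sub>\<le>\<^sub>0" "x - t \<notin> \<int>\<^sub>\<le>\<^sub>0" if "x \<in> X" for x
      using wilson_contour_range[OF wc] that by (auto simp: gamma_domain_def X_def)
    have up: "gamma_pair (x + 1/2) (t + 1/2) = (x + t) * gamma_pair x t" if "x \<in> X" for x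
      using Gamma_plus1[OF dom(1)[OF that]] by (simp add: gamma_pair_def add_ac)
    have down: "gamma_pair (x + 1/2) (t - 1/2) = (x - t) * gamma_pair x t" if "x \<in> X" for x
      using Gamma_plus1[OF dom(2)[OF that]] by (simp add: gamma_pair_def add_ac)
    have s1: "sin (2 * of_real pi * (t + 1/2)) = - sin (2 * of_real pi * t)"
      by (simp add: distrib_left sin_add sin_of_real cos_of_real)
    have s2: "sin (2 * of_real pi * (t - 1/2)) = - sin (2 * of_real pi * t)"
      by (simp add: right_diff_distrib sin_diff sin_of_real cos_of_real)
    define P where "P = gamma_pair a t * gamma_pair b t * gamma_pair c t * gamma_pair d t"
    have G: "G (t + 1/2) = (a + t) * (b + t) * (c + t) * (d + t) * P"
      "G (t - 1/2) = (a - t) * (b - t) * (c - t) * (d - t) * P"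
      using up down by (simp_all add: G_def P_def X_def)
    define E where "E = (b * c * d + a * c * d + a * b * d + a * b * c) + t\<^sup>2 * (a + b + c + d)"
    have E: "poly [:b * c * d + a * c * d + a * b * d + a * b * c, a + b + c + d:] (t\<^sup>2) = E"
      by (simp add: E_def)
    have "s * (x * P) - s * (y * P) = s * P * (x - y)" for s x y :: complex
      by (simp add: right_diff_distrib mult_ac)
    hence "H (t + 1/2) - H (t - 1/2) =
        - sin (2 * of_real pi * t) * P * ((a + t) * (b + t) * (c + t) * (d + t) - (a - t) * (b - t) * (c - t) * (d - t))"
      unfolding H_def s1 s2 G .
    also have "(a + t) * (b + t) * (c + t) * (d + t) - (a - t) * (b - t) * (c - t) * (d - t)
       = 2 * t * E"
      by (simp add: E_def algebra_simps power2_eq_square)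
    also have "- sin (2 * of_real pi * t) * P * (2 * t * E) =
        of_real pi * (E * (- (2 * t * sin (2 * of_real pi * t) / of_real pi) * P))"
      by simp
    finally show "H (t + 1/2) - H (t - 1/2) = of_real pi *
        (poly [:b * c * d + a * c * d + a * b * d + a * b * c, a + b + c + d:] (t\<^sup>2) * wilson_weight a b c d t)"
      unfolding wilson_weight_altdef P_def[symmetric] E .
  qed
  also have "\<dots> = of_real pi * wilson_int \<gamma> a b c d [:b * c * d + a * c * d + a * b * d + a * b * c, a + b + c + d:]"
    by (simp add: wilson_int_def contour_int_def mult.assoc)
  finally show ?thesis by simp
qed

text \<open>
  The mass for \<open>a + 1\<close> is the integral of \<open>a\<^sup>2 - t\<^sup>2\<close>. Eliminating the integral of \<open>t\<^sup>2\<close> by the shift identity leaves the factor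
  \<open>a\<^sup>2 e\<^sub>1 + e\<^sub>3 = (a + b) (a + c) (a + d)\<close>.
\<close>

lemma wilson_contiguous:
  assumes wc: "wilson_contour a b c d \<gamma>"
  shows "(a + b + c + d) * wilson_int \<gamma> (a + 1) b c d 1 = (a + b) * (a + c) * (a + d) * wilson_int \<gamma> a b c d 1"
proof -
  define I where "I = wilson_int \<gamma> a b c d 1"
  define J where "J = wilson_int \<gamma> a b c d [:0, 1:]"
  have lin: "wilson_int \<gamma> a b c d [:u, v:] = u * I + v * J" for u v
  proof -
    have "[:u, v:] = smult u 1 + smult v [:0, 1:]" by (simp add: one_pCons)
    thus ?thesis by (simp only: wilson_int_add[OF wc] wilson_int_smult I_def J_def)
  qed
  have "(b * c * d + a * c * d + a * b * d + a * b * c) * I + (a + b + c + d) * J = 0"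
    using wilson_shift_identity[OF wc] unfolding lin .
  moreover have "wilson_int \<gamma> (a + 1) b c d 1 = a\<^sup>2 * I - J"
    unfolding wilson_int_Suc[OF wc] using lin[of "a\<^sup>2" "- 1"] by simp
  ultimately show ?thesis unfolding I_def[symmetric] by algebra
qed

section \<open>Determinacy of exponentially decaying densities\<close>

lemma has_integral_exp_abs: "((\<lambda>x::real. exp (- \<bar>x\<bar>)) has_integral 2) UNIV"
proof -
  have "((\<lambda>x::real. exp (- 1 * x)) has_integral 1) {0..}"
    using has_integral_exp_minus_to_infinity[of 1 0] by simp
  hence 1: "((\<lambda>x::real. exp (- \<bar>x\<bar>)) has_integral 1) {0..}"
    by (rule has_integral_eq[rotated]) simp
  have "((\<lambda>x::real. exp x) has_integral 1) {..0}" using has_integral_exp_left[of 0] by simp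
  hence 2: "((\<lambda>x::real. exp (- \<bar>x\<bar>)) has_integral 1) {..0}"
    by (rule has_integral_eq[rotated]) simp
  have inter: "{0::real..} \<inter> {..0} = {0}" and union: "{0::real..} \<union> {..0} = UNIV" by auto
  have "((\<lambda>x::real. exp (- \<bar>x\<bar>)) has_integral (1 + 1)) ({0..} \<union> {..0})"
    by (rule has_integral_Un[OF 1 2]) (simp add: inter)
  thus ?thesis by (simp add: union)
qed

lemma integrable_exp_bound:
  fixes h :: "real \<Rightarrow> 'a::{banach,second_countable_topology}"
  assumes "continuous_on UNIV h" "\<And>s. norm (h s) \<le> C * exp (- \<bar>s\<bar>)"
  shows "integrable lborel h"
proof (rule Bochner_Integration.integrable_bound)
  have "integral\<^sup>N lborel (\<lambda>x::real. ennreal (exp (- \<bar>x\<bar>))) = ennreal 2"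
    by (rule nn_integral_has_integral_lborel[OF _ _ has_integral_exp_abs]) auto
  hence "integrable lborel (\<lambda>x::real. exp (- \<bar>x\<bar>))"
    by (intro integrableI_nn_integral_finite[where x = 2]) auto
  thus "integrable lborel (\<lambda>x::real. C * exp (- \<bar>x\<bar>))" by (rule integrable_mult_right)
  show "h \<in> borel_measurable lborel"
    using borel_measurable_continuous_onI[OF assms(1)] by simp
  have "norm (h x) \<le> norm (C * exp (- \<bar>x\<bar>))" for x
    using assms(2)[of x] by (metis abs_of_nonneg norm_ge_zero order_trans real_norm_def)
  thus "AE x in lborel. norm (h x) \<le> norm (C * exp (- \<bar>x\<bar>))" by simp
qed

lemma exp_abs_power_bound:
  "\<exists>K\<ge>0. \<forall>s::real. \<bar>s\<bar> ^ k * exp (- (1/2) * \<bar>s\<bar>) \<le> K"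
proof -
  obtain K where "K \<ge> 0" "\<And>x. x \<ge> 0 \<Longrightarrow> (x + 0) ^ k * exp (- (1/2) * x) \<le> (K::real)"
    using power_times_exp_bounded[of "1/2" 0 k] by auto
  thus ?thesis by (intro exI[of _ K]) auto
qed

text \<open>
  Expanding \<open>exp (\<i>hs)\<close> in powers of \<open>h\<close> is legitimate for \<open>\<bar>h\<bar> \<le> 1/2\<close> by the exponential decay. If all moments of
  \<open>exp (\<i>\<theta>s) v(s)\<close> vanish, then so do those of \<open>exp (\<i>(\<theta> + h)s) v(s)\<close>, and finitely many such steps reach every
  frequency.
\<close>

lemma moments_zero_imp_fourier_zero:
  fixes v :: "real \<Rightarrow> real"
  assumes cont: "continuous_on UNIV v" and bound: "\<And>s. \<bar>v s\<bar> \<le> C * exp (- 2 * \<bar>s\<bar>)"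
    and moments: "\<And>k. (LINT s|lborel. s ^ k * v s) = 0"
  shows "(CLINT s|lborel. iexp (\<theta> * s) * of_real (v s)) = 0"
proof -
  define Z where "Z = (\<lambda>\<theta>. \<forall>k. (CLINT s|lborel. of_real (s ^ k) * iexp (\<theta> * s) * of_real (v s)) = 0)"
  have C0: "C \<ge> 0" using bound[of 0] by simp
  have Z0: "Z 0"
    unfolding Z_def
  proof
    fix k
    have "(CLINT s|lborel. of_real (s ^ k) * iexp (0 * s) * of_real (v s)) = (CLINT s|lborel. complex_of_real (s ^ k * v s))"
      by (intro Bochner_Integration.integral_cong) auto
    also have "\<dots> = of_real (LINT s|lborel. s ^ k * v s)" by (rule integral_complex_of_real)
    finally show "(CLINT s|lborel. of_real (s ^ k) * iexp (0 * s) * of_real (v s)) = 0"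
      using moments by simp
  qed
  have step: "Z (\<theta> + h)" if Z: "Z \<theta>" and h: "\<bar>h\<bar> \<le> 1/2" for \<theta> h
    unfolding Z_def
  proof
    fix k
    obtain K where K: "K \<ge> 0" "\<And>s::real. \<bar>s\<bar> ^ k * exp (- (1/2) * \<bar>s\<bar>) \<le> K" using exp_abs_power_bound by blast
    define B where "B = (\<lambda>s. \<bar>s\<bar> ^ k * exp (\<bar>h\<bar> * \<bar>s\<bar>) * (C * exp (- 2 * \<bar>s\<bar>)))"
    have B_le: "B s \<le> (K * C) * exp (- \<bar>s\<bar>)" for s
    proof -
      have "B s \<le> \<bar>s\<bar> ^ k * exp ((1/2) * \<bar>s\<bar>) * (C * exp (- 2 * \<bar>s\<bar>))"
      proof -
        have "\<bar>h\<bar> * \<bar>s\<bar> \<le> (1/2) * \<bar>s\<bar>" using h by (intro mult_right_mono) auto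
        thus ?thesis unfolding B_def using C0 by (intro mult_right_mono mult_left_mono) auto
      qed
      also have "\<dots> = (\<bar>s\<bar> ^ k * exp (- (1/2) * \<bar>s\<bar>)) * C * exp (- \<bar>s\<bar>)"
        by (simp add: mult_ac flip: exp_add)
      also have "\<dots> \<le> K * C * exp (- \<bar>s\<bar>)" using K(2)[of s] C0 by (intro mult_right_mono) auto
      finally show ?thesis .
    qed
    define F where "F = (\<lambda>n s. (\<Sum>j<n. (\<i> * of_real (h * s)) ^ j / fact j) * (of_real (s ^ k) * iexp (\<theta> * s) * of_real (v s)))"
    have F_bound: "norm (F n s) \<le> B s" for n s
    proof -
      have "norm (\<Sum>j<n. (\<i> * of_real (h * s)) ^ j / fact j) \<le> (\<Sum>j<n. (\<bar>h\<bar> * \<bar>s\<bar>) ^ j / fact j)"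
        by (rule order_trans[OF norm_sum])
           (auto simp: norm_mult norm_power norm_divide abs_mult intro!: sum_mono)
      also have "\<dots> \<le> (\<Sum>j. (\<bar>h\<bar> * \<bar>s\<bar>) ^ j / fact j)"
        using summable_exp[of "\<bar>h\<bar> * \<bar>s\<bar>"] by (intro sum_le_suminf) (auto simp: divide_inverse mult_ac)
      also have "\<dots> = exp (\<bar>h\<bar> * \<bar>s\<bar>)"
        by (simp add: exp_def divide_inverse mult_ac)
      finally have "norm (\<Sum>j<n. (\<i> * of_real (h * s)) ^ j / fact j) \<le> exp (\<bar>h\<bar> * \<bar>s\<bar>)" .
      moreover have "norm (of_real (s ^ k) * iexp (\<theta> * s) * of_real (v s) :: complex) \<le> \<bar>s\<bar> ^ k * (C * exp (- 2 * \<bar>s\<bar>))"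
        using bound[of s] by (simp add: norm_mult norm_power norm_exp_eq_Re mult_left_mono)
      ultimately have "norm (F n s) \<le> exp (\<bar>h\<bar> * \<bar>s\<bar>) * (\<bar>s\<bar> ^ k * (C * exp (- 2 * \<bar>s\<bar>)))"
        unfolding F_def norm_mult[of "sum _ _"] by (intro mult_mono) auto
      thus ?thesis by (simp add: B_def mult_ac)
    qed
    have F_cont: "continuous_on UNIV (F n)" for n
      unfolding F_def by (intro continuous_intros cont) auto
    have term_int: "integrable lborel (\<lambda>s. of_real (s ^ j) * iexp (\<theta> * s) * complex_of_real (v s))" for j
    proof -
      obtain L where L: "L \<ge> 0" "\<And>s::real. \<bar>s\<bar> ^ j * exp (- (1/2) * \<bar>s\<bar>) \<le> L" using exp_abs_power_bound by blast
      show ?thesis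
      proof (rule integrable_exp_bound)
        show "continuous_on UNIV (\<lambda>s. of_real (s ^ j) * iexp (\<theta> * s) * complex_of_real (v s))"
          by (intro continuous_intros cont)
        fix s :: real
        have "norm (of_real (s ^ j) * iexp (\<theta> * s) * complex_of_real (v s)) \<le> \<bar>s\<bar> ^ j * (C * exp (- 2 * \<bar>s\<bar>))"
          using bound[of s] by (simp add: norm_mult norm_power norm_exp_eq_Re mult_left_mono)
        also have "\<dots> = (\<bar>s\<bar> ^ j * exp (- (1/2) * \<bar>s\<bar>)) * C * exp (- (3/2) * \<bar>s\<bar>)"
          by (simp add: mult_ac flip: exp_add)
        also have "\<dots> \<le> L * C * exp (- \<bar>s\<bar>)"
          using L C0 by (intro mult_mono) auto
        finally show "norm (of_real (s ^ j) * iexp (\<theta> * s) * complex_of_real (v s)) \<le> (L * C) * exp (- \<bar>s\<bar>)" by simp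
      qed
    qed
    have F_zero: "(CLINT s|lborel. F n s) = 0" for n
    proof -
      have "(CLINT s|lborel. F n s) = (CLINT s|lborel. (\<Sum>j<n. ((\<i> * of_real h) ^ j / fact j) * (of_real (s ^ (j + k)) * iexp (\<theta> * s) * of_real (v s))))"
        by (intro Bochner_Integration.integral_cong)
           (auto simp: F_def sum_distrib_right power_mult_distrib power_add intro!: sum.cong)
      also have "\<dots> = (\<Sum>j<n. ((\<i> * of_real h) ^ j / fact j) * (CLINT s|lborel. of_real (s ^ (j + k)) * iexp (\<theta> * s) * of_real (v s)))"
        using term_int by (subst Bochner_Integration.integral_sum) auto
      also have "\<dots> = 0" using Z unfolding Z_def by simp
      finally show ?thesis .
    qed
    have "(\<lambda>n. CLINT s|lborel. F n s) \<longlonglongrightarrow> (CLINT s|lborel. of_real (s ^ k) * iexp ((\<theta> + h) * s) * of_real (v s))"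
    proof (rule integral_dominated_convergence[where w = B])
      show "(\<lambda>s. of_real (s ^ k) * iexp ((\<theta> + h) * s) * complex_of_real (v s)) \<in> borel_measurable lborel"
        using borel_measurable_continuous_onI[of "\<lambda>s. of_real (s ^ k) * iexp ((\<theta> + h) * s) * complex_of_real (v s)"]
        by (simp add: continuous_intros cont)
      show "F n \<in> borel_measurable lborel" for n
        using borel_measurable_continuous_onI[OF F_cont] by simp
      show "integrable lborel B"
      proof (rule integrable_exp_bound)
        show "continuous_on UNIV B" unfolding B_def by (intro continuous_intros)
        show "norm (B s) \<le> (K * C) * exp (- \<bar>s\<bar>)" for s using B_le[of s] C0 by (simp add: B_def)
      qed
      show "AE s in lborel. (\<lambda>n. F n s) \<longlonglongrightarrow> of_real (s ^ k) * iexp ((\<theta> + h) * s) * of_real (v s)"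
      proof (rule AE_I2)
        fix s :: real
        have "(\<lambda>n. \<Sum>j<n. (\<i> * of_real (h * s)) ^ j / fact j) \<longlonglongrightarrow> exp (\<i> * of_real (h * s))"
          using exp_converges[of "\<i> * complex_of_real (h * s)"] by (simp add: sums_def scaleR_conv_of_real divide_inverse mult_ac)
        hence "(\<lambda>n. F n s) \<longlonglongrightarrow> exp (\<i> * of_real (h * s)) * (of_real (s ^ k) * iexp (\<theta> * s) * of_real (v s))"
          unfolding F_def by (rule tendsto_mult_right)
        also have "exp (\<i> * of_real (h * s)) * (of_real (s ^ k) * iexp (\<theta> * s) * of_real (v s)) =
            of_real (s ^ k) * iexp ((\<theta> + h) * s) * of_real (v s)"
          by (simp add: distrib_left distrib_right exp_add mult_ac)
        finally show "(\<lambda>n. F n s) \<longlonglongrightarrow> of_real (s ^ k) * iexp ((\<theta> + h) * s) * of_real (v s)" .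
      qed
      show "AE s in lborel. norm (F n s) \<le> B s" for n using F_bound by simp
    qed
    hence "(\<lambda>n. 0) \<longlonglongrightarrow> (CLINT s|lborel. of_real (s ^ k) * iexp ((\<theta> + h) * s) * of_real (v s))"
      unfolding F_zero .
    thus "(CLINT s|lborel. of_real (s ^ k) * iexp ((\<theta> + h) * s) * of_real (v s)) = 0"
      using LIMSEQ_unique tendsto_const by blast
  qed
  obtain N :: nat where N: "real N > 2 * \<bar>\<theta>\<bar>" using reals_Archimedean2 by blast
  hence N0: "real N > 0" by (smt (verit) abs_ge_zero)
  have "Z (real j * (\<theta> / N))" for j
  proof (induction j)
    case (Suc j)
    have "\<bar>\<theta> / N\<bar> \<le> 1/2" using N N0 by (simp add: field_simps abs_divide)
    from step[OF Suc this] show ?case by (simp add: algebra_simps add_divide_distrib)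
  qed (use Z0 in simp)
  from this[of N] have "Z \<theta>" using N0 by simp
  thus ?thesis unfolding Z_def by (drule_tac spec[of _ 0]) simp
qed

text \<open>
  A small multiple of \<open>v\<close> is added to the Laplace density \<open>exp (- \<bar>s\<bar>) / 2\<close>. The sum is again a probability density,
  with the same characteristic function, so the two densities agree.
\<close>

lemma moments_zero_imp_zero:
  fixes v :: "real \<Rightarrow> real"
  assumes cont: "continuous_on UNIV v" and bound: "\<And>s. \<bar>v s\<bar> \<le> C * exp (- 2 * \<bar>s\<bar>)"
    and moments: "\<And>k. (LINT s|lborel. s ^ k * v s) = 0"
  shows "v s = 0"
proof -
  have C0: "C \<ge> 0" using bound[of 0] by simp
  \<comment> \<open>small enough for \<open>\<epsilon> \<bar>v\<bar>\<close> to stay below the Laplace density\<close>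
  define \<epsilon> where "\<epsilon> = 1 / (2 * (C + 1))"
  have \<epsilon>: "\<epsilon> > 0" "\<epsilon> * C \<le> 1/2" using C0 by (auto simp: \<epsilon>_def field_simps)
  have vb: "\<bar>v s\<bar> \<le> C * exp (- \<bar>s\<bar>)" for s
  proof -
    have "C * exp (- 2 * \<bar>s\<bar>) \<le> C * exp (- \<bar>s\<bar>)" using C0 by (intro mult_left_mono) auto
    thus ?thesis using bound[of s] by linarith
  qed
  have v_int: "integrable lborel v" by (rule integrable_exp_bound[OF cont]) (use vb in auto)
  define p where "p = (\<lambda>s::real. exp (- \<bar>s\<bar>) / 2)"
  define q where "q = (\<lambda>s. p s + \<epsilon> * v s)"
  have p_cont: "continuous_on UNIV p" unfolding p_def by (intro continuous_intros) auto
  have q_cont: "continuous_on UNIV q" unfolding q_def by (intro continuous_intros p_cont cont)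
  have p0: "p s \<ge> 0" for s by (simp add: p_def)
  have q0: "q s \<ge> 0" for s
  proof -
    have "\<bar>\<epsilon> * v s\<bar> \<le> \<epsilon> * (C * exp (- \<bar>s\<bar>))" using vb[of s] \<epsilon> by (simp add: abs_mult)
    also have "\<dots> \<le> (1/2) * exp (- \<bar>s\<bar>)" using \<epsilon>(2) by (simp add: mult.assoc[symmetric] mult_right_mono)
    finally show ?thesis by (simp add: q_def p_def abs_le_iff)
  qed
  have p_int: "integrable lborel p" by (rule integrable_exp_bound[OF p_cont, of 1]) (simp add: p_def)
  have q_int: "integrable lborel q" unfolding q_def using p_int v_int by auto
  have p1: "(LINT s|lborel. p s) = 1"
  proof -
    have "(p has_integral (2 / 2)) UNIV" unfolding p_def by (rule has_integral_divide[OF has_integral_exp_abs])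
    from has_integral_unique[OF has_integral_integral_lborel[OF p_int] this] show ?thesis by simp
  qed
  have q1: "(LINT s|lborel. q s) = 1"
    unfolding q_def using p_int v_int p1 moments[of 0] by simp
  have pm: "p \<in> borel_measurable borel" "q \<in> borel_measurable borel"
    using p_cont q_cont by (auto intro: borel_measurable_continuous_onI)
  have rd: "real_distribution (density lborel (\<lambda>s. ennreal (f s)))"
    if "f \<in> borel_measurable borel" "\<And>s. f s \<ge> 0" "integrable lborel f" "(LINT s|lborel. f s) = 1" for f
  proof -
    have "emeasure (density lborel (\<lambda>s. ennreal (f s))) UNIV = (\<integral>\<^sup>+ s. ennreal (f s) \<partial>lborel)"
      using that by (subst emeasure_density) auto
    also have "\<dots> = ennreal 1" using that by (simp add: nn_integral_eq_integral)
    finally have "prob_space (density lborel (\<lambda>s. ennreal (f s)))" by (intro prob_spaceI) simp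
    thus ?thesis by (simp add: real_distribution_def real_distribution_axioms_def)
  qed
  have ch: "char (density lborel (\<lambda>s. ennreal (f s))) \<theta> = (CLINT s|lborel. iexp (\<theta> * s) * of_real (f s))"
    if "f \<in> borel_measurable borel" "\<And>s. f s \<ge> 0" for f \<theta>
    unfolding char_def using that
    by (subst integral_density) (auto simp: scaleR_conv_of_real mult.commute)
  have "density lborel (\<lambda>s. ennreal (p s)) = density lborel (\<lambda>s. ennreal (q s))"
  proof (rule Levy_uniqueness)
    show "char (density lborel (\<lambda>s. ennreal (p s))) = char (density lborel (\<lambda>s. ennreal (q s)))"
    proof
      fix \<theta>
      have i: "integrable lborel (\<lambda>s. iexp (\<theta> * s) * complex_of_real (f s))"
        if "integrable lborel f" "continuous_on UNIV f" for f
      proof (rule Bochner_Integration.integrable_bound[OF that(1)])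
        show "(\<lambda>s. iexp (\<theta> * s) * complex_of_real (f s)) \<in> borel_measurable lborel"
          using borel_measurable_continuous_onI[of "\<lambda>s. iexp (\<theta> * s) * complex_of_real (f s)"] that(2)
          by (simp add: continuous_intros)
      qed (simp add: norm_mult norm_exp_eq_Re)
      have "(CLINT s|lborel. iexp (\<theta> * s) * of_real (q s)) =
         (CLINT s|lborel. iexp (\<theta> * s) * of_real (p s) + of_real \<epsilon> * (iexp (\<theta> * s) * of_real (v s)))"
        by (intro Bochner_Integration.integral_cong) (auto simp: q_def algebra_simps)
      also have "\<dots> = (CLINT s|lborel. iexp (\<theta> * s) * of_real (p s)) + of_real \<epsilon> * (CLINT s|lborel. iexp (\<theta> * s) * of_real (v s))"
        using i[OF p_int p_cont] i[OF v_int cont] by (subst Bochner_Integration.integral_add) auto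
      also have "(CLINT s|lborel. iexp (\<theta> * s) * of_real (v s)) = 0"
        by (rule moments_zero_imp_fourier_zero[OF cont bound moments])
      finally show "char (density lborel (\<lambda>s. ennreal (p s))) \<theta> = char (density lborel (\<lambda>s. ennreal (q s))) \<theta>"
        using ch pm p0 q0 by simp
    qed
  qed (use rd pm p0 q0 p_int q_int p1 q1 in auto)
  hence "AE s in lborel. ennreal (p s) = ennreal (q s)"
    using pm p_int p0
    by (subst (asm) sigma_finite_measure.density_unique_iff[OF sigma_finite_lborel]) auto
  hence "AE s in lborel. v s = 0"
    by eventually_elim (use p0 q0 \<epsilon> in \<open>auto simp: q_def\<close>)
  moreover have opn: "open {s. v s \<noteq> 0}" using cont by (intro open_Collect_neq continuous_intros) auto
  ultimately have "{s. v s \<noteq> 0} \<in> null_sets lborel"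
    using AE_iff_null[of lborel "\<lambda>s. v s = 0"] by simp
  hence "negligible {s. v s \<noteq> 0}"
    by (simp add: negligible_iff_null_sets null_sets_completionI)
  hence "{s. v s \<noteq> 0} = {}" using opn open_not_negligible by blast
  thus ?thesis by blast
qed

section \<open>Moments of the Wilson functional\<close>

text \<open>As a function of \<open>t\<^sup>2\<close> this is the factor by which the weight changes when \<open>a\<close> is raised by \<open>k\<close>.\<close>

definition wilson_basis :: "complex \<Rightarrow> nat \<Rightarrow> complex poly" where
  "wilson_basis a k = (\<Prod>i<k. [:(a + of_nat i)\<^sup>2, - 1:])"

lemma wilson_basis_0 [simp]: "wilson_basis a 0 = 1"
  by (simp add: wilson_basis_def)

lemma wilson_basis_Suc: "wilson_basis a (Suc k) = [:(a + of_nat k)\<^sup>2, - 1:] * wilson_basis a k"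
  by (simp add: wilson_basis_def mult.commute)

lemma degree_wilson_basis [simp]: "degree (wilson_basis a k) = k"
  and lead_coeff_wilson_basis: "coeff (wilson_basis a k) k = (- 1) ^ k"
proof -
  have both: "degree (wilson_basis a k) = k \<and> lead_coeff (wilson_basis a k) = (- 1) ^ k"
  proof (induction k)
    case (Suc k)
    have "wilson_basis a k \<noteq> 0" using Suc by auto
    hence "degree (wilson_basis a (Suc k)) = Suc k"
      unfolding wilson_basis_Suc using Suc by (subst degree_mult_eq) auto
    moreover have "lead_coeff (wilson_basis a (Suc k)) = (- 1) ^ Suc k"
      unfolding wilson_basis_Suc lead_coeff_mult using conjunct1[OF Suc] conjunct2[OF Suc] by simp
    ultimately show ?case by simp
  qed auto
  thus "degree (wilson_basis a k) = k" by (rule conjunct1)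
  from conjunct2[OF both] show "coeff (wilson_basis a k) k = (- 1) ^ k"
    unfolding conjunct1[OF both] .
qed

lemma poly_wilson_basis: "poly (wilson_basis a k) (t\<^sup>2) = pochhammer (a - t) k * pochhammer (a + t) k"
proof (induction k)
  case (Suc k)
  have "poly [:(a + of_nat k)\<^sup>2, - 1:] (t\<^sup>2) = (a - t + of_nat k) * (a + t + of_nat k)"
    by (simp add: power2_eq_square algebra_simps)
  thus ?case unfolding wilson_basis_Suc poly_mult Suc pochhammer_Suc by (simp only: mult_ac)
qed auto

lemma wilson_basis_spans:
  "degree p \<le> N \<Longrightarrow> \<exists>c. p = (\<Sum>k\<le>N. smult (c k) (wilson_basis a k))"
proof (induction N arbitrary: p)
  case 0
  then obtain u where "p = [:u:]" using degree_eq_zeroE by blast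
  thus ?case by (intro exI[of _ "\<lambda>_. u"]) simp
next
  case (Suc N)
  define l where "l = coeff p (Suc N) * (- 1) ^ Suc N"
  define q where "q = p - smult l (wilson_basis a (Suc N))"
  have "coeff q n = 0" if "n > N" for n
  proof (cases "n = Suc N")
    case True
    have "((- 1) ^ Suc N) * ((- 1) ^ Suc N) = (1 :: complex)" by (simp flip: power_mult_distrib)
    thus ?thesis by (simp add: q_def True lead_coeff_wilson_basis l_def mult.assoc del: power_Suc)
  next
    case False
    thus ?thesis using Suc.prems that by (simp add: q_def coeff_eq_0)
  qed
  hence "degree q \<le> N" by (intro degree_le) auto
  then obtain c where c: "q = (\<Sum>k\<le>N. smult (c k) (wilson_basis a k))" using Suc.IH by blast
  have "p = q + smult l (wilson_basis a (Suc N))" by (simp add: q_def)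
  also have "\<dots> = (\<Sum>k\<le>Suc N. smult ((c(Suc N := l)) k) (wilson_basis a k))"
    unfolding c by (simp add: atMost_Suc add.commute cong: sum.cong_simp)
  finally show ?case by blast
qed

lemma wilson_contour_shift:
  "wilson_contour a b c d \<gamma> \<Longrightarrow> wilson_contour (a + of_nat k) b c d \<gamma>"
proof (induction k)
  case (Suc k)
  thus ?case using wilson_contour_Suc[of "a + of_nat k" b c d \<gamma>] by (simp add: add_ac)
qed auto

lemma wilson_int_shift:
  assumes "wilson_contour a b c d \<gamma>"
  shows "wilson_int \<gamma> (a + of_nat k) b c d p = wilson_int \<gamma> a b c d (wilson_basis a k * p)"
proof (induction k arbitrary: p)
  case (Suc k)
  have "wilson_int \<gamma> (a + of_nat (Suc k)) b c d p = wilson_int \<gamma> (a + of_nat k + 1) b c d p"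
    by (simp add: add_ac)
  also have "\<dots> = wilson_int \<gamma> (a + of_nat k) b c d ([:(a + of_nat k)\<^sup>2, - 1:] * p)"
    by (rule wilson_int_Suc[OF wilson_contour_shift[OF assms]])
  also have "\<dots> = wilson_int \<gamma> a b c d (wilson_basis a (Suc k) * p)"
    unfolding Suc.IH wilson_basis_Suc by (simp only: mult_ac)
  finally show ?case .
qed simp

text \<open>Iteration of the contiguous relation, written without division because \<open>a + b + c + d\<close> may be a nonpositive integer.\<close>

lemma wilson_int_shift_value:
  assumes wc: "wilson_contour a b c d \<gamma>"
  shows "pochhammer (a + b + c + d) k * wilson_int \<gamma> (a + of_nat k) b c d 1 =
     pochhammer (a + b) k * pochhammer (a + c) k * pochhammer (a + d) k * wilson_int \<gamma> a b c d 1"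
proof (induction k)
  case (Suc k)
  define a' where "a' = a + of_nat k"
  have step: "(a' + b + c + d) * wilson_int \<gamma> (a' + 1) b c d 1 = (a' + b) * (a' + c) * (a' + d) * wilson_int \<gamma> a' b c d 1"
    unfolding a'_def by (rule wilson_contiguous[OF wilson_contour_shift[OF wc]])
  have e: "a + of_nat (Suc k) = a' + 1" "a + b + c + d + of_nat k = a' + b + c + d"
    "a + b + of_nat k = a' + b" "a + c + of_nat k = a' + c" "a + d + of_nat k = a' + d"
    by (simp_all add: a'_def)
  have "pochhammer (a + b + c + d) (Suc k) * wilson_int \<gamma> (a + of_nat (Suc k)) b c d 1 =
      pochhammer (a + b + c + d) k * ((a' + b + c + d) * wilson_int \<gamma> (a' + 1) b c d 1)"
    unfolding pochhammer_Suc e by simp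
  also have "\<dots> = (a' + b) * (a' + c) * (a' + d) * (pochhammer (a + b + c + d) k * wilson_int \<gamma> a' b c d 1)"
    unfolding step by simp
  also have "\<dots> = (a' + b) * (a' + c) * (a' + d) *
      (pochhammer (a + b) k * pochhammer (a + c) k * pochhammer (a + d) k * wilson_int \<gamma> a b c d 1)"
    using Suc unfolding a'_def by simp
  finally show ?case unfolding pochhammer_Suc e by (simp only: mult_ac)
qed simp

text \<open>The two factors raise \<open>a\<close> by \<open>k\<close> and \<open>b\<close> by \<open>l\<close>, independently of each other.\<close>

lemma wilson_int_basis_product:
  assumes wc: "wilson_contour a b c d \<gamma>"
  shows "pochhammer (a + b + c + d) (k + l) * wilson_int \<gamma> a b c d (wilson_basis a k * wilson_basis b l) =
     pochhammer (a + b) (k + l) * pochhammer (a + c) k * pochhammer (a + d) k *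
     pochhammer (b + c) l * pochhammer (b + d) l * wilson_int \<gamma> a b c d 1"
proof -
  define a' where "a' = a + of_nat k"
  have wc': "wilson_contour b a' c d \<gamma>"
    unfolding a'_def by (rule wilson_contour_perm(1)[OF wilson_contour_shift[OF wc]])
  have "wilson_int \<gamma> a b c d (wilson_basis a k * wilson_basis b l) = wilson_int \<gamma> a' b c d (wilson_basis b l * 1)"
    using wilson_int_shift[OF wc, of k "wilson_basis b l"] by (simp add: a'_def)
  also have "\<dots> = wilson_int \<gamma> (b + of_nat l) a' c d 1"
    unfolding wilson_int_shift[OF wc', of l 1] by (simp only: wilson_int_perm(1)[of _ b a'])
  finally have 1: "wilson_int \<gamma> a b c d (wilson_basis a k * wilson_basis b l) = wilson_int \<gamma> (b + of_nat l) a' c d 1" .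
  have 2: "pochhammer (b + a' + c + d) l * wilson_int \<gamma> (b + of_nat l) a' c d 1 =
     pochhammer (b + a') l * pochhammer (b + c) l * pochhammer (b + d) l * wilson_int \<gamma> a' b c d 1"
    using wilson_int_shift_value[OF wc', of l] by (simp only: wilson_int_perm(1)[of _ b a'])
  have 3: "pochhammer (a + b + c + d) k * wilson_int \<gamma> a' b c d 1 =
     pochhammer (a + b) k * pochhammer (a + c) k * pochhammer (a + d) k * wilson_int \<gamma> a b c d 1"
    unfolding a'_def by (rule wilson_int_shift_value[OF wc])
  have e: "a + b + c + d + of_nat k = b + a' + c + d" "a + b + of_nat k = b + a'" by (simp_all add: a'_def)
  have p: "pochhammer (a + b + c + d) (k + l) = pochhammer (a + b + c + d) k * pochhammer (b + a' + c + d) l"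
    "pochhammer (a + b) (k + l) = pochhammer (a + b) k * pochhammer (b + a') l"
    unfolding pochhammer_product' e by simp_all
  show ?thesis unfolding 1 p using 2 3 by algebra
qed

section \<open>Nonvanishing of the total mass\<close>

lemma wilson_weight_even: "wilson_weight a b c d (- t) = wilson_weight a b c d t"
  by (simp add: wilson_weight_altdef gamma_pair_def mult_ac)

lemma strip_subset_gamma_domain:
  assumes "\<And>x. x \<in> X \<Longrightarrow> Re x > M"
  shows "{t. \<bar>Re t\<bar> < M} \<subseteq> gamma_domain X"
proof
  fix t assume t: "t \<in> {t. \<bar>Re t\<bar> < M}"
  have "x + t \<notin> \<int>\<^sub>\<le>\<^sub>0 \<and> x - t \<notin> \<int>\<^sub>\<le>\<^sub>0" if "x \<in> X" for x
    using assms[OF that] t by (intro conjI nonpos_Int_Re_pos) auto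
  thus "t \<in> gamma_domain X" unfolding gamma_domain_def by blast
qed

text \<open>
  Odd moments vanish since the weight is even, even ones by assumption, so the weight would vanish on the
  axis; but Gamma functions have no zeros.
\<close>

lemma wilson_weight_axis_moments:
  assumes pos: "\<And>x. x \<in> {a, b, c, d} \<Longrightarrow> Re x > 0"
    and zero: "\<And>p. wilson_int (\<lambda>s. \<i> * of_real s) a b c d p = 0"
  shows False
proof -
  define u where "u = (\<lambda>s. wilson_weight a b c d (\<i> * of_real s))"
  have axis_dom: "\<i> * of_real s \<in> gamma_domain {a, b, c, d}" for s
  proof -
    have "x + \<i> * of_real s \<notin> \<int>\<^sub>\<le>\<^sub>0 \<and> x - \<i> * of_real s \<notin> \<int>\<^sub>\<le>\<^sub>0" if "x \<in> {a, b, c, d}" for x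
      using pos[OF that] by (intro conjI nonpos_Int_Re_pos) simp_all
    thus ?thesis unfolding gamma_domain_def by blast
  qed
  have "continuous_on (gamma_domain {a, b, c, d}) (wilson_weight a b c d)"
    using holomorphic_on_imp_continuous_on[OF holomorphic_wilson_weight[of 1 a b c d]] by simp
  hence u_cont: "continuous_on UNIV u"
    unfolding u_def
  proof (rule continuous_on_compose2)
    show "(\<lambda>s. \<i> * complex_of_real s) ` UNIV \<subseteq> gamma_domain {a, b, c, d}"
      using axis_dom by blast
  qed (intro continuous_intros)
  obtain C T where CT: "C \<ge> 0" "T \<ge> 1" "\<And>s. \<bar>s\<bar> \<ge> T \<Longrightarrow> norm (u s) \<le> C * exp (- 4 * \<bar>s\<bar>)"
    using wilson_weight_decay[of a b c d] unfolding u_def by blast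
  have "compact (u ` {- T..T})"
    by (rule compact_continuous_image[OF continuous_on_subset[OF u_cont]]) auto
  hence "bounded (u ` {- T..T})" by (rule compact_imp_bounded)
  then obtain B where B: "\<And>s. s \<in> {- T..T} \<Longrightarrow> norm (u s) \<le> B"
    unfolding bounded_iff by blast
  define D where "D = C + \<bar>B\<bar> * exp (2 * T)"
  have u_bound: "norm (u s) \<le> D * exp (- 2 * \<bar>s\<bar>)" for s
  proof (cases "\<bar>s\<bar> \<ge> T")
    case True
    have "norm (u s) \<le> C * exp (- 4 * \<bar>s\<bar>)" by (rule CT(3)[OF True])
    also have "\<dots> \<le> D * exp (- 2 * \<bar>s\<bar>)" using CT(1) by (intro mult_mono) (auto simp: D_def)
    finally show ?thesis .
  next
    case False
    hence "norm (u s) \<le> B" by (intro B) auto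
    also have "\<dots> \<le> \<bar>B\<bar> * (exp (2 * T) * exp (- 2 * \<bar>s\<bar>))"
    proof -
      have "exp (2 * T) * exp (- 2 * \<bar>s\<bar>) \<ge> 1" using False by (simp flip: exp_add)
      hence "\<bar>B\<bar> * 1 \<le> \<bar>B\<bar> * (exp (2 * T) * exp (- 2 * \<bar>s\<bar>))" by (intro mult_left_mono) auto
      thus ?thesis by linarith
    qed
    also have "\<dots> \<le> D * exp (- 2 * \<bar>s\<bar>)" using CT(1) by (simp add: D_def algebra_simps)
    finally show ?thesis .
  qed
  have D0: "D \<ge> 0" using CT(1) by (simp add: D_def)
  have int: "integrable lborel (\<lambda>s. of_real (s ^ k) * u s)" for k
  proof -
    obtain L where L: "L \<ge> 0" "\<And>s::real. \<bar>s\<bar> ^ k * exp (- (1/2) * \<bar>s\<bar>) \<le> L" using exp_abs_power_bound by blast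
    show ?thesis
    proof (rule integrable_exp_bound)
      show "continuous_on UNIV (\<lambda>s. of_real (s ^ k) * u s)" by (intro continuous_intros u_cont)
      fix s :: real
      have "norm (of_real (s ^ k) * u s) \<le> \<bar>s\<bar> ^ k * (D * exp (- 2 * \<bar>s\<bar>))"
        using u_bound[of s] by (simp add: norm_mult norm_power mult_left_mono)
      also have "\<dots> = (\<bar>s\<bar> ^ k * exp (- (1/2) * \<bar>s\<bar>)) * D * exp (- (3/2) * \<bar>s\<bar>)"
        by (simp add: mult_ac flip: exp_add)
      also have "\<dots> \<le> L * D * exp (- \<bar>s\<bar>)" using L D0 by (intro mult_mono) auto
      finally show "norm (of_real (s ^ k) * u s) \<le> (L * D) * exp (- \<bar>s\<bar>)" by simp
    qed
  qed
  have vd: "vector_derivative (\<lambda>s. \<i> * of_real s) (at s) = \<i>" for s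
    by (rule vector_derivative_at) (auto intro!: derivative_eq_intros has_vector_derivative_real_field)
  have moment: "(CLINT s|lborel. of_real (s ^ k) * u s) = 0" for k
  proof (cases "even k")
    case True
    then obtain m where m: "k = 2 * m" by (elim evenE)
    have "wilson_int (\<lambda>s. \<i> * of_real s) a b c d (monom ((- 1) ^ m) m) = integral UNIV (\<lambda>s. \<i> * (of_real (s ^ k) * u s))"
      unfolding wilson_int_def contour_int_def
    proof (rule integral_cong)
      fix s :: real
      have "poly (monom ((- 1) ^ m) m) ((\<i> * of_real s)\<^sup>2) = ((- 1) * (\<i> * complex_of_real s)\<^sup>2) ^ m"
        unfolding poly_monom power_mult_distrib[symmetric] ..
      also have "(- 1) * (\<i> * complex_of_real s)\<^sup>2 = (of_real s)\<^sup>2" by (simp add: power_mult_distrib)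
      finally have "poly (monom ((- 1) ^ m) m) ((\<i> * of_real s)\<^sup>2) = of_real (s ^ k)"
        by (simp add: m power_mult)
      thus "poly (monom ((- 1) ^ m) m) ((\<i> * of_real s)\<^sup>2) * wilson_weight a b c d (\<i> * of_real s) *
          vector_derivative (\<lambda>s. \<i> * of_real s) (at s) = \<i> * (of_real (s ^ k) * u s)"
        unfolding vd u_def by simp
    qed
    hence "integral UNIV (\<lambda>s. of_real (s ^ k) * u s) = 0" using zero by simp
    thus ?thesis unfolding integral_unique[OF has_integral_integral_lborel[OF int[of k]]] .
  next
    case False
    define I where "I = (CLINT s|lborel. of_real (s ^ k) * u s)"
    have hi: "((\<lambda>s. of_real (s ^ k) * u s) has_integral I) UNIV"
      unfolding I_def by (rule has_integral_integral_lborel[OF int])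
    have "of_real ((- s) ^ k) * u (- s) = - (of_real (s ^ k) * u s)" for s
      using False wilson_weight_even[of a b c d "\<i> * of_real s"] by (simp add: u_def)
    hence "((\<lambda>s. - (of_real (s ^ k) * u s)) has_integral I) UNIV"
      using has_integral_reflect_UNIV[OF hi] by simp
    from has_integral_unique[OF this has_integral_neg[OF hi]] have "I = - I" .
    thus ?thesis by (simp add: I_def)
  qed
  have re_zero: "Re (u s) = 0" for s
  proof (rule moments_zero_imp_zero[of "\<lambda>s. Re (u s)" D])
    show "continuous_on UNIV (\<lambda>s. Re (u s))" by (intro continuous_intros u_cont)
    show "\<bar>Re (u s)\<bar> \<le> D * exp (- 2 * \<bar>s\<bar>)" for s using abs_Re_le_cmod[of "u s"] u_bound[of s] by linarith
    fix k
    have "(LINT s|lborel. s ^ k * Re (u s)) = (LINT s|lborel. Re (of_real (s ^ k) * u s))" by simp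
    also have "\<dots> = Re (CLINT s|lborel. of_real (s ^ k) * u s)" by (rule integral_Re[OF int])
    finally show "(LINT s|lborel. s ^ k * Re (u s)) = 0" using moment[of k] by simp
  qed
  have im_zero: "Im (u s) = 0" for s
  proof (rule moments_zero_imp_zero[of "\<lambda>s. Im (u s)" D])
    show "continuous_on UNIV (\<lambda>s. Im (u s))" by (intro continuous_intros u_cont)
    show "\<bar>Im (u s)\<bar> \<le> D * exp (- 2 * \<bar>s\<bar>)" for s using abs_Im_le_cmod[of "u s"] u_bound[of s] by linarith
    fix k
    have "(LINT s|lborel. s ^ k * Im (u s)) = (LINT s|lborel. Im (of_real (s ^ k) * u s))" by simp
    also have "\<dots> = Im (CLINT s|lborel. of_real (s ^ k) * u s)" by (rule integral_Im[OF int])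
    finally show "(LINT s|lborel. s ^ k * Im (u s)) = 0" using moment[of k] by simp
  qed
  have "u 1 = 0" using re_zero[of 1] im_zero[of 1] by (simp add: complex_eq_iff)
  moreover have "u 1 \<noteq> 0"
  proof -
    have "gamma_pair x \<i> \<noteq> 0" if "x \<in> {a, b, c, d}" for x
    proof -
      have "x + \<i> \<notin> \<int>\<^sub>\<le>\<^sub>0" "x - \<i> \<notin> \<int>\<^sub>\<le>\<^sub>0"
        using axis_dom[of 1] that unfolding gamma_domain_def by simp_all blast+
      thus ?thesis by (simp add: gamma_pair_def Gamma_eq_zero_iff)
    qed
    moreover have "sin (2 * of_real pi * \<i>) \<noteq> 0"
    proof
      assume "sin (2 * of_real pi * \<i>) = 0"
      then obtain n :: int where "2 * of_real pi * \<i> = complex_of_real (n * pi)"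
        unfolding sin_eq_0 by blast
      hence "Im (2 * of_real pi * \<i>) = Im (complex_of_real (n * pi))" by (rule arg_cong)
      thus False by simp
    qed
    ultimately show ?thesis by (simp add: u_def wilson_weight_altdef)
  qed
  ultimately show False by simp
qed

text \<open>
  A vanishing mass forces the functional to vanish identically, since all \<open>\<phi>\<^sub>k\<close> have integral a multiple of the mass. The functional
  for raised parameters is the original one on multiples of a polynomial, so it vanishes as well. Once
  all real parts exceed the width of the contour, the latter can be replaced by the imaginary axis.
\<close>

theorem wilson_mass_nonzero:
  assumes wc: "wilson_contour a b c d \<gamma>" and s: "a + b + c + d \<notin> \<int>\<^sub>\<le>\<^sub>0"
  shows "wilson_int \<gamma> a b c d 1 \<noteq> 0"
proof
  assume zero: "wilson_int \<gamma> a b c d 1 = 0"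
  have "wilson_int \<gamma> a b c d (wilson_basis a k) = 0" for k
  proof -
    have "pochhammer (a + b + c + d) k \<noteq> 0" using s by (auto dest: pochhammer_eq_0_imp_nonpos_Int)
    thus ?thesis using wilson_int_basis_product[OF wc, of k 0] zero by simp
  qed
  hence all: "wilson_int \<gamma> a b c d p = 0" for p
  proof -
    obtain e where e: "p = (\<Sum>k\<le>degree p. smult (e k) (wilson_basis a k))"
      using wilson_basis_spans[of p "degree p" a] by blast
    have "wilson_int \<gamma> a b c d p = (\<Sum>k\<le>degree p. e k * wilson_int \<gamma> a b c d (wilson_basis a k))"
      by (subst e) (simp only: wilson_int_sum[OF wc] wilson_int_smult)
    thus ?thesis using \<open>\<And>k. wilson_int \<gamma> a b c d (wilson_basis a k) = 0\<close> by simp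
  qed
  obtain R0 where ax: "axis_contour \<gamma> R0" using wilson_contour_axis[OF wc] by blast
  have R0: "R0 > 0" and on_axis: "\<And>s. \<bar>s\<bar> \<ge> R0 \<Longrightarrow> \<gamma> s = \<i> * of_real s" using ax by (auto simp: axis_contour_def)
  have "compact (\<gamma> ` {- R0..R0})"
    using axis_contour_C1[OF ax order_refl] by (intro compact_continuous_image) (auto simp: piecewise_C1_differentiable_on_def)
  hence "bounded (\<gamma> ` {- R0..R0})" by (rule compact_imp_bounded)
  then obtain M0 where M0: "\<And>t. t \<in> \<gamma> ` {- R0..R0} \<Longrightarrow> norm t \<le> M0"
    unfolding bounded_iff by blast
  define M where "M = \<bar>M0\<bar> + 1"
  define U where "U = {t. \<bar>Re t\<bar> < M}"
  have gU: "\<gamma> s \<in> U" for s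
  proof (cases "\<bar>s\<bar> \<ge> R0")
    case True thus ?thesis using on_axis[of s] by (simp add: U_def M_def)
  next
    case False
    hence "norm (\<gamma> s) \<le> M0" by (intro M0 imageI) auto
    thus ?thesis using abs_Re_le_cmod[of "\<gamma> s"] by (simp add: U_def M_def)
  qed
  \<comment> \<open>raising all parameters by \<open>n\<close> moves their poles out of a strip that contains the contour\<close>
  obtain n :: nat where n: "real n > M + norm a + norm b + norm c + norm d" using reals_Archimedean2 by blast
  define a' where "a' = a + of_nat n"
  define b' where "b' = b + of_nat n"
  define c' where "c' = c + of_nat n"
  define d' where "d' = d + of_nat n"
  have big: "Re x > M" if "x \<in> {a', b', c', d'}" for x
    using that n abs_Re_le_cmod[of a] abs_Re_le_cmod[of b] abs_Re_le_cmod[of c] abs_Re_le_cmod[of d]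
      norm_ge_zero[of a] norm_ge_zero[of b] norm_ge_zero[of c] norm_ge_zero[of d]
    by (auto simp: a'_def b'_def c'_def d'_def simp del: norm_ge_zero)
  have shifted: "wilson_int \<gamma> a' b' c' d' p = 0" for p
  proof -
    note w1 = wilson_contour_shift[OF wc, of n, folded a'_def]
    note w1' = wilson_contour_perm(2)[OF w1]
    note w2 = wilson_contour_shift[OF w1', of n, folded b'_def]
    note w2' = wilson_contour_perm(2)[OF w2]
    note w3 = wilson_contour_shift[OF w2', of n, folded c'_def]
    note w3' = wilson_contour_perm(2)[OF w3]
    have 1: "wilson_int \<gamma> a' b c d q = 0" for q
      using wilson_int_shift[OF wc, of n q] all by (simp add: a'_def)
    have 2: "wilson_int \<gamma> b' c d a' q = 0" for q
      using wilson_int_shift[OF w1', of n q] 1 by (simp add: b'_def wilson_int_perm(2)[of \<gamma> b c d a'])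
    have 3: "wilson_int \<gamma> c' d a' b' q = 0" for q
      using wilson_int_shift[OF w2', of n q] 2 by (simp add: c'_def wilson_int_perm(2)[of \<gamma> c d a' b'])
    have 4: "wilson_int \<gamma> d' a' b' c' q = 0" for q
      using wilson_int_shift[OF w3', of n q] 3 by (simp add: d'_def wilson_int_perm(2)[of \<gamma> d a' b' c'])
    show ?thesis using 4[of p] wilson_int_perm(2)[of \<gamma> a' b' c' d'] wilson_int_perm(2)[of \<gamma> d' a' b' c'] by simp
  qed
  have U_dom: "U \<subseteq> gamma_domain {a', b', c', d'}"
    unfolding U_def by (rule strip_subset_gamma_domain) (use big in auto)
  have U_alt: "U = {t. Re t < M} \<inter> {t. Re t > - M}" by (auto simp: U_def)
  have U: "convex U" "open U"
    unfolding U_alt by (auto intro!: convex_Int convex_halfspace_Re_lt convex_halfspace_Re_gt open_Int open_halfspace_Re_lt open_halfspace_Re_gt)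
  have straight: "wilson_int \<gamma> a' b' c' d' p = wilson_int (\<lambda>s. \<i> * of_real s) a' b' c' d' p" for p
  proof -
    obtain C T where CT: "\<forall>s. \<bar>s\<bar> \<ge> T \<longrightarrow>
       norm (poly p ((\<i> * of_real s)\<^sup>2) * wilson_weight a' b' c' d' (\<i> * of_real s)) \<le> C * exp (- \<bar>s\<bar>)"
      using wilson_integrand_decay[of p a' b' c' d'] by blast
    show ?thesis unfolding wilson_int_def
    proof (rule contour_int_straighten[OF ax _ U(2) _ U order_refl _ _ CT])
      show "(\<lambda>t. poly p (t\<^sup>2) * wilson_weight a' b' c' d' t) holomorphic_on U"
        using holomorphic_wilson_weight U_dom by (rule holomorphic_on_subset)
    qed (use gU in \<open>auto simp: U_def M_def\<close>)
  qed
  show False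
  proof (rule wilson_weight_axis_moments)
    show "Re x > 0" if "x \<in> {a', b', c', d'}" for x using big[OF that] by (simp add: M_def)
    show "wilson_int (\<lambda>s. \<i> * of_real s) a' b' c' d' p = 0" for p
      using shifted straight by simp
  qed
qed

section \<open>Orthogonality as vanishing of Jacobi moments\<close>

text \<open>
  For \<open>Re z > 0\<close>, \<open>Re \<kappa> > 0\<close> this is the integral of \<open>u\<^bsup>z - 1\<^esup> (1 - u)\<^bsup>\<kappa> - 1\<^esup> \<Sum> x\<^sub>k u\<^sup>k\<close> over \<open>(0, 1)\<close>, divided by
  \<open>\<Gamma>(z) \<Gamma>(\<kappa>) / \<Gamma>(z + \<kappa> + N)\<close>; as a polynomial it makes sense for all \<open>z\<close> and \<open>\<kappa>\<close>.
\<close>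

definition jacobi_moment_poly :: "complex \<Rightarrow> nat \<Rightarrow> (nat \<Rightarrow> complex) \<Rightarrow> complex poly" where
  "jacobi_moment_poly \<kappa> N x =
     (\<Sum>k\<le>N. smult (x k) (pochhammer [:0, 1:] k * pochhammer [:\<kappa> + of_nat k, 1:] (N - k)))"

lemma poly_pochhammer: "poly (pochhammer p n) z = pochhammer (poly p z) n"
  by (induction n) (simp_all add: pochhammer_Suc)

lemma degree_pochhammer_linear: "degree (pochhammer [:u, 1:] n :: complex poly) \<le> n"
proof (induction n)
  case (Suc n)
  have "[:u, 1:] + of_nat n = [:u + of_nat n, 1:]" by (simp add: of_nat_poly)
  hence "pochhammer [:u, 1:] (Suc n) = pochhammer [:u, 1:] n * [:u + of_nat n, 1:]"
    by (simp add: pochhammer_Suc)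
  also have "degree \<dots> \<le> degree (pochhammer [:u, 1:] n) + degree [:u + of_nat n, 1:]"
    by (rule degree_mult_le)
  also have "\<dots> \<le> Suc n" using Suc by simp
  finally show ?case .
qed simp

lemma poly_jacobi_moment_poly:
  "poly (jacobi_moment_poly \<kappa> N x) z =
     (\<Sum>k\<le>N. x k * (pochhammer z k * pochhammer (z + \<kappa> + of_nat k) (N - k)))"
  by (simp add: jacobi_moment_poly_def poly_sum poly_pochhammer add_ac)

lemma degree_jacobi_moment_poly: "degree (jacobi_moment_poly \<kappa> N x) \<le> N"
  unfolding jacobi_moment_poly_def
proof (rule degree_sum_le)
  fix k assume "k \<in> {..N}"
  have "degree (smult (x k) (pochhammer [:0, 1:] k * pochhammer [:\<kappa> + of_nat k, 1:] (N - k))) \<le>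
      degree (pochhammer [:0, 1:] k * pochhammer [:\<kappa> + of_nat k, 1:] (N - k))"
    by (rule degree_smult_le)
  also have "\<dots> \<le> degree (pochhammer [:0, 1:] k :: complex poly) + degree (pochhammer [:\<kappa> + of_nat k, 1:] (N - k))"
    by (rule degree_mult_le)
  also have "\<dots> \<le> k + (N - k)" by (intro add_mono degree_pochhammer_linear)
  finally show "degree (smult (x k) (pochhammer [:0, 1:] k * pochhammer [:\<kappa> + of_nat k, 1:] (N - k))) \<le> N"
    using \<open>k \<in> {..N}\<close> by simp
qed simp

text \<open>
  At \<open>z = - i\<close> only the terms with \<open>k \<le> i\<close> survive, so evaluation at \<open>0, -1, -2, \<dots>\<close> is a triangular system
  for the coefficients, with diagonal entries that are not zero.
\<close>

lemma jacobi_moment_poly_eq_0: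
  assumes "jacobi_moment_poly \<kappa> N x = 0" "\<kappa> \<notin> \<int>\<^sub>\<le>\<^sub>0" "i \<le> N"
  shows "x i = 0"
  using assms(3)
proof (induction i rule: less_induct)
  case (less i)
  have vanish: "pochhammer (- of_nat i) k = (0 :: complex)" if "k > i" for k
    using that by (rule pochhammer_of_nat_eq_0_lemma)
  have "0 = poly (jacobi_moment_poly \<kappa> N x) (- of_nat i)" using assms(1) by simp
  also have "\<dots> = (\<Sum>k\<le>N. x k * (pochhammer (- of_nat i) k * pochhammer (- of_nat i + \<kappa> + of_nat k) (N - k)))"
    by (rule poly_jacobi_moment_poly)
  also have "\<dots> = (\<Sum>k\<in>{i}. x k * (pochhammer (- of_nat i) k * pochhammer (- of_nat i + \<kappa> + of_nat k) (N - k)))"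
  proof (rule sum.mono_neutral_right)
    show "\<forall>k\<in>{..N} - {i}. x k * (pochhammer (- of_nat i) k * pochhammer (- of_nat i + \<kappa> + of_nat k) (N - k)) = 0"
    proof
      fix k assume k: "k \<in> {..N} - {i}"
      show "x k * (pochhammer (- of_nat i) k * pochhammer (- of_nat i + \<kappa> + of_nat k) (N - k)) = 0"
        using k less.IH[of k] vanish[of k] by (cases "k < i") auto
    qed
  qed (use less.prems in auto)
  finally have "x i * (pochhammer (- of_nat i) i * pochhammer \<kappa> (N - i)) = 0" by simp
  moreover have "pochhammer (- of_nat i) i \<noteq> (0 :: complex)"
    by (auto simp: pochhammer_eq_0_iff)
  moreover have "pochhammer \<kappa> (N - i) \<noteq> 0" using assms(2) by (auto dest: pochhammer_eq_0_imp_nonpos_Int)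
  ultimately show "x i = 0" by simp
qed

text \<open>Both families of \<open>n\<close> polynomials span the polynomials of degree less than \<open>n\<close>.\<close>

lemma wilson_orthogonality_basis:
  assumes wc: "wilson_contour a b c d \<gamma>"
  shows "(\<forall>k<n. wilson_int \<gamma> a b c d (p * monom 1 k) = 0) \<longleftrightarrow>
         (\<forall>l<n. wilson_int \<gamma> a b c d (p * wilson_basis b l) = 0)"
proof
  assume m: "\<forall>k<n. wilson_int \<gamma> a b c d (p * monom 1 k) = 0"
  show "\<forall>l<n. wilson_int \<gamma> a b c d (p * wilson_basis b l) = 0"
  proof (intro allI impI)
    fix l assume l: "l < n"
    have "wilson_basis b l = (\<Sum>i\<le>l. smult (coeff (wilson_basis b l) i) (monom 1 i))"
      using poly_as_sum_of_monoms[of "wilson_basis b l"] by (simp add: smult_monom)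
    hence "p * wilson_basis b l = (\<Sum>i\<le>l. smult (coeff (wilson_basis b l) i) (p * monom 1 i))"
      by (metis (no_types, lifting) mult_smult_right sum.cong sum_distrib_left)
    hence "wilson_int \<gamma> a b c d (p * wilson_basis b l) =
        (\<Sum>i\<le>l. coeff (wilson_basis b l) i * wilson_int \<gamma> a b c d (p * monom 1 i))"
      by (simp only: wilson_int_sum[OF wc] wilson_int_smult)
    also have "\<dots> = 0" using m l by (intro sum.neutral) auto
    finally show "wilson_int \<gamma> a b c d (p * wilson_basis b l) = 0" .
  qed
next
  assume m: "\<forall>l<n. wilson_int \<gamma> a b c d (p * wilson_basis b l) = 0"
  have "\<forall>l. k + l < n \<longrightarrow> wilson_int \<gamma> a b c d (p * (monom 1 k * wilson_basis b l)) = 0" for k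
  proof (induction k)
    case 0 thus ?case using m by (simp add: monom_0)
  next
    case (Suc k)
    show ?case
    proof (intro allI impI)
      fix l assume l: "Suc k + l < n"
      have "[:(b + of_nat l)\<^sup>2, - 1:] = smult ((b + of_nat l)\<^sup>2) 1 - monom 1 1"
        by (simp add: monom_Suc monom_0 one_pCons)
      hence "wilson_basis b (Suc l) = smult ((b + of_nat l)\<^sup>2) (wilson_basis b l) - monom 1 1 * wilson_basis b l"
        unfolding wilson_basis_Suc by (simp add: left_diff_distrib)
      hence "monom 1 1 * wilson_basis b l = smult ((b + of_nat l)\<^sup>2) (wilson_basis b l) + smult (- 1) (wilson_basis b (Suc l))"
        by simp
      moreover have "monom 1 (Suc k) = monom 1 k * (monom 1 1 :: complex poly)" by (simp add: mult_monom)
      ultimately have "p * (monom 1 (Suc k) * wilson_basis b l) =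
          p * (monom 1 k * (smult ((b + of_nat l)\<^sup>2) (wilson_basis b l) + smult (- 1) (wilson_basis b (Suc l))))"
        by (simp only: mult.assoc)
      also have "\<dots> = smult ((b + of_nat l)\<^sup>2) (p * (monom 1 k * wilson_basis b l)) +
          smult (- 1) (p * (monom 1 k * wilson_basis b (Suc l)))"
        by (simp add: distrib_left right_diff_distrib)
      finally have "wilson_int \<gamma> a b c d (p * (monom 1 (Suc k) * wilson_basis b l)) =
          (b + of_nat l)\<^sup>2 * wilson_int \<gamma> a b c d (p * (monom 1 k * wilson_basis b l)) +
          (- 1) * wilson_int \<gamma> a b c d (p * (monom 1 k * wilson_basis b (Suc l)))"
        by (simp only: wilson_int_add[OF wc] wilson_int_smult)
      thus "wilson_int \<gamma> a b c d (p * (monom 1 (Suc k) * wilson_basis b l)) = 0"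
        using Suc l by simp
    qed
  qed
  from this[THEN spec, of _ 0] show "\<forall>k<n. wilson_int \<gamma> a b c d (p * monom 1 k) = 0" by simp
qed

text \<open>
  The evaluated products \<open>\<phi>\<^sub>k \<psi>\<^sub>l\<close> have denominators \<open>(a + b + c + d)\<^sub>k\<^sub>+\<^sub>l\<close>. Over the common denominator with
  subscript \<open>N + l\<close> the dependence on \<open>k\<close> and \<open>l\<close> is precisely that of the summands of \<open>jacobi_moment_poly\<close> at \<open>a + b + l\<close>.
\<close>

lemma wilson_int_jacobi_moment:
  assumes wc: "wilson_contour a b c d \<gamma>"
    and p: "p = (\<Sum>k\<le>N. smult (e k) (wilson_basis a k))"
  defines "x \<equiv> \<lambda>k. e k * (pochhammer (a + c) k * pochhammer (a + d) k)"
  shows "pochhammer (a + b + c + d) (N + l) * wilson_int \<gamma> a b c d (p * wilson_basis b l) =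
     wilson_int \<gamma> a b c d 1 * (pochhammer (a + b) l * pochhammer (b + c) l * pochhammer (b + d) l) *
     poly (jacobi_moment_poly (c + d) N x) (a + b + of_nat l)"
proof -
  define s where "s = a + b + c + d"
  define m where "m = wilson_int \<gamma> a b c d 1"
  have "p * wilson_basis b l = (\<Sum>k\<le>N. smult (e k) (wilson_basis a k * wilson_basis b l))"
    unfolding p by (simp add: sum_distrib_right)
  hence "wilson_int \<gamma> a b c d (p * wilson_basis b l) =
      (\<Sum>k\<le>N. e k * wilson_int \<gamma> a b c d (wilson_basis a k * wilson_basis b l))"
    by (simp only: wilson_int_sum[OF wc] wilson_int_smult)
  hence "pochhammer s (N + l) * wilson_int \<gamma> a b c d (p * wilson_basis b l) =
      (\<Sum>k\<le>N. pochhammer s (N + l) * (e k * wilson_int \<gamma> a b c d (wilson_basis a k * wilson_basis b l)))"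
    by (simp add: sum_distrib_left)
  also have "\<dots> = (\<Sum>k\<le>N. m * (pochhammer (a + b) l * pochhammer (b + c) l * pochhammer (b + d) l) *
     (x k * (pochhammer (a + b + of_nat l) k * pochhammer (a + b + of_nat l + (c + d) + of_nat k) (N - k))))"
  proof (rule sum.cong[OF refl])
    fix k assume "k \<in> {..N}"
    hence split: "N + l = (k + l) + (N - k)" by simp
    have 1: "pochhammer s (N + l) = pochhammer s (k + l) * pochhammer (a + b + of_nat l + (c + d) + of_nat k) (N - k)"
      by (subst split, subst pochhammer_product') (simp add: s_def add_ac)
    have 2: "pochhammer (a + b) (k + l) = pochhammer (a + b) l * pochhammer (a + b + of_nat l) k"
      by (subst add.commute, rule pochhammer_product')
    have 3: "pochhammer s (k + l) * wilson_int \<gamma> a b c d (wilson_basis a k * wilson_basis b l) =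
       (pochhammer (a + b) l * pochhammer (a + b + of_nat l) k) * pochhammer (a + c) k * pochhammer (a + d) k *
       pochhammer (b + c) l * pochhammer (b + d) l * m"
      unfolding s_def m_def 2[symmetric] by (rule wilson_int_basis_product[OF wc])
    have "pochhammer s (N + l) * (e k * wilson_int \<gamma> a b c d (wilson_basis a k * wilson_basis b l)) =
       e k * pochhammer (a + b + of_nat l + (c + d) + of_nat k) (N - k) *
       (pochhammer s (k + l) * wilson_int \<gamma> a b c d (wilson_basis a k * wilson_basis b l))"
      unfolding 1 by (simp only: mult_ac)
    also have "\<dots> = m * (pochhammer (a + b) l * pochhammer (b + c) l * pochhammer (b + d) l) *
     (x k * (pochhammer (a + b + of_nat l) k * pochhammer (a + b + of_nat l + (c + d) + of_nat k) (N - k)))"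
      unfolding 3 x_def by (simp only: mult_ac)
    finally show "pochhammer s (N + l) * (e k * wilson_int \<gamma> a b c d (wilson_basis a k * wilson_basis b l)) = \<dots>" .
  qed
  also have "\<dots> = m * (pochhammer (a + b) l * pochhammer (b + c) l * pochhammer (b + d) l) *
     poly (jacobi_moment_poly (c + d) N x) (a + b + of_nat l)"
    unfolding poly_jacobi_moment_poly sum_distrib_left ..
  finally show ?thesis by (simp add: s_def m_def)
qed

definition wilson_params :: "complex \<Rightarrow> complex \<Rightarrow> complex \<Rightarrow> complex \<Rightarrow> bool" where
  "wilson_params a b c d \<longleftrightarrow>
     {2 * a, a + b, a + c, a + d, 2 * b, b + c, b + d, 2 * c, c + d, 2 * d, a + b + c + d} \<inter> \<int>\<^sub>\<le>\<^sub>0 = {}"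

lemma wilson_functional_orthogonality:
  assumes par: "wilson_params a b c d"
    and p: "p = (\<Sum>k\<le>N. smult (e k) (wilson_basis a k))"
  shows "(\<forall>k<n. wilson_functional a b c d (p * monom 1 k) = 0) \<longleftrightarrow>
         (\<forall>l<n. poly (jacobi_moment_poly (c + d) N (\<lambda>k. e k * (pochhammer (a + c) k * pochhammer (a + d) k)))
                    (a + b + of_nat l) = 0)"
proof -
  have nz: "a + b \<notin> \<int>\<^sub>\<le>\<^sub>0" "b + c \<notin> \<int>\<^sub>\<le>\<^sub>0" "b + d \<notin> \<int>\<^sub>\<le>\<^sub>0" "a + b + c + d \<notin> \<int>\<^sub>\<le>\<^sub>0"
    using par unfolding wilson_params_def by blast+
  have "\<exists>\<gamma>. wilson_contour a b c d \<gamma>"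
  proof (rule wilson_contour_exists)
    fix x y assume "x \<in> {a, b, c, d}" "y \<in> {a, b, c, d}"
    moreover have "a + a \<notin> \<int>\<^sub>\<le>\<^sub>0" "b + b \<notin> \<int>\<^sub>\<le>\<^sub>0" "c + c \<notin> \<int>\<^sub>\<le>\<^sub>0" "d + d \<notin> \<int>\<^sub>\<le>\<^sub>0"
      "a + b \<notin> \<int>\<^sub>\<le>\<^sub>0" "a + c \<notin> \<int>\<^sub>\<le>\<^sub>0" "a + d \<notin> \<int>\<^sub>\<le>\<^sub>0" "b + c \<notin> \<int>\<^sub>\<le>\<^sub>0" "b + d \<notin> \<int>\<^sub>\<le>\<^sub>0" "c + d \<notin> \<int>\<^sub>\<le>\<^sub>0"
      using par unfolding wilson_params_def mult_2 by blast+
    moreover from this have "b + a \<notin> \<int>\<^sub>\<le>\<^sub>0" "c + a \<notin> \<int>\<^sub>\<le>\<^sub>0" "d + a \<notin> \<int>\<^sub>\<le>\<^sub>0" "c + b \<notin> \<int>\<^sub>\<le>\<^sub>0" "d + b \<notin> \<int>\<^sub>\<le>\<^sub>0" "d + c \<notin> \<int>\<^sub>\<le>\<^sub>0"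
      by (simp_all add: add.commute)
    ultimately show "x + y \<notin> \<int>\<^sub>\<le>\<^sub>0"
      by (elim insertE emptyE) simp_all
  qed
  define \<gamma> where "\<gamma> = (SOME \<gamma>. wilson_contour a b c d \<gamma>)"
  have wc: "wilson_contour a b c d \<gamma>" unfolding \<gamma>_def using \<open>\<exists>\<gamma>. wilson_contour a b c d \<gamma>\<close> by (rule someI_ex)
  have L: "wilson_functional a b c d h = wilson_int \<gamma> a b c d h" for h
    by (simp add: wilson_functional_def wilson_int_def contour_int_def \<gamma>_def Let_def)
  have poch: "pochhammer z k \<noteq> 0" if "z \<notin> \<int>\<^sub>\<le>\<^sub>0" for z :: complex and k
    using that by (auto dest: pochhammer_eq_0_imp_nonpos_Int)
  have zero_iff: "u = 0 \<longleftrightarrow> v = 0" if "x * u = y * v" "x \<noteq> 0" "y \<noteq> 0" for x y u v :: complex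
    using that by (metis mult_eq_0_iff)
  have "wilson_int \<gamma> a b c d (p * wilson_basis b l) = 0 \<longleftrightarrow>
     poly (jacobi_moment_poly (c + d) N (\<lambda>k. e k * (pochhammer (a + c) k * pochhammer (a + d) k))) (a + b + of_nat l) = 0" for l
    by (rule zero_iff[OF wilson_int_jacobi_moment[OF wc p, of l] poch[OF nz(4)]])
       (simp add: poch nz wilson_mass_nonzero[OF wc nz(4)])
  thus ?thesis unfolding L wilson_orthogonality_basis[OF wc] by simp
qed

text \<open>Counting zeros: a polynomial \<open>Q\<close> of degree less than \<open>N\<close> cannot vanish at all the \<open>N\<close> points \<open>a + b\<^sub>j + l\<close>.\<close>

theorem wilson_system_perfect:
  assumes par: "\<And>j. j \<in> {1..m} \<Longrightarrow> wilson_params a (b j) c d"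
    and ac: "a + c \<notin> \<int>\<^sub>\<le>\<^sub>0" "a + d \<notin> \<int>\<^sub>\<le>\<^sub>0" "c + d \<notin> \<int>\<^sub>\<le>\<^sub>0"
    and inc: "\<And>l k. l \<in> {1..m} \<Longrightarrow> k \<in> {1..m} \<Longrightarrow> l \<noteq> k \<Longrightarrow> b l - b k \<notin> \<int>"
  shows "perfect_system m (\<lambda>j. wilson_functional a (b j) c d)"
  unfolding perfect_system_def normal_index_def
proof (intro allI impI)
  fix n p assume mop: "is_type_II_mop m (\<lambda>j. wilson_functional a (b j) c d) n p"
  define N where "N = mi_size m n"
  have p: "p \<noteq> 0" "degree p \<le> N"
    and orth: "\<And>j. j \<in> {1..m} \<Longrightarrow> \<forall>k<n j. wilson_functional a (b j) c d (p * monom 1 k) = 0"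
    using mop by (auto simp: is_type_II_mop_def N_def)
  show "degree p = mi_size m n"
  proof (rule ccontr)
    assume "degree p \<noteq> mi_size m n"
    hence deg: "degree p \<le> N - 1" "N > 0" using p(2) by (auto simp: N_def)
    obtain e where e: "p = (\<Sum>k\<le>N - 1. smult (e k) (wilson_basis a k))"
      using wilson_basis_spans[OF deg(1), of a] by blast
    define x where "x = (\<lambda>k. e k * (pochhammer (a + c) k * pochhammer (a + d) k))"
    define Q where "Q = jacobi_moment_poly (c + d) (N - 1) x"
    define z where "z = (\<lambda>(j, l). a + b j + of_nat l)"
    define I where "I = (SIGMA j:{1..m}. {..<n j})"
    have roots: "z ` I \<subseteq> {t. poly Q t = 0}"
    proof
      fix t assume "t \<in> z ` I"
      then obtain j l where jl: "j \<in> {1..m}" "l < n j" "t = a + b j + of_nat l" by (auto simp: I_def z_def)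
      show "t \<in> {t. poly Q t = 0}"
        using wilson_functional_orthogonality[OF par[OF jl(1)] e, of "n j"] orth[OF jl(1)] jl(2,3)
        by (simp add: Q_def x_def)
    qed
    have inj: "inj_on z I"
    proof (rule inj_onI)
      fix u v assume u: "u \<in> I" and v: "v \<in> I" and eq: "z u = z v"
      obtain j l where u': "u = (j, l)" "j \<in> {1..m}" using u by (auto simp: I_def)
      obtain j' l' where v': "v = (j', l')" "j' \<in> {1..m}" using v by (auto simp: I_def)
      have "b j + of_nat l = b j' + of_nat l'" using eq u' v' by (simp add: z_def)
      hence diff: "b j - b j' = of_int (int l' - int l)" by (simp add: algebra_simps)
      hence "j = j'" using inc[OF u'(2) v'(2)] by (metis Ints_of_int)
      moreover from this have "l = l'" using diff by simp
      ultimately show "u = v" using u' v' by simp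
    qed
    have "card (z ` I) = N" using inj by (simp add: card_image I_def N_def mi_size_def)
    have "Q = 0"
    proof (rule ccontr)
      assume "Q \<noteq> 0"
      hence "N \<le> card {t. poly Q t = 0}"
        using card_mono[OF poly_roots_finite roots] \<open>card (z ` I) = N\<close> by simp
      also have "\<dots> \<le> degree Q" using \<open>Q \<noteq> 0\<close> by (rule card_poly_roots_bound)
      also have "\<dots> \<le> N - 1" unfolding Q_def by (rule degree_jacobi_moment_poly)
      finally show False using deg(2) by simp
    qed
    have "e k = 0" if "k \<le> N - 1" for k
    proof -
      have "x k = 0" using jacobi_moment_poly_eq_0[OF \<open>Q = 0\<close>[unfolded Q_def] ac(3) that] .
      moreover have "pochhammer (a + c) k \<noteq> 0" "pochhammer (a + d) k \<noteq> 0"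
        using ac by (auto dest: pochhammer_eq_0_imp_nonpos_Int)
      ultimately show ?thesis by (simp add: x_def)
    qed
    hence "p = 0" unfolding e by (intro sum.neutral) auto
    thus False using p(1) by simp
  qed
qed

section \<open>Moments of Jacobi-Pineiro polynomials\<close>

text \<open>A neighbourhood of the interval \<open>(0, 1)\<close> on which all powers in the Rodrigues formula are holomorphic.\<close>

definition unit_strip :: "complex set" where
  "unit_strip = {v. 0 < Re v \<and> Re v < 1}"

lemma open_unit_strip: "open unit_strip"
proof -
  have "unit_strip = {v. Re v > 0} \<inter> {v. Re v < 1}" by (auto simp: unit_strip_def)
  moreover have "open ({v::complex. Re v > 0} \<inter> {v. Re v < 1})"
    by (intro open_Int open_halfspace_Re_gt open_halfspace_Re_lt)
  ultimately show ?thesis by simp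
qed

lemma unit_strip_powr:
  assumes "v \<in> unit_strip"
  shows "v \<notin> \<real>\<^sub>\<le>\<^sub>0" "1 - v \<notin> \<real>\<^sub>\<le>\<^sub>0" "v \<noteq> 0" "1 - v \<noteq> 0"
  using assms by (auto simp: unit_strip_def complex_nonpos_Reals_iff complex_eq_iff)

text \<open>
  Carrying out the innermost derivative lowers the order by one. A Rodrigues operator of order \<open>k\<close> is thus the
  composition of the first-order operators \<open>v d/dv + \<alpha> + i\<close> for \<open>i = 1, \<dots>, k\<close>.
\<close>

lemma rodrigues_op_Suc:
  assumes f: "f holomorphic_on unit_strip" and u: "u \<in> unit_strip"
  shows "rodrigues_op \<alpha> (Suc k) f u =
         rodrigues_op \<alpha> k (\<lambda>v. (of_nat (Suc k) + \<alpha>) * f v + v * deriv f v) u"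
proof -
  define c where "c = of_nat (Suc k) + \<alpha>"
  define g where "g = (\<lambda>v. v powr c * f v)"
  define h where "h = (\<lambda>v. v powr (of_nat k + \<alpha>) * (c * f v + v * deriv f v))"
  have powr_hol: "(\<lambda>v. v powr e) holomorphic_on unit_strip" for e
    by (intro holomorphic_intros) (use unit_strip_powr in auto)
  have df: "deriv f holomorphic_on unit_strip" by (rule holomorphic_deriv[OF f open_unit_strip])
  have g_hol: "g holomorphic_on unit_strip" unfolding g_def by (intro holomorphic_intros powr_hol f)
  have "deriv g v = h v" if v: "v \<in> unit_strip" for v
  proof -
    have "(f has_field_derivative deriv f v) (at v)" by (rule holomorphic_derivI[OF f open_unit_strip v])
    hence "(g has_field_derivative (v powr c * deriv f v + c * v powr (c - 1) * f v)) (at v)"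
      unfolding g_def using unit_strip_powr(1)[OF v]
      by (auto intro!: derivative_eq_intros simp: algebra_simps)
    moreover have "v powr c = v * v powr (c - 1)"
      using unit_strip_powr(3)[OF v] by (simp add: powr_diff)
    moreover have "c - 1 = of_nat k + \<alpha>" by (simp add: c_def)
    ultimately show ?thesis by (simp add: DERIV_imp_deriv h_def algebra_simps)
  qed
  hence "(deriv ^^ k) (deriv g) u = (deriv ^^ k) h u"
    unfolding h_def using df f
    by (intro higher_deriv_transform_within_open[OF _ _ open_unit_strip u] holomorphic_deriv g_hol
        open_unit_strip holomorphic_intros powr_hol) auto
  moreover have "(deriv ^^ Suc k) g u = (deriv ^^ k) (deriv g) u"
    by (simp only: funpow_Suc_right o_apply)
  ultimately show ?thesis by (simp only: rodrigues_op_def g_def h_def c_def)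
qed

text \<open>
  The effect of \<open>c + v d/dv\<close> on \<open>(1 - v)\<^bsup>\<gamma>\<^esup> p(v)\<close>, expressed on \<open>p\<close> after a factor \<open>(1 - v)\<^bsup>\<gamma> - 1\<^esup>\<close> has been split off.
\<close>

definition rodrigues_step :: "complex \<Rightarrow> complex \<Rightarrow> complex poly \<Rightarrow> complex poly" where
  "rodrigues_step c \<gamma> p = [:c, - c - \<gamma>:] * p + [:0, 1, - 1:] * pderiv p"

lemma rodrigues_step_correct:
  assumes f: "\<And>v. v \<in> unit_strip \<Longrightarrow> f v = (1 - v) powr \<gamma> * poly p v" and v: "v \<in> unit_strip"
  shows "c * f v + v * deriv f v = (1 - v) powr (\<gamma> - 1) * poly (rodrigues_step c \<gamma> p) v"
proof -
  have "((\<lambda>v. (1 - v) powr \<gamma> * poly p v) has_field_derivative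
      ((1 - v) powr \<gamma> * poly (pderiv p) v - \<gamma> * (1 - v) powr (\<gamma> - 1) * poly p v)) (at v)"
    using unit_strip_powr(2)[OF v] by (auto intro!: derivative_eq_intros simp: algebra_simps)
  hence "(f has_field_derivative
      ((1 - v) powr \<gamma> * poly (pderiv p) v - \<gamma> * (1 - v) powr (\<gamma> - 1) * poly p v)) (at v)"
    by (rule has_field_derivative_transform_within_open[OF _ open_unit_strip v]) (simp add: f)
  hence d: "deriv f v = (1 - v) powr \<gamma> * poly (pderiv p) v - \<gamma> * (1 - v) powr (\<gamma> - 1) * poly p v"
    by (rule DERIV_imp_deriv)
  have s: "(1 - v) powr \<gamma> = (1 - v) * (1 - v) powr (\<gamma> - 1)"
    using unit_strip_powr(4)[OF v] by (simp add: powr_diff)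
  show ?thesis unfolding f[OF v] d s
    by (simp add: rodrigues_step_def) (simp add: algebra_simps)
qed

lemma degree_rodrigues_step: "degree (rodrigues_step c \<gamma> p) \<le> Suc (degree p)"
proof -
  have "degree ([:c, - c - \<gamma>:] * p) \<le> Suc (degree p)"
    using degree_mult_le[of "[:c, - c - \<gamma>:]" p] by (simp split: if_splits)
  moreover have "degree ([:0, 1, - 1:] * pderiv p) \<le> Suc (degree p)"
  proof (cases "degree p = 0")
    case True
    hence "pderiv p = 0" by (simp add: pderiv_eq_0_iff)
    thus ?thesis by simp
  next
    case False
    thus ?thesis using degree_mult_le[of "[:0, 1, - 1:]" "pderiv p"] by (simp add: degree_pderiv)
  qed
  ultimately show ?thesis unfolding rodrigues_step_def by (rule degree_add_le)
qed

text \<open>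
  The integral of \<open>u\<^bsup>z - 1\<^esup> (1 - u)\<^bsup>\<gamma>\<^esup> p(u)\<close> over \<open>(0, 1)\<close>, divided by \<open>\<Gamma>(\<gamma> + 1)\<close> and evaluated by the Beta integral. As a
  finite sum it makes sense for every \<open>\<gamma>\<close>; each differentiation lowers \<open>\<gamma>\<close> by one.
\<close>

definition jacobi_moment :: "complex \<Rightarrow> complex \<Rightarrow> complex poly \<Rightarrow> complex" where
  "jacobi_moment z \<gamma> p =
     (\<Sum>k\<le>degree p. coeff p k * (Gamma (z + of_nat k) * rGamma (z + of_nat k + \<gamma> + 1)))"

lemma jacobi_moment_altdef:
  assumes "degree p \<le> N"
  shows "jacobi_moment z \<gamma> p =
     (\<Sum>k\<le>N. coeff p k * (Gamma (z + of_nat k) * rGamma (z + of_nat k + \<gamma> + 1)))"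
  unfolding jacobi_moment_def using assms
  by (intro sum.mono_neutral_left) (auto simp: coeff_eq_0)

lemma jacobi_moment_add: "jacobi_moment z \<gamma> (p + q) = jacobi_moment z \<gamma> p + jacobi_moment z \<gamma> q"
proof -
  define N where "N = max (degree p) (degree q)"
  have "degree p \<le> N" "degree q \<le> N" "degree (p + q) \<le> N"
    using degree_add_le_max[of p q] by (auto simp: N_def)
  thus ?thesis by (simp add: jacobi_moment_altdef[of _ N] sum.distrib distrib_right)
qed

lemma jacobi_moment_monom:
  "jacobi_moment z \<gamma> (monom u k) = u * (Gamma (z + of_nat k) * rGamma (z + of_nat k + \<gamma> + 1))"
proof -
  have "jacobi_moment z \<gamma> (monom u k) =
     (\<Sum>i\<le>k. coeff (monom u k) i * (Gamma (z + of_nat i) * rGamma (z + of_nat i + \<gamma> + 1)))"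
    by (rule jacobi_moment_altdef) (rule degree_monom_le)
  also have "\<dots> = (\<Sum>i\<in>{k}. coeff (monom u k) i * (Gamma (z + of_nat i) * rGamma (z + of_nat i + \<gamma> + 1)))"
    by (rule sum.mono_neutral_right) auto
  finally show ?thesis by simp
qed

text \<open>
  Integration by parts: against \<open>u\<^bsup>z - 1\<^esup>\<close> the operator \<open>u d/du\<close> becomes multiplication by \<open>- z\<close>. The factor \<open>\<gamma>\<close> comes from the
  normalisation by \<open>\<Gamma>(\<gamma> + 1)\<close>. By linearity it is enough to treat monomials, where both sides are explicit.
\<close>

lemma jacobi_moment_rodrigues_step:
  assumes z: "Re z > 0"
  shows "jacobi_moment z (\<gamma> - 1) (rodrigues_step c \<gamma> p) = \<gamma> * (c - z) * jacobi_moment z \<gamma> p"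
proof -
  have add: "rodrigues_step c \<gamma> (p + q) = rodrigues_step c \<gamma> p + rodrigues_step c \<gamma> q" for p q
    by (simp add: rodrigues_step_def pderiv_add distrib_left)
  have monom: "jacobi_moment z (\<gamma> - 1) (rodrigues_step c \<gamma> (monom u k)) = \<gamma> * (c - z) * jacobi_moment z \<gamma> (monom u k)" for u k
  proof -
    have lin: "[:c, - c - \<gamma>:] = monom c 0 + monom (- c - \<gamma>) 1" "[:0, 1, - 1:] = monom (1::complex) 1 + monom (- 1) 2"
      by (simp_all add: monom_altdef numeral_2_eq_2)
    have "rodrigues_step c \<gamma> (monom u k) = monom ((c + of_nat k) * u) k + monom (- (c + \<gamma> + of_nat k) * u) (Suc k)"
    proof (cases k)
      case 0
      show ?thesis unfolding rodrigues_step_def lin 0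
        by (simp add: mult_monom distrib_right monom_0 smult_monom algebra_simps)
    next
      case (Suc l)
      have "rodrigues_step c \<gamma> (monom u k) =
         monom (c * u) k + monom ((- c - \<gamma>) * u) (Suc k) + (monom (of_nat k * u) k + monom (- (of_nat k * u)) (Suc k))"
        unfolding rodrigues_step_def lin Suc pderiv_monom
        by (simp add: mult_monom distrib_right)
      also have "\<dots> = monom (c * u + of_nat k * u) k + monom ((- c - \<gamma>) * u + - (of_nat k * u)) (Suc k)"
        by (simp only: add_monom[symmetric] ac_simps)
      also have "\<dots> = monom ((c + of_nat k) * u) k + monom (- (c + \<gamma> + of_nat k) * u) (Suc k)"
        by (simp add: algebra_simps)
      finally show ?thesis .
    qed
    hence 1: "jacobi_moment z (\<gamma> - 1) (rodrigues_step c \<gamma> (monom u k)) =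
       (c + of_nat k) * u * (Gamma (z + of_nat k) * rGamma (z + of_nat k + \<gamma>)) +
       (- (c + \<gamma> + of_nat k) * u) * (Gamma (z + of_nat k + 1) * rGamma (z + of_nat k + \<gamma> + 1))"
      by (simp add: jacobi_moment_add jacobi_moment_monom add_ac)
    have 2: "rGamma (z + of_nat k + \<gamma>) = (z + of_nat k + \<gamma>) * rGamma (z + of_nat k + \<gamma> + 1)"
      by (rule rGamma_plus1[symmetric])
    have 3: "Gamma (z + of_nat k + 1) = (z + of_nat k) * Gamma (z + of_nat k)"
      by (rule Gamma_plus1, rule nonpos_Int_Re_pos) (use z in simp)
    show ?thesis unfolding 1 2 3 jacobi_moment_monom by algebra
  qed
  have "jacobi_moment z (\<gamma> - 1) (rodrigues_step c \<gamma> (\<Sum>k\<in>K. monom (x k) k)) = \<gamma> * (c - z) * jacobi_moment z \<gamma> (\<Sum>k\<in>K. monom (x k) k)"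
    if "finite K" for K x
    using that
  proof (induction K rule: finite_induct)
    case empty
    have "rodrigues_step c \<gamma> 0 = 0" by (simp add: rodrigues_step_def)
    thus ?case by (simp add: jacobi_moment_def)
  next
    case (insert k K)
    thus ?case by (simp add: add jacobi_moment_add monom distrib_left)
  qed
  from this[of "{..degree p}" "coeff p"] show ?thesis by (simp add: poly_as_sum_of_monoms)
qed

lemma rodrigues_op_poly:
  assumes "\<And>v. v \<in> unit_strip \<Longrightarrow> f v = (1 - v) powr \<gamma> * poly p v"
  shows "\<exists>q. degree q \<le> degree p + k \<and>
     (\<forall>u\<in>unit_strip. rodrigues_op \<alpha> k f u = (1 - u) powr (\<gamma> - of_nat k) * poly q u) \<and>
     (\<forall>z. Re z > 0 \<longrightarrow> jacobi_moment z (\<gamma> - of_nat k) q =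
        pochhammer (\<gamma> - of_nat k + 1) k * pochhammer (\<alpha> + 1 - z) k * jacobi_moment z \<gamma> p)"
  using assms
proof (induction k arbitrary: f \<gamma> p)
  case 0
  have "rodrigues_op \<alpha> 0 f u = f u" if "u \<in> unit_strip" for u
    using unit_strip_powr(3)[OF that] by (simp add: rodrigues_op_def powr_minus)
  thus ?case using 0 by (intro exI[of _ p]) auto
next
  case (Suc k)
  define c where "c = of_nat (Suc k) + \<alpha>"
  define f1 where "f1 = (\<lambda>v. c * f v + v * deriv f v)"
  define p1 where "p1 = rodrigues_step c \<gamma> p"
  have f1: "f1 v = (1 - v) powr (\<gamma> - 1) * poly p1 v" if "v \<in> unit_strip" for v
    unfolding f1_def p1_def by (rule rodrigues_step_correct[OF Suc.prems that])
  have "(\<lambda>v. (1 - v) powr \<gamma> * poly p v) holomorphic_on unit_strip"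
    by (intro holomorphic_intros) (use unit_strip_powr in auto)
  hence f_hol: "f holomorphic_on unit_strip"
    by (rule holomorphic_transform) (simp add: Suc.prems)
  obtain q where q: "degree q \<le> degree p1 + k"
    "\<And>u. u \<in> unit_strip \<Longrightarrow> rodrigues_op \<alpha> k f1 u = (1 - u) powr (\<gamma> - 1 - of_nat k) * poly q u"
    "\<And>z. Re z > 0 \<Longrightarrow> jacobi_moment z (\<gamma> - 1 - of_nat k) q =
        pochhammer (\<gamma> - 1 - of_nat k + 1) k * pochhammer (\<alpha> + 1 - z) k * jacobi_moment z (\<gamma> - 1) p1"
    using Suc.IH[of f1 "\<gamma> - 1" p1, OF f1] by blast
  have e: "\<gamma> - 1 - of_nat k = \<gamma> - of_nat (Suc k)" "\<gamma> - of_nat (Suc k) + 1 + of_nat k = \<gamma>" by simp_all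
  show ?case
  proof (intro exI[of _ q] conjI ballI allI impI)
    show "degree q \<le> degree p + Suc k"
      using q(1) degree_rodrigues_step[of c \<gamma> p] by (simp add: p1_def)
    show "rodrigues_op \<alpha> (Suc k) f u = (1 - u) powr (\<gamma> - of_nat (Suc k)) * poly q u" if "u \<in> unit_strip" for u
      using rodrigues_op_Suc[OF f_hol that, of \<alpha> k] q(2)[OF that] unfolding f1_def c_def e by simp
    fix z :: complex assume z: "Re z > 0"
    have "jacobi_moment z (\<gamma> - of_nat (Suc k)) q =
        pochhammer (\<gamma> - of_nat (Suc k) + 1) k * pochhammer (\<alpha> + 1 - z) k * (\<gamma> * (c - z) * jacobi_moment z \<gamma> p)"
      using q(3)[OF z] unfolding p1_def jacobi_moment_rodrigues_step[OF z] e .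
    also have "\<dots> = pochhammer (\<gamma> - of_nat (Suc k) + 1) (Suc k) * pochhammer (\<alpha> + 1 - z) (Suc k) * jacobi_moment z \<gamma> p"
      unfolding pochhammer_Suc e by (simp add: c_def algebra_simps)
    finally show "jacobi_moment z (\<gamma> - of_nat (Suc k)) q = \<dots>" .
  qed
qed

lemma rodrigues_fold_poly:
  fixes n :: "nat \<Rightarrow> nat" and \<gamma> :: complex
  defines "f0 \<equiv> \<lambda>v::complex. (1 - v) powr \<gamma>"
  shows "\<exists>q. degree q \<le> sum_list (map n js) \<and>
     (\<forall>u\<in>unit_strip. foldr (\<lambda>j. rodrigues_op (\<alpha> j) (n j)) js f0 u =
         (1 - u) powr (\<gamma> - of_nat (sum_list (map n js))) * poly q u) \<and>
     (\<forall>z. Re z > 0 \<longrightarrow> jacobi_moment z (\<gamma> - of_nat (sum_list (map n js))) q =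
        pochhammer (\<gamma> - of_nat (sum_list (map n js)) + 1) (sum_list (map n js)) *
        prod_list (map (\<lambda>j. pochhammer (\<alpha> j + 1 - z) (n j)) js) * jacobi_moment z \<gamma> 1)"
proof (induction js)
  case Nil
  show ?case by (intro exI[of _ 1]) (simp add: f0_def)
next
  case (Cons j js)
  define t where "t = sum_list (map n js)"
  define F where "F = foldr (\<lambda>j. rodrigues_op (\<alpha> j) (n j)) js f0"
  obtain p where p: "degree p \<le> t"
    "\<And>u. u \<in> unit_strip \<Longrightarrow> F u = (1 - u) powr (\<gamma> - of_nat t) * poly p u"
    "\<And>z. Re z > 0 \<Longrightarrow> jacobi_moment z (\<gamma> - of_nat t) p =
        pochhammer (\<gamma> - of_nat t + 1) t * prod_list (map (\<lambda>j. pochhammer (\<alpha> j + 1 - z) (n j)) js) * jacobi_moment z \<gamma> 1"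
    using Cons unfolding t_def[symmetric] F_def[symmetric] by blast
  obtain q where q: "degree q \<le> degree p + n j"
    "\<And>u. u \<in> unit_strip \<Longrightarrow> rodrigues_op (\<alpha> j) (n j) F u = (1 - u) powr (\<gamma> - of_nat t - of_nat (n j)) * poly q u"
    "\<And>z. Re z > 0 \<Longrightarrow> jacobi_moment z (\<gamma> - of_nat t - of_nat (n j)) q =
        pochhammer (\<gamma> - of_nat t - of_nat (n j) + 1) (n j) * pochhammer (\<alpha> j + 1 - z) (n j) * jacobi_moment z (\<gamma> - of_nat t) p"
    using rodrigues_op_poly[of F "\<gamma> - of_nat t" p "n j" "\<alpha> j", OF p(2)] by blast
  have e: "\<gamma> - of_nat t - of_nat (n j) = \<gamma> - of_nat (n j + t)" by simp
  have poch: "pochhammer (\<gamma> - of_nat (n j + t) + 1) (n j + t) =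
      pochhammer (\<gamma> - of_nat (n j + t) + 1) (n j) * pochhammer (\<gamma> - of_nat t + 1) t"
  proof -
    have "\<gamma> - of_nat (n j + t) + 1 + of_nat (n j) = \<gamma> - of_nat t + 1" by simp
    thus ?thesis by (simp only: pochhammer_product')
  qed
  have fold: "foldr (\<lambda>j. rodrigues_op (\<alpha> j) (n j)) (j # js) f0 = rodrigues_op (\<alpha> j) (n j) F"
    by (simp add: F_def)
  have tot: "sum_list (map n (j # js)) = n j + t" by (simp add: t_def)
  show ?case unfolding fold tot
  proof (intro exI[of _ q] conjI ballI allI impI)
    show "degree q \<le> n j + t" using p(1) q(1) by simp
    show "rodrigues_op (\<alpha> j) (n j) F u = (1 - u) powr (\<gamma> - of_nat (n j + t)) * poly q u" if "u \<in> unit_strip" for u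
      using q(2)[OF that] unfolding e .
    fix z :: complex assume z: "Re z > 0"
    show "jacobi_moment z (\<gamma> - of_nat (n j + t)) q =
        pochhammer (\<gamma> - of_nat (n j + t) + 1) (n j + t) *
        prod_list (map (\<lambda>j. pochhammer (\<alpha> j + 1 - z) (n j)) (j # js)) * jacobi_moment z \<gamma> 1"
      using q(3)[OF z] unfolding e p(3)[OF z] poch by simp
  qed
qed

theorem jacobi_pineiro_poly:
  fixes m :: nat and n :: "nat \<Rightarrow> nat"
  defines "N \<equiv> mi_size m n"
  shows "\<exists>q. degree q \<le> N \<and>
     (\<forall>u\<in>{0<..<1}. jacobi_pineiro m n \<alpha> \<beta> (of_real u) = poly q (of_real u) / mi_fact m n) \<and>
     (\<forall>z. Re z > 0 \<longrightarrow> jacobi_moment z \<beta> q =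
        pochhammer (\<beta> + 1) N * (\<Prod>j=1..m. pochhammer (\<alpha> j + 1 - z) (n j)) * (Gamma z * rGamma (z + of_nat N + \<beta> + 1)))"
proof -
  have N: "sum_list (map n [1..<Suc m]) = N"
    by (simp only: N_def mi_size_def sum_list_distinct_conv_sum_set distinct_upt set_upt atLeastLessThanSuc_atLeastAtMost)
  have P: "prod_list (map (\<lambda>j. pochhammer (\<alpha> j + 1 - z) (n j)) [1..<Suc m]) = (\<Prod>j=1..m. pochhammer (\<alpha> j + 1 - z) (n j))" for z
    by (simp only: prod.distinct_set_conv_list[symmetric] distinct_upt set_upt atLeastLessThanSuc_atLeastAtMost)
  have e: "of_nat N + \<beta> - of_nat N = \<beta>" by simp
  obtain q where q: "degree q \<le> N"
    "\<And>u. u \<in> unit_strip \<Longrightarrow> foldr (\<lambda>j. rodrigues_op (\<alpha> j) (n j)) [1..<Suc m] (\<lambda>v. (1 - v) powr (of_nat N + \<beta>)) u = (1 - u) powr \<beta> * poly q u"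
    "\<And>z. Re z > 0 \<Longrightarrow> jacobi_moment z \<beta> q = pochhammer (\<beta> + 1) N * (\<Prod>j=1..m. pochhammer (\<alpha> j + 1 - z) (n j)) * jacobi_moment z (of_nat N + \<beta>) 1"
    using rodrigues_fold_poly[of n "[1..<Suc m]" \<alpha> "of_nat N + \<beta>"] unfolding N P e by blast
  have "jacobi_pineiro m n \<alpha> \<beta> (of_real u) = poly q (of_real u) / mi_fact m n" if u: "u \<in> {0<..<1}" for u
  proof -
    have us: "complex_of_real u \<in> unit_strip" using u by (simp add: unit_strip_def)
    have "(1 - complex_of_real u) powr (- \<beta>) * (1 - complex_of_real u) powr \<beta> = 1"
      using unit_strip_powr(4)[OF us] by (simp add: powr_minus)
    thus ?thesis unfolding jacobi_pineiro_def N_def[symmetric] q(2)[OF us] by simp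
  qed
  moreover have "jacobi_moment z (of_nat N + \<beta>) 1 = Gamma z * rGamma (z + of_nat N + \<beta> + 1)" for z
    using jacobi_moment_monom[of z "of_nat N + \<beta>" 1 0] by (simp add: monom_0 one_pCons add_ac)
  ultimately show ?thesis using q by (intro exI[of _ q]) auto
qed

section \<open>Gauss's summation theorem\<close>

text \<open>The reciprocal of a limit formula for \<open>\<Gamma>\<close>, which in this form also holds at the poles.\<close>

lemma pochhammer_asymp:
  fixes z :: complex
  shows "(\<lambda>n. pochhammer z n / (fact (n - 1) * exp (z * of_real (ln (of_nat n))))) \<longlonglongrightarrow> rGamma z"
proof (cases "z \<in> \<int>\<^sub>\<le>\<^sub>0")
  case False
  have "(\<lambda>n. inverse (Gamma_series' z n)) \<longlonglongrightarrow> inverse (Gamma z)"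
    by (intro tendsto_inverse Gamma_series'_LIMSEQ) (use False in \<open>simp add: Gamma_eq_zero_iff\<close>)
  thus ?thesis by (simp add: Gamma_series'_def rGamma_inverse_Gamma)
next
  case True
  then obtain k where k: "z = - of_nat k" by (elim nonpos_Ints_cases')
  have "eventually (\<lambda>n. pochhammer z n / (fact (n - 1) * exp (z * of_real (ln (of_nat n)))) = 0) sequentially"
    using eventually_gt_at_top[of k]
    by eventually_elim (simp add: k pochhammer_of_nat_eq_0_iff)
  moreover have "rGamma z = 0" using True by (simp add: rGamma_eq_zero_iff)
  ultimately show ?thesis by (simp add: tendsto_eventually)
qed

lemma pochhammer_upper_bound:
  fixes z :: complex
  shows "\<exists>C\<ge>0. \<forall>n\<ge>1. norm (pochhammer z n) \<le> C * (fact (n - 1) * real n powr Re z)"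
proof -
  from convergent_imp_Bseq[OF convergentI[OF pochhammer_asymp[of z]]]
  obtain C where C: "C > 0" "\<And>n. norm (pochhammer z n / (fact (n - 1) * exp (z * of_real (ln (of_nat n))))) \<le> C"
    by (auto simp: Bseq_def)
  have "norm (pochhammer z n) \<le> C * (fact (n - 1) * real n powr Re z)" if "n \<ge> 1" for n
    using C(2)[of n] that
    by (simp add: norm_divide norm_mult norm_exp_eq_Re powr_def divide_le_eq)
  with C show ?thesis by (intro exI[of _ C]) auto
qed

lemma pochhammer_lower_bound:
  fixes z :: complex
  assumes "z \<notin> \<int>\<^sub>\<le>\<^sub>0"
  shows "\<exists>C\<ge>0. \<forall>n\<ge>1. fact (n - 1) * real n powr Re z \<le> C * norm (pochhammer z n)"
proof -
  from convergent_imp_Bseq[OF convergentI[OF Gamma_series'_LIMSEQ[of z]]]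
  obtain C where C: "C > 0" "\<And>n. norm (Gamma_series' z n) \<le> C"
    by (auto simp: Bseq_def)
  have "fact (n - 1) * real n powr Re z \<le> C * norm (pochhammer z n)" if "n \<ge> 1" for n
  proof -
    have "pochhammer z n \<noteq> 0" using assms by (auto dest: pochhammer_eq_0_imp_nonpos_Int)
    thus ?thesis using C(2)[of n] that
      by (simp add: Gamma_series'_def norm_divide norm_mult norm_exp_eq_Re powr_def divide_le_eq)
  qed
  with C show ?thesis by (intro exI[of _ C]) auto
qed

lemma pochhammer_quotient_bound:
  fixes z w :: complex
  assumes "w \<notin> \<int>\<^sub>\<le>\<^sub>0"
  shows "\<exists>C\<ge>0. \<forall>n\<ge>1. norm (pochhammer z n / pochhammer w n) \<le> C * real n powr Re (z - w)"
proof -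
  obtain C where C: "C \<ge> 0" "\<And>n. n \<ge> 1 \<Longrightarrow> norm (pochhammer z n) \<le> C * (fact (n - 1) * real n powr Re z)"
    using pochhammer_upper_bound by blast
  obtain D where D: "D \<ge> 0" "\<And>n. n \<ge> 1 \<Longrightarrow> fact (n - 1) * real n powr Re w \<le> D * norm (pochhammer w n)"
    using pochhammer_lower_bound[OF assms] by blast
  have "norm (pochhammer z n / pochhammer w n) \<le> C * D * real n powr Re (z - w)" if n: "n \<ge> 1" for n
  proof -
    define F where "F = (fact (n - 1) :: real)"
    have pos: "F > 0" "norm (pochhammer w n) > 0" "real n > 0"
      using assms n by (auto simp: F_def dest: pochhammer_eq_0_imp_nonpos_Int)
    have inv: "1 / norm (pochhammer w n) \<le> D / (F * real n powr Re w)"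
      using D(2)[OF n] pos by (simp add: field_simps F_def)
    have "norm (pochhammer z n / pochhammer w n) = norm (pochhammer z n) * (1 / norm (pochhammer w n))"
      by (simp add: norm_divide)
    also have "\<dots> \<le> (C * (F * real n powr Re z)) * (D / (F * real n powr Re w))"
      using C(2)[OF n] inv C(1) pos by (intro mult_mono) (auto simp: F_def)
    also have "\<dots> = C * D * real n powr Re (z - w)"
      using pos by (simp add: powr_diff)
    finally show ?thesis .
  qed
  thus ?thesis using C(1) D(1) by (intro exI[of _ "C * D"]) auto
qed

definition hypergeo_coeff :: "complex \<Rightarrow> complex \<Rightarrow> complex \<Rightarrow> nat \<Rightarrow> complex" where
  "hypergeo_coeff A B E n = pochhammer A n * pochhammer B n / (pochhammer E n * fact n)"

lemma hypergeo_coeff_bound: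
  assumes "E \<notin> \<int>\<^sub>\<le>\<^sub>0"
  shows "\<exists>C\<ge>0. \<forall>n\<ge>1. norm (hypergeo_coeff A B E n) \<le> C * real n powr (Re (A + B - E) - 1)"
proof -
  obtain C where C: "C \<ge> 0" "\<And>n. n \<ge> 1 \<Longrightarrow> norm (pochhammer A n / pochhammer E n) \<le> C * real n powr Re (A - E)"
    using pochhammer_quotient_bound[OF assms] by blast
  obtain D where D: "D \<ge> 0" "\<And>n. n \<ge> 1 \<Longrightarrow> norm (pochhammer B n / pochhammer 1 n) \<le> D * real n powr Re (B - 1)"
    using pochhammer_quotient_bound[of 1 B] by auto
  have "norm (hypergeo_coeff A B E n) \<le> C * D * real n powr (Re (A + B - E) - 1)" if n: "n \<ge> 1" for n
  proof -
    have "norm (hypergeo_coeff A B E n) = norm (pochhammer A n / pochhammer E n) * norm (pochhammer B n / pochhammer 1 n)"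
      by (simp add: hypergeo_coeff_def norm_divide norm_mult flip: pochhammer_fact)
    also have "\<dots> \<le> (C * real n powr Re (A - E)) * (D * real n powr Re (B - 1))"
      using C(2)[OF n] D(2)[OF n] C(1) by (intro mult_mono) auto
    also have "\<dots> = C * D * real n powr (Re (A - E) + Re (B - 1))"
      by (simp add: powr_add)
    also have "Re (A - E) + Re (B - 1) = Re (A + B - E) - 1" by simp
    finally show ?thesis .
  qed
  thus ?thesis using C(1) D(1) by (intro exI[of _ "C * D"]) auto
qed

lemma summable_powr_bound:
  fixes f :: "nat \<Rightarrow> real"
  assumes "\<And>n. n \<ge> 1 \<Longrightarrow> norm (f n) \<le> C * real n powr e" "e < - 1"
  shows "summable f"
proof (rule summable_comparison_test')
  show "summable (\<lambda>n. C * real n powr e)"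
    using assms(2) by (intro summable_mult) (simp add: summable_real_powr_iff)
qed (use assms(1) in auto)

lemma summable_hypergeo_coeff:
  assumes "E \<notin> \<int>\<^sub>\<le>\<^sub>0" "Re (E - A - B) > 0"
  shows "summable (\<lambda>n. norm (hypergeo_coeff A B E n))"
proof -
  from hypergeo_coeff_bound[OF assms(1), of A B]
  obtain C where "\<And>n. n \<ge> 1 \<Longrightarrow> norm (hypergeo_coeff A B E n) \<le> C * real n powr (Re (A + B - E) - 1)"
    by blast
  thus ?thesis
    by (intro summable_powr_bound[of _ C "Re (A + B - E) - 1"]) (use assms(2) in auto)
qed

text \<open>The difference of the two summands telescopes, with \<open>u\<^sub>n = E n h\<^sub>n\<close>.\<close>

lemma hypergeo_contiguous:
  assumes "Re E > 0" "Re (E - A - B) > 0"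
  shows "(E - A) * (E - B) * (\<Sum>n. hypergeo_coeff A B (E + 1) n) =
         E * (E - A - B) * (\<Sum>n. hypergeo_coeff A B E n)"
proof -
  define h where "h = hypergeo_coeff A B E"
  define u where "u = (\<lambda>n. E * of_nat n * h n)"
  have En: "E + of_nat n \<noteq> 0" for n using assms by (auto simp: complex_eq_iff)
  have En': "E \<notin> \<int>\<^sub>\<le>\<^sub>0" "E + 1 \<notin> \<int>\<^sub>\<le>\<^sub>0" using assms by (auto intro!: nonpos_Int_Re_pos)
  have pE: "pochhammer E n \<noteq> 0" for n using En' by (auto dest: pochhammer_eq_0_imp_nonpos_Int)
  have E0: "E \<noteq> 0" using En[of 0] by simp
  have h1: "hypergeo_coeff A B (E + 1) n = E * h n / (E + of_nat n)" for n
  proof -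
    have "E * pochhammer (E + 1) n = pochhammer E n * (E + of_nat n)"
      using pochhammer_rec[of E n] pochhammer_Suc[of E n] by simp
    hence pS: "pochhammer (E + 1) n = pochhammer E n * (E + of_nat n) / E"
      using E0 by (simp add: divide_simps mult_ac)
    show ?thesis unfolding h_def hypergeo_coeff_def pS
      using E0 En[of n] pE[of n] by (simp add: divide_simps)
  qed
  have hS: "(E + of_nat n) * (of_nat n + 1) * h (Suc n) = (A + of_nat n) * (B + of_nat n) * h n" for n
  proof -
    have "1 + of_nat n \<noteq> (0 :: complex)" by (simp add: complex_eq_iff)
    thus ?thesis using pE[of n] En[of n] unfolding h_def hypergeo_coeff_def pochhammer_Suc fact_Suc
      by (simp add: divide_simps) (simp add: algebra_simps)?
  qed
  have step: "(E - A) * (E - B) * hypergeo_coeff A B (E + 1) n - E * (E - A - B) * h n = u (Suc n) - u n" for n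
  proof -
    have "(E + of_nat n) * ((E - A) * (E - B) * hypergeo_coeff A B (E + 1) n - E * (E - A - B) * h n)
        = E * (A * B - of_nat n * (E - A - B)) * h n"
      using En[of n] by (simp add: h1 field_simps)
    also have "\<dots> = E * ((A + of_nat n) * (B + of_nat n) * h n) - (E + of_nat n) * u n"
      by (simp add: u_def algebra_simps)
    also have "\<dots> = (E + of_nat n) * (u (Suc n) - u n)"
      unfolding hS[symmetric] by (simp add: u_def algebra_simps)
    finally show ?thesis using En[of n] by simp
  qed
  have sums: "summable (\<lambda>n. hypergeo_coeff A B (E + 1) n)" "summable h"
    unfolding h_def using assms En' by (auto intro!: summable_norm_cancel[OF summable_hypergeo_coeff])
  have "u \<longlonglongrightarrow> 0"
  proof -
    from hypergeo_coeff_bound[OF En'(1), of A B]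
    obtain C where C: "\<And>n. n \<ge> 1 \<Longrightarrow> norm (h n) \<le> C * real n powr (Re (A + B - E) - 1)"
      unfolding h_def by blast
    have "(\<lambda>n. norm E * C * real n powr Re (A + B - E)) \<longlonglongrightarrow> norm E * C * 0"
      using assms by (intro tendsto_intros tendsto_neg_powr filterlim_real_sequentially) auto
    moreover have "norm (u n) \<le> norm E * C * real n powr Re (A + B - E)" if "n \<ge> 1" for n
    proof -
      have "norm (u n) \<le> norm E * real n * (C * real n powr (Re (A + B - E) - 1))"
        using C[OF that] by (simp add: u_def norm_mult mult_left_mono)
      also have "\<dots> = norm E * C * real n powr Re (A + B - E)"
        using that by (simp add: powr_diff)
      finally show ?thesis .
    qed
    ultimately show ?thesis
      by (intro Lim_null_comparison[of u]) (auto simp: eventually_at_top_linorder)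
  qed
  hence "(\<lambda>n. u (Suc n) - u n) sums (0 - u 0)" by (rule telescope_sums)
  hence "(\<lambda>n. (E - A) * (E - B) * hypergeo_coeff A B (E + 1) n - E * (E - A - B) * h n) sums 0"
    by (simp add: step) (simp add: u_def)
  moreover have "(\<lambda>n. (E - A) * (E - B) * hypergeo_coeff A B (E + 1) n - E * (E - A - B) * h n) sums
     ((E - A) * (E - B) * (\<Sum>n. hypergeo_coeff A B (E + 1) n) - E * (E - A - B) * suminf h)"
    by (intro sums_diff sums_mult summable_sums sums)
  ultimately show ?thesis unfolding h_def using sums_unique2 by force
qed

lemma tendsto_inverse_shift: "(\<lambda>n. 1 / (z + of_nat n :: complex)) \<longlonglongrightarrow> 0"
  by (intro tendsto_divide_0[OF tendsto_const] tendsto_add_filterlim_at_infinity[OF tendsto_const]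
       tendsto_of_nat)

text \<open>As the lower parameter grows only the term with \<open>k = 0\<close> survives; the series for \<open>E\<close> itself is a majorant.\<close>

lemma hypergeo_shift_tendsto:
  assumes "Re E > 0" "Re (E - A - B) > 0"
  shows "(\<lambda>n. \<Sum>k. hypergeo_coeff A B (E + of_nat n) k) \<longlonglongrightarrow> 1"
proof -
  define b where "b = (\<lambda>k::nat. if k = 0 then 1 else 0 :: complex)"
  have lim: "(\<lambda>n. hypergeo_coeff A B (E + of_nat n) k) \<longlonglongrightarrow> b k" for k
  proof -
    have "(\<lambda>n. \<Prod>i<k. 1 / ((E + of_nat i) + of_nat n)) \<longlonglongrightarrow> (\<Prod>i<k. 0)"
      by (intro tendsto_prod tendsto_inverse_shift)
    hence "(\<lambda>n. pochhammer A k * pochhammer B k / fact k * (\<Prod>i<k. 1 / ((E + of_nat i) + of_nat n)))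
       \<longlonglongrightarrow> pochhammer A k * pochhammer B k / fact k * (\<Prod>i<k. 0)"
      by (rule tendsto_mult[OF tendsto_const])
    moreover have "(\<lambda>n. pochhammer A k * pochhammer B k / fact k * (\<Prod>i<k. 1 / ((E + of_nat i) + of_nat n)))
      = (\<lambda>n. hypergeo_coeff A B (E + of_nat n) k)"
      by (simp add: hypergeo_coeff_def pochhammer_prod prod_dividef atLeast0LessThan add_ac mult_ac)
    moreover have "pochhammer A k * pochhammer B k / fact k * (\<Prod>i<k. 0) = b k"
      by (cases k) (auto simp: b_def)
    ultimately show ?thesis by simp
  qed
  have le: "norm (hypergeo_coeff A B (E + of_nat n) k) \<le> norm (hypergeo_coeff A B E k)" for n k
  proof -
    have "norm (pochhammer E k) \<le> norm (pochhammer (E + of_nat n) k)"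
      unfolding pochhammer_prod prod_norm[symmetric]
    proof (intro prod_mono conjI)
      fix i :: nat
      have "(Re E + i) ^ 2 \<le> (Re E + n + i) ^ 2"
        using assms by (intro power_mono) auto
      hence "norm (E + of_nat i) ^ 2 \<le> norm (E + of_nat n + of_nat i) ^ 2"
        by (simp add: cmod_power2)
      thus "norm (E + of_nat i) \<le> norm (E + of_nat n + of_nat i)"
        by (rule power2_le_imp_le) auto
    qed auto
    moreover have "pochhammer E k \<noteq> 0"
      using assms nonpos_Int_Re_pos[of E] by (auto dest: pochhammer_eq_0_imp_nonpos_Int)
    ultimately show ?thesis
      unfolding hypergeo_coeff_def norm_divide norm_mult
      by (intro divide_left_mono mult_right_mono mult_pos_pos) (auto intro: less_le_trans[rotated])
  qed
  have dominated: "eventually (\<lambda>(k, n). norm (hypergeo_coeff A B (E + of_nat n) k) \<le> norm (hypergeo_coeff A B E k))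
      (at_top \<times>\<^sub>F sequentially)"
    by (intro always_eventually) (use le in auto)
  have sm: "summable (\<lambda>k. norm (hypergeo_coeff A B E k))"
    by (intro summable_hypergeo_coeff nonpos_Int_Re_pos assms)
  have "(\<lambda>n. \<Sum>k. hypergeo_coeff A B (E + of_nat n) k) \<longlonglongrightarrow> suminf b"
    by (rule tannerys_theorem[where a = "\<lambda>k n. hypergeo_coeff A B (E + of_nat n) k"
          and M = "\<lambda>k. norm (hypergeo_coeff A B E k)", THEN conjunct2, THEN conjunct2])
       (rule lim dominated sm sequentially_bot)+
  moreover have "suminf b = 1"
    using sums_unique[OF sums_single[of 0 "\<lambda>_. 1::complex"]] by (simp add: b_def)
  ultimately show ?thesis by simp
qed

text \<open>
  Iterating the contiguous relation expresses the sum by the one for \<open>E + n\<close>, which tends to \<open>1\<close>, and by four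
  Pochhammer symbols, which have the asserted Gamma factors as limits.
\<close>

theorem Gauss_hypergeo_sum:
  assumes "Re E > 0" "Re (E - A - B) > 0"
  shows "(\<lambda>n. hypergeo_coeff A B E n) sums
    (Gamma E * Gamma (E - A - B) * rGamma (E - A) * rGamma (E - B))"
proof -
  define F where "F = (\<lambda>E. \<Sum>n. hypergeo_coeff A B E n)"
  define D where "D = E - A - B"
  have nz: "E \<notin> \<int>\<^sub>\<le>\<^sub>0" "D \<notin> \<int>\<^sub>\<le>\<^sub>0" using assms by (auto intro!: nonpos_Int_Re_pos simp: D_def)
  hence pnz: "pochhammer E n \<noteq> 0" "pochhammer D n \<noteq> 0" for n by (auto dest: pochhammer_eq_0_imp_nonpos_Int)
  have iter: "pochhammer E n * pochhammer D n * F E =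
              pochhammer (E - A) n * pochhammer (E - B) n * F (E + of_nat n)" for n
  proof (induction n)
    case (Suc n)
    have "pochhammer E (Suc n) * pochhammer D (Suc n) * F E
       = (E + of_nat n) * (D + of_nat n) * (pochhammer (E - A) n * pochhammer (E - B) n * F (E + of_nat n))"
      unfolding pochhammer_Suc Suc[symmetric] by simp
    also have "(E + of_nat n) * (D + of_nat n) * F (E + of_nat n) =
        (E - A + of_nat n) * (E - B + of_nat n) * F (E + of_nat (Suc n))"
      using hypergeo_contiguous[of "E + of_nat n" A B] assms
      by (simp add: F_def D_def algebra_simps)
    hence "(E + of_nat n) * (D + of_nat n) * (pochhammer (E - A) n * pochhammer (E - B) n * F (E + of_nat n))
       = pochhammer (E - A) (Suc n) * pochhammer (E - B) (Suc n) * F (E + of_nat (Suc n))"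
      unfolding pochhammer_Suc by (simp add: mult_ac)
    finally show ?case .
  qed auto
  define q where "q = (\<lambda>z n. pochhammer z n / (fact (n - 1) * exp (z * of_real (ln (of_nat n)))) :: complex)"
  have q: "q z \<longlonglongrightarrow> rGamma z" for z unfolding q_def by (rule pochhammer_asymp)
  have eq: "q E n * q D n * F E = q (E - A) n * q (E - B) n * F (E + of_nat n)" for n
  proof -
    define L where "L = complex_of_real (ln (of_nat n))"
    have "exp (E * L) * exp (D * L) = exp ((E - A) * L) * exp ((E - B) * L)"
      by (simp add: D_def algebra_simps flip: exp_add)
    thus ?thesis using iter[of n] unfolding q_def L_def[symmetric]
      by (simp add: divide_simps mult_ac)
  qed
  have "(\<lambda>n. q E n * q D n * F E) \<longlonglongrightarrow> rGamma E * rGamma D * F E"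
    by (intro tendsto_intros q)
  moreover have "(\<lambda>n. q (E - A) n * q (E - B) n * F (E + of_nat n)) \<longlonglongrightarrow> rGamma (E - A) * rGamma (E - B) * 1"
    unfolding F_def by (intro tendsto_intros q hypergeo_shift_tendsto assms)
  ultimately have "rGamma E * rGamma D * F E = rGamma (E - A) * rGamma (E - B)"
    unfolding eq using LIMSEQ_unique by fastforce
  hence "F E = Gamma E * Gamma D * rGamma (E - A) * rGamma (E - B)"
    using nz by (simp add: rGamma_inverse_Gamma field_simps Gamma_eq_zero_iff)
  moreover have "summable (hypergeo_coeff A B E)"
    using nz assms by (intro summable_norm_cancel[OF summable_hypergeo_coeff]) (auto simp: D_def)
  ultimately show ?thesis by (simp add: F_def D_def sums_iff)
qed

section \<open>The Beta integral and the Mellin transform of a hypergeometric function\<close>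

lemma integral_suminf_absolutely:
  fixes f :: "nat \<Rightarrow> 'a::euclidean_space \<Rightarrow> complex"
  assumes int: "\<And>n. f n absolutely_integrable_on S"
    and pointwise: "\<And>x. x \<in> S \<Longrightarrow> summable (\<lambda>n. norm (f n x))"
    and total: "summable (\<lambda>n. integral S (\<lambda>x. norm (f n x)))"
  shows "(\<lambda>x. \<Sum>n. f n x) absolutely_integrable_on S"
    and "(\<lambda>n. integral S (f n)) sums integral S (\<lambda>x. \<Sum>n. f n x)"
proof -
  define g where "g = (\<lambda>n x. indicator S x *\<^sub>R f n x)"
  have g: "integrable lebesgue (g n)" for n
    using int[of n] by (simp add: g_def set_integrable_def)
  have pt: "AE x in lebesgue. summable (\<lambda>n. norm (g n x))"
    by (rule AE_I2) (use pointwise in \<open>auto simp: g_def indicator_def\<close>)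
  have normint: "(\<integral>x. norm (g n x) \<partial>lebesgue) = integral S (\<lambda>x. norm (f n x))" for n
  proof -
    have "(\<integral>x. norm (g n x) \<partial>lebesgue) = (LINT x:S|lebesgue. norm (f n x))"
      unfolding set_lebesgue_integral_def g_def by (intro Bochner_Integration.integral_cong) auto
    also have "\<dots> = integral S (\<lambda>x. norm (f n x))"
      using int[of n] by (intro set_lebesgue_integral_eq_integral set_integrable_norm)
    finally show ?thesis .
  qed
  have sm: "summable (\<lambda>n. \<integral>x. norm (g n x) \<partial>lebesgue)" using total by (simp add: normint)
  have sum_eq: "(\<lambda>x. \<Sum>n. g n x) = (\<lambda>x. indicator S x *\<^sub>R (\<Sum>n. f n x))"
    by (auto simp: g_def indicator_def fun_eq_iff)
  show ai: "(\<lambda>x. \<Sum>n. f n x) absolutely_integrable_on S"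
    using integrable_suminf[OF g pt sm] unfolding sum_eq set_integrable_def .
  have "(\<integral>x. g n x \<partial>lebesgue) = integral S (f n)" for n
    using set_lebesgue_integral_eq_integral(2)[OF int[of n]]
    by (simp add: g_def set_lebesgue_integral_def)
  moreover have "(\<integral>x. (\<Sum>n. g n x) \<partial>lebesgue) = integral S (\<lambda>x. \<Sum>n. f n x)"
    unfolding sum_eq using set_lebesgue_integral_eq_integral(2)[OF ai]
    by (simp add: set_lebesgue_integral_def)
  ultimately show "(\<lambda>n. integral S (f n)) sums integral S (\<lambda>x. \<Sum>n. f n x)"
    using sums_integral[OF g pt sm] by simp
qed

lemma norm_of_real_powr_unit:
  "u \<in> {0<..<1} \<Longrightarrow> norm (complex_of_real u powr z) = u powr Re z"
  by (simp add: norm_powr_real_powr)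

lemma integral_power_unit:
  assumes "Re s > 0"
  shows "(\<lambda>u::real. of_real u powr (s - 1)) absolutely_integrable_on {0<..<1}"
    and "integral {0<..<1} (\<lambda>u::real. of_real u powr (s - 1)) = 1 / s"
    and "integral {0<..<1} (\<lambda>u::real. norm (of_real u powr (s - 1) :: complex)) = 1 / Re s"
proof -
  have s0: "s \<noteq> 0" using assms by auto
  have "((\<lambda>u::real. of_real u powr (s - 1)) has_integral
        (of_real 1 powr s / s - of_real 0 powr s / s)) {0..1}"
  proof (rule fundamental_theorem_of_calculus_interior)
    show "continuous_on {0..1} (\<lambda>u::real. of_real u powr s / s)"
      using assms s0 by (intro continuous_intros) auto
    fix u :: real assume u: "u \<in> {0<..<1}"
    have "((\<lambda>z. z powr s / s) has_field_derivative (s * of_real u powr (s - 1) / s)) (at (of_real u))"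
      using u by (intro DERIV_cdivide has_field_derivative_powr) auto
    hence "((\<lambda>z. z powr s / s) has_field_derivative (of_real u powr (s - 1))) (at (of_real u))"
      using s0 by simp
    from has_vector_derivative_real_field[OF this]
    show "((\<lambda>u::real. of_real u powr s / s) has_vector_derivative of_real u powr (s - 1)) (at u)" .
  qed simp
  hence 1: "((\<lambda>u::real. of_real u powr (s - 1)) has_integral 1 / s) {0<..<1}"
    by (simp add: has_integral_Icc_iff_Ioo)
  have "((\<lambda>u. u powr (Re s - 1)) has_integral (1 powr (Re s - 1 + 1) / (Re s - 1 + 1))) {0..1}"
    by (rule has_integral_powr_from_0) (use assms in auto)
  hence "((\<lambda>u. u powr (Re s - 1)) has_integral 1 / Re s) {0<..<1}"
    by (simp add: has_integral_Icc_iff_Ioo)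
  hence 2: "((\<lambda>u. norm (complex_of_real u powr (s - 1))) has_integral 1 / Re s) {0<..<1}"
    by (rule has_integral_eq[rotated]) (simp add: norm_of_real_powr_unit)
  show "(\<lambda>u::real. of_real u powr (s - 1)) absolutely_integrable_on {0<..<1}"
    using 1 2 by (auto simp: absolutely_integrable_on_def)
  show "integral {0<..<1} (\<lambda>u::real. of_real u powr (s - 1)) = 1 / s"
    "integral {0<..<1} (\<lambda>u::real. norm (of_real u powr (s - 1) :: complex)) = 1 / Re s"
    using 1 2 by (auto intro: integral_unique)
qed

text \<open>Expanding \<open>(1 - u)\<^bsup>c - 1\<^esup>\<close> into a binomial series and integrating term by term gives a hypergeometric series at \<open>1\<close>.\<close>

lemma complex_Beta_integral:
  assumes s: "Re s > 0" and c: "Re c > 0"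
  shows "(\<lambda>u::real. of_real u powr (s - 1) * (1 - of_real u) powr (c - 1)) absolutely_integrable_on {0<..<1}"
    and "integral {0<..<1} (\<lambda>u::real. of_real u powr (s - 1) * (1 - of_real u) powr (c - 1))
           = Gamma s * Gamma c * rGamma (s + c)"
proof -
  define h where "h = (\<lambda>n. pochhammer (1 - c) n / fact n)"
  define f where "f = (\<lambda>n (u::real). h n * of_real u powr (s + of_nat n - 1))"
  have hb: "\<exists>K\<ge>0. \<forall>n\<ge>1. norm (h n) \<le> K * real n powr (- Re c)"
    using hypergeo_coeff_bound[of 1 "1 - c" 1]
    by (simp add: h_def hypergeo_coeff_def flip: pochhammer_fact)
  then obtain K where K: "K \<ge> 0" "\<And>n. n \<ge> 1 \<Longrightarrow> norm (h n) \<le> K * real n powr (- Re c)" by blast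
  have series: "(\<lambda>n. f n u) sums (of_real u powr (s - 1) * (1 - of_real u) powr (c - 1))"
    and series_abs: "summable (\<lambda>n. norm (f n u))" if u: "u \<in> {0<..<1}" for u
  proof -
    have fe: "f n u = of_real u powr (s - 1) * (h n * of_real u ^ n)" for n
    proof -
      have "complex_of_real u powr (s + of_nat n - 1) = of_real u powr ((s - 1) + of_nat n)"
        by (simp add: algebra_simps)
      also have "\<dots> = of_real u powr (s - 1) * of_real u ^ n"
        using u by (subst powr_add) (simp add: powr_nat')
      finally show ?thesis by (simp add: f_def)
    qed
    have g: "((c - 1) gchoose n) * (- of_real u) ^ n = h n * of_real u ^ n" for n
    proof -
      have "(- 1) ^ n * (- complex_of_real u) ^ n = of_real u ^ n"
        by (simp flip: power_mult_distrib)
      moreover have "((c - 1) gchoose n) * (- of_real u) ^ n = h n * ((- 1) ^ n * (- of_real u) ^ n)"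
        by (simp add: gbinomial_pochhammer h_def)
      ultimately show ?thesis by simp
    qed
    have "(\<lambda>n. ((c - 1) gchoose n) * (- of_real u) ^ n) sums (1 + (- of_real u)) powr (c - 1)"
      by (rule gen_binomial_complex) (use u in auto)
    from sums_mult[OF this[unfolded g], of "of_real u powr (s - 1)"]
    show "(\<lambda>n. f n u) sums (of_real u powr (s - 1) * (1 - of_real u) powr (c - 1))"
      by (simp add: fe)
    show "summable (\<lambda>n. norm (f n u))"
    proof (rule summable_comparison_test')
      show "summable (\<lambda>n. norm (of_real u powr (s - 1) :: complex) * K * u ^ n)"
        using u by (intro summable_mult summable_geometric) auto
      fix n :: nat assume n: "n \<ge> 1"
      have "norm (h n) \<le> K * real n powr (- Re c)" using K n by blast
      also have "\<dots> \<le> K * 1"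
        using n c K(1) by (intro mult_left_mono) (auto simp: powr_minus divide_simps ge_one_powr_ge_zero)
      finally have "norm (h n) \<le> K" by simp
      thus "norm (norm (f n u)) \<le> norm (of_real u powr (s - 1) :: complex) * K * u ^ n"
        using u by (simp add: fe norm_mult norm_power mult_right_mono mult_left_mono mult.assoc)
    qed
  qed
  have ps: "Re (s + of_nat n) > 0" for n using s by simp
  have int: "f n absolutely_integrable_on {0<..<1}" for n
    unfolding f_def by (intro set_integrable_mult_right integral_power_unit(1) ps)
  have total: "summable (\<lambda>n. integral {0<..<1} (\<lambda>u. norm (f n u)))"
  proof (rule summable_powr_bound[of _ K "- Re c - 1"])
    fix n :: nat assume n: "n \<ge> 1"
    have I0: "integral {0<..<1} (\<lambda>u. norm (f n u)) = norm (h n) * (1 / Re (s + of_nat n))"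
      unfolding f_def norm_mult integral_mult_right integral_power_unit(3)[OF ps] by simp
    also have "\<dots> \<le> (K * real n powr (- Re c)) * (1 / real n)"
      using K(2)[OF n] n s by (intro mult_mono divide_left_mono) (auto simp: K(1))
    also have "\<dots> = K * real n powr (- Re c - 1)"
      using n by (simp add: powr_diff)
    finally show "norm (integral {0<..<1} (\<lambda>u. norm (f n u))) \<le> K * real n powr (- Re c - 1)"
      unfolding I0 using s by simp
  qed (use c in simp)
  note res = integral_suminf_absolutely[OF int series_abs total]
  have cong: "(\<Sum>n. f n u) = of_real u powr (s - 1) * (1 - of_real u) powr (c - 1)" if "u \<in> {0<..<1}" for u
    using series[OF that] by (simp add: sums_iff)
  show "(\<lambda>u::real. of_real u powr (s - 1) * (1 - of_real u) powr (c - 1)) absolutely_integrable_on {0<..<1}"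
    by (rule iffD1[OF set_integrable_cong[OF refl refl] res(1)]) (rule cong)
  have I: "integral {0<..<1} (f n) = hypergeo_coeff (1 - c) s (s + 1) n / s" for n
  proof -
    have s0: "s \<noteq> 0" "s + of_nat n \<noteq> 0" using s by (auto simp: complex_eq_iff)
    have pn: "pochhammer (s + 1) n \<noteq> 0"
      using nonpos_Int_Re_pos[of "s + 1"] s by (auto dest: pochhammer_eq_0_imp_nonpos_Int)
    have "s * pochhammer (s + 1) n = pochhammer s n * (s + of_nat n)"
      using pochhammer_rec[of s n] pochhammer_Suc[of s n] by simp
    hence "pochhammer s n = s * pochhammer (s + 1) n / (s + of_nat n)"
      using s0 by (simp add: divide_simps)
    hence "hypergeo_coeff (1 - c) s (s + 1) n / s = h n * (1 / (s + of_nat n))"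
      unfolding hypergeo_coeff_def h_def using s0 pn by simp
    thus ?thesis unfolding f_def by (simp add: integral_power_unit(2)[OF ps])
  qed
  have "(\<lambda>n. hypergeo_coeff (1 - c) s (s + 1) n / s) sums
      (Gamma (s + 1) * Gamma (s + 1 - (1 - c) - s) * rGamma (s + 1 - (1 - c)) * rGamma (s + 1 - s) / s)"
    by (intro sums_divide Gauss_hypergeo_sum) (use s c in auto)
  also have "Gamma (s + 1) * Gamma (s + 1 - (1 - c) - s) * rGamma (s + 1 - (1 - c)) * rGamma (s + 1 - s) / s
     = Gamma s * Gamma c * rGamma (s + c)"
    using s nonpos_Int_Re_pos[of s] by (auto simp: Gamma_plus1)
  finally have "(\<Sum>n. integral {0<..<1} (f n)) = Gamma s * Gamma c * rGamma (s + c)"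
    unfolding I by (simp add: sums_iff)
  hence "integral {0<..<1} (\<lambda>x. \<Sum>n. f n x) = Gamma s * Gamma c * rGamma (s + c)"
    using res(2) by (simp add: sums_iff)
  moreover have "integral {0<..<1} (\<lambda>x. \<Sum>n. f n x) =
     integral {0<..<1} (\<lambda>u::real. of_real u powr (s - 1) * (1 - of_real u) powr (c - 1))"
    by (intro integral_cong cong)
  ultimately show "integral {0<..<1} (\<lambda>u::real. of_real u powr (s - 1) * (1 - of_real u) powr (c - 1))
           = Gamma s * Gamma c * rGamma (s + c)" by simp
qed

lemma Gamma_shift:
  fixes z :: complex
  assumes "z \<notin> \<int>\<^sub>\<le>\<^sub>0"
  shows "Gamma (z + of_nat n) = pochhammer z n * Gamma z"
  using assms by (simp add: pochhammer_Gamma Gamma_eq_zero_iff)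

lemma rGamma_shift:
  fixes z :: complex
  assumes "z \<notin> \<int>\<^sub>\<le>\<^sub>0"
  shows "rGamma (z + of_nat n) = rGamma z / pochhammer z n"
proof -
  have "pochhammer z n \<noteq> 0" using assms by (auto dest: pochhammer_eq_0_imp_nonpos_Int)
  thus ?thesis by (subst pochhammer_rGamma[of z n]) simp
qed

text \<open>
  Termwise integration of the hypergeometric series by the Beta integral yields another such series at \<open>1\<close>, with lower parameter
  \<open>s + c\<close>, which Gauss's theorem sums. The condition on \<open>s + c - A - B\<close> makes the integrals of the absolute
  values summable.
\<close>

lemma Mellin_hypergeo:
  assumes s: "Re s > 0" and c: "Re c > 0" and pos: "Re (s + c - A - B) > 0"
  defines "f \<equiv> (\<lambda>u::real. of_real u powr (s - 1) * (1 - of_real u) powr (c - 1) *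
                    hyp2F1 A B c (1 - of_real u))"
  shows "f absolutely_integrable_on {0<..<1}"
    and "integral {0<..<1} f =
      Gamma s * Gamma c * Gamma (s + c - A - B) * rGamma (s + c - A) * rGamma (s + c - B)"
proof -
  define h where "h = hypergeo_coeff A B c"
  define g where "g = (\<lambda>n (u::real). h n * (of_real u powr (s - 1) * (1 - of_real u) powr (c + of_nat n - 1)))"
  have cn: "c \<notin> \<int>\<^sub>\<le>\<^sub>0" using c by (rule nonpos_Int_Re_pos)
  have scn: "s + c \<notin> \<int>\<^sub>\<le>\<^sub>0" using c s by (intro nonpos_Int_Re_pos) simp
  obtain K where K: "K \<ge> 0" "\<And>n. n \<ge> 1 \<Longrightarrow> norm (h n) \<le> K * real n powr (Re (A + B - c) - 1)"
    unfolding h_def using hypergeo_coeff_bound[OF cn] by blast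
  have fe: "g n u = of_real u powr (s - 1) * (1 - of_real u) powr (c - 1) * (h n * (1 - of_real u) ^ n)"
    if u: "u \<in> {0<..<1}" for n u
  proof -
    have "(1 - complex_of_real u) \<noteq> 0" using u by (metis greaterThanLessThan_iff less_irrefl of_real_1 of_real_eq_iff right_minus_eq)
    hence "(1 - complex_of_real u) powr ((c - 1) + of_nat n) = (1 - of_real u) powr (c - 1) * (1 - of_real u) ^ n"
      by (subst powr_add) (simp add: powr_nat')
    moreover have "c + of_nat n - 1 = (c - 1) + of_nat n" by simp
    ultimately show ?thesis by (simp only: g_def mult_ac)
  qed
  have norm1: "norm (1 - complex_of_real u) = 1 - u" if "u \<in> {0<..<1}" for u
    using that by (metis abs_of_nonneg diff_ge_0_iff_ge greaterThanLessThan_iff less_imp_le norm_of_real of_real_1 of_real_diff)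
  have hsum: "summable (\<lambda>n. norm (h n * (1 - of_real u) ^ n))" if u: "u \<in> {0<..<1}" for u
  proof -
    define e where "e = Re (A + B - c) - 1"
    obtain N :: nat where N: "e \<le> real N" using real_arch_simple by blast
    have q: "0 < sqrt (1 - u)" "sqrt (1 - u) < 1" using u by auto
    obtain M where M0: "M \<ge> 0" "\<And>x. x \<ge> 0 \<Longrightarrow> (x + 0) ^ N * exp (- (- ln (sqrt (1 - u))) * x) \<le> M"
      using power_times_exp_bounded[of "- ln (sqrt (1 - u))" 0 N] q by (auto simp: ln_less_zero)
    have M: "real n powr e * sqrt (1 - u) ^ n \<le> M" if n: "n \<ge> 1" for n
    proof -
      have "real n powr e * sqrt (1 - u) ^ n \<le> real n powr N * sqrt (1 - u) ^ n"
        using n N q by (intro mult_right_mono powr_mono) auto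
      also have "\<dots> = real n ^ N * exp (ln (sqrt (1 - u)) * real n)"
        using n q by (simp add: powr_realpow exp_of_nat2_mult)
      also have "\<dots> \<le> M" using M0(2)[of "real n"] by simp
      finally show ?thesis .
    qed
    show ?thesis
    proof (rule summable_comparison_test')
      show "summable (\<lambda>n. K * M * sqrt (1 - u) ^ n)"
        using u by (intro summable_mult summable_geometric) auto
      fix n :: nat assume n: "n \<ge> 1"
      have "norm (h n * (1 - of_real u) ^ n) = norm (h n) * (sqrt (1 - u) ^ n * sqrt (1 - u) ^ n)"
        using u by (simp add: norm_mult norm_power norm1 flip: power_mult_distrib)
      also have "\<dots> \<le> (K * real n powr e) * (sqrt (1 - u) ^ n * sqrt (1 - u) ^ n)"
        using K(2)[OF n] u by (intro mult_right_mono) (auto simp: e_def)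
      also have "\<dots> = K * (real n powr e * sqrt (1 - u) ^ n) * sqrt (1 - u) ^ n" by simp
      also have "\<dots> \<le> K * M * sqrt (1 - u) ^ n"
        using M[OF n] K(1) u by (intro mult_right_mono mult_left_mono) auto
      finally show "norm (norm (h n * (1 - of_real u) ^ n)) \<le> K * M * sqrt (1 - u) ^ n" by simp
    qed
  qed
  have series_abs: "summable (\<lambda>n. norm (g n u))" if u: "u \<in> {0<..<1}" for u
    using summable_mult[OF hsum[OF u], of "norm (of_real u powr (s - 1) * (1 - of_real u) powr (c - 1) :: complex)"]
    by (simp add: fe[OF u] norm_mult mult.assoc)
  have series: "(\<Sum>n. g n u) = f u" if u: "u \<in> {0<..<1}" for u
  proof -
    have "hyp2F1 A B c (1 - of_real u) = (\<Sum>n. h n * (1 - of_real u) ^ n)"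
      by (simp add: hyp2F1_def eval_fps_def h_def hypergeo_coeff_def)
    thus ?thesis using hsum[OF u]
      by (simp add: fe[OF u] f_def suminf_mult summable_norm_cancel)
  qed
  have pc: "Re (c + of_nat n) > 0" for n using c by simp
  have int: "g n absolutely_integrable_on {0<..<1}" for n
    unfolding g_def by (intro set_integrable_mult_right complex_Beta_integral(1) s pc)
  define \<sigma> \<kappa> where "\<sigma> = complex_of_real (Re s)" and "\<kappa> = complex_of_real (Re c)"
  have re: "Re \<sigma> > 0" "Re (\<kappa> + of_nat n) > 0" "\<kappa> \<notin> \<int>\<^sub>\<le>\<^sub>0" "\<sigma> + \<kappa> \<notin> \<int>\<^sub>\<le>\<^sub>0" for n
    using s c by (auto simp: \<sigma>_def \<kappa>_def intro!: nonpos_Int_Re_pos)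
  have normint: "integral {0<..<1} (\<lambda>u. norm (g n u)) =
      norm (h n) * norm (Gamma \<sigma> * Gamma (\<kappa> + of_nat n) * rGamma (\<sigma> + (\<kappa> + of_nat n)))" for n
  proof -
    define v where "v = Gamma \<sigma> * Gamma (\<kappa> + of_nat n) * rGamma (\<sigma> + (\<kappa> + of_nat n))"
    define b where "b = (\<lambda>u. u powr (Re s - 1) * (1 - u) powr (Re c + n - 1))"
    have cb: "of_real u powr (\<sigma> - 1) * (1 - of_real u) powr (\<kappa> + of_nat n - 1) = complex_of_real (b u)"
      if u: "u \<in> {0<..<1}" for u
    proof -
      have "complex_of_real (b u) = of_real u powr of_real (Re s - 1) * of_real (1 - u) powr of_real (Re c + n - 1)"
        unfolding b_def of_real_mult using u by (simp only: powr_of_real greaterThanLessThan_iff less_imp_le diff_ge_0_iff_ge)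
      thus ?thesis by (simp add: \<sigma>_def \<kappa>_def)
    qed
    have "((\<lambda>u::real. of_real u powr (\<sigma> - 1) * (1 - of_real u) powr (\<kappa> + of_nat n - 1)) has_integral v) {0<..<1}"
      using set_lebesgue_integral_eq_integral(1)[OF complex_Beta_integral(1)[OF re(1,2)]]
            complex_Beta_integral(2)[OF re(1,2)]
      unfolding v_def by (simp add: has_integral_integral)
    hence b: "((\<lambda>u. complex_of_real (b u)) has_integral v) {0<..<1}"
      by (rule has_integral_eq[rotated]) (rule cb)
    have bR: "(b has_integral Re v) {0<..<1}" using has_integral_Re[OF b] by simp
    hence "((\<lambda>u. complex_of_real (b u)) has_integral of_real (Re v)) {0<..<1}"
      by (rule has_integral_of_real)
    hence "v = of_real (Re v)" using b has_integral_unique by blast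
    moreover have "Re v \<ge> 0" using bR by (rule has_integral_nonneg) (simp add: b_def)
    ultimately have "Re v = norm v" by (metis abs_of_nonneg norm_of_real)
    have "integral {0<..<1} (\<lambda>u. norm (g n u)) = integral {0<..<1} (\<lambda>u. norm (h n) * b u)"
    proof (intro integral_cong)
      fix u :: real assume u: "u \<in> {0<..<1}"
      have "1 - complex_of_real u = of_real (1 - u)" by simp
      hence "norm ((1 - complex_of_real u) powr (c + of_nat n - 1)) = (1 - u) powr Re (c + of_nat n - 1)"
        using u norm_of_real_powr_unit[of "1 - u"] by simp
      thus "norm (g n u) = norm (h n) * b u"
        using norm_of_real_powr_unit[OF u] by (simp add: g_def norm_mult b_def)
    qed
    also have "\<dots> = norm (h n) * Re v" using bR by (simp add: integral_unique)
    finally show ?thesis using \<open>Re v = norm v\<close> by (simp add: v_def)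
  qed
  have total: "summable (\<lambda>n. integral {0<..<1} (\<lambda>u. norm (g n u)))"
  proof -
    obtain D where D: "D \<ge> 0" "\<And>n. n \<ge> 1 \<Longrightarrow> norm (pochhammer \<kappa> n / pochhammer (\<sigma> + \<kappa>) n) \<le> D * real n powr Re (\<kappa> - (\<sigma> + \<kappa>))"
      using pochhammer_quotient_bound[OF re(4)] by blast
    define G where "G = norm (Gamma \<sigma> * Gamma \<kappa> * rGamma (\<sigma> + \<kappa>))"
    have G: "norm (Gamma \<sigma> * Gamma (\<kappa> + of_nat n) * rGamma (\<sigma> + (\<kappa> + of_nat n)))
       = G * norm (pochhammer \<kappa> n / pochhammer (\<sigma> + \<kappa>) n)" for n
      unfolding G_def norm_mult[symmetric] using Gamma_shift[OF re(3)] rGamma_shift[OF re(4)]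
      by (simp add: add.assoc mult_ac)
    show ?thesis
    proof (rule summable_powr_bound)
      fix n :: nat assume n: "n \<ge> 1"
      have "integral {0<..<1} (\<lambda>u. norm (g n u)) \<le> (K * real n powr (Re (A + B - c) - 1)) * (G * (D * real n powr Re (\<kappa> - (\<sigma> + \<kappa>))))"
        unfolding normint G using K(2)[OF n] D(2)[OF n] K(1)
        by (intro mult_mono mult_left_mono) (auto simp: G_def)
      also have "\<dots> = (K * G * D) * real n powr ((Re (A + B - c) - 1) + Re (\<kappa> - (\<sigma> + \<kappa>)))"
        by (subst powr_add) simp
      finally show "norm (integral {0<..<1} (\<lambda>u. norm (g n u))) \<le> (K * G * D) * real n powr ((Re (A + B - c) - 1) + Re (\<kappa> - (\<sigma> + \<kappa>)))"
        unfolding normint by simp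
    qed (use pos in \<open>simp add: \<sigma>_def\<close>)
  qed
  note res = integral_suminf_absolutely[OF int series_abs total]
  show "f absolutely_integrable_on {0<..<1}"
    by (rule iffD1[OF set_integrable_cong[OF refl refl] res(1)]) (rule series)
  have I: "integral {0<..<1} (g n) = Gamma s * Gamma c * rGamma (s + c) * hypergeo_coeff A B (s + c) n" for n
  proof -
    have "integral {0<..<1} (g n) = h n * (Gamma s * Gamma (c + of_nat n) * rGamma (s + (c + of_nat n)))"
      unfolding g_def integral_mult_right complex_Beta_integral(2)[OF s pc] ..
    moreover have "rGamma (s + (c + of_nat n)) = rGamma (s + c) / pochhammer (s + c) n"
      using rGamma_shift[OF scn, of n] by (simp add: add.assoc)
    moreover have "pochhammer c n \<noteq> 0" using cn by (auto dest: pochhammer_eq_0_imp_nonpos_Int)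
    ultimately show ?thesis by (simp add: h_def hypergeo_coeff_def Gamma_shift[OF cn] mult_ac)
  qed
  have "(\<lambda>n. integral {0<..<1} (g n)) sums
      (Gamma s * Gamma c * rGamma (s + c) * (Gamma (s + c) * Gamma (s + c - A - B) * rGamma (s + c - A) * rGamma (s + c - B)))"
    unfolding I by (intro sums_mult Gauss_hypergeo_sum) (use s c pos in auto)
  moreover have "rGamma (s + c) * Gamma (s + c) = 1"
    using scn by (simp add: rGamma_inverse_Gamma Gamma_eq_zero_iff)
  hence "Gamma s * Gamma c * rGamma (s + c) * (Gamma (s + c) * Gamma (s + c - A - B) * rGamma (s + c - A) * rGamma (s + c - B))
     = Gamma s * Gamma c * Gamma (s + c - A - B) * rGamma (s + c - A) * rGamma (s + c - B)"
    by algebra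
  ultimately have "integral {0<..<1} (\<lambda>u. \<Sum>n. g n u) = Gamma s * Gamma c * Gamma (s + c - A - B) * rGamma (s + c - A) * rGamma (s + c - B)"
    using res(2) sums_unique2 by metis
  moreover have "integral {0<..<1} (\<lambda>u. \<Sum>n. g n u) = integral {0<..<1} f"
    by (intro integral_cong series)
  ultimately show "integral {0<..<1} f =
      Gamma s * Gamma c * Gamma (s + c - A - B) * rGamma (s + c - A) * rGamma (s + c - B)" by simp
qed

section \<open>The integral representation\<close>

lemma wilson_basis_independent:
  assumes "(\<Sum>k\<le>N. smult (e k) (wilson_basis a k)) = 0" "k \<le> N"
  shows "e k = 0"
  using assms
proof (induction N)
  case (Suc N)
  have "0 = coeff (\<Sum>k\<le>Suc N. smult (e k) (wilson_basis a k)) (Suc N)"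
    using Suc.prems(1) by simp
  also have "\<dots> = (\<Sum>k\<le>N. e k * coeff (wilson_basis a k) (Suc N)) + e (Suc N) * coeff (wilson_basis a (Suc N)) (Suc N)"
    by (simp add: coeff_sum)
  also have "(\<Sum>k\<le>N. e k * coeff (wilson_basis a k) (Suc N)) = 0"
    by (intro sum.neutral) (auto simp: coeff_eq_0)
  finally have 0: "e (Suc N) = 0" by (simp add: lead_coeff_wilson_basis)
  with Suc show ?case by (auto simp: le_Suc_eq)
qed auto

lemma jacobi_moment_eq_poly:
  assumes z: "Re z > 0" and q: "degree q \<le> N"
  shows "jacobi_moment z \<beta> q =
    Gamma z * rGamma (z + of_nat N + \<beta> + 1) * poly (jacobi_moment_poly (\<beta> + 1) N (coeff q)) z"
proof -
  have zn: "z \<notin> \<int>\<^sub>\<le>\<^sub>0" by (rule nonpos_Int_Re_pos[OF z])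
  have "Gamma (z + of_nat k) * rGamma (z + of_nat k + \<beta> + 1) =
      Gamma z * rGamma (z + of_nat N + \<beta> + 1) *
      (pochhammer z k * pochhammer (z + (\<beta> + 1) + of_nat k) (N - k))" if "k \<le> N" for k
  proof -
    have e: "z + of_nat k + \<beta> + 1 = z + (\<beta> + 1) + of_nat k"
      "z + (\<beta> + 1) + of_nat k + of_nat (N - k) = z + of_nat N + \<beta> + 1"
      using that by (simp_all add: of_nat_diff)
    show ?thesis unfolding Gamma_shift[OF zn] e(1)
      pochhammer_rGamma[of "z + (\<beta> + 1) + of_nat k" "N - k"] e(2) by (simp only: mult_ac)
  qed
  thus ?thesis unfolding jacobi_moment_altdef[OF q] poly_jacobi_moment_poly sum_distrib_left
    by (intro sum.cong) (simp_all add: mult_ac)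
qed

lemma pochhammer_linear_nonzero: "pochhammer [:u, - 1:] k \<noteq> (0 :: complex poly)"
proof (induction k)
  case (Suc k)
  have "[:u, - 1:] + of_nat k = [:u + of_nat k, - 1 :: complex:]" by (simp add: of_nat_poly)
  hence "[:u, - 1:] + of_nat k \<noteq> (0 :: complex poly)" by simp
  with Suc show ?case unfolding pochhammer_Suc by (rule no_zero_divisors)
qed simp

text \<open>
  For \<open>z\<close> with large real part the moments determine the values of \<open>jacobi_moment_poly\<close>; as both sides are
  polynomials in \<open>z\<close>, they agree everywhere. The subscripts \<open>n\<^sub>j\<close> of the factors on the right-hand side place zeros
  at \<open>\<alpha>\<^sub>j + 1 + l\<close>, \<open>l < n\<^sub>j\<close>.
\<close>

theorem jacobi_pineiro_moments:
  fixes m :: nat and n :: "nat \<Rightarrow> nat" and \<alpha> :: "nat \<Rightarrow> complex"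
  defines "N \<equiv> mi_size m n"
  obtains q where "degree q \<le> N"
    "\<And>u::real. u \<in> {0<..<1} \<Longrightarrow> jacobi_pineiro m n \<alpha> \<beta> (of_real u) = poly q (of_real u) / mi_fact m n"
    "jacobi_moment_poly (\<beta> + 1) N (coeff q) =
       smult (pochhammer (\<beta> + 1) N) (\<Prod>j=1..m. pochhammer [:\<alpha> j + 1, - 1:] (n j))"
proof -
  obtain q where q: "degree q \<le> N"
     "\<And>u::real. u \<in> {0<..<1} \<Longrightarrow> jacobi_pineiro m n \<alpha> \<beta> (of_real u) = poly q (of_real u) / mi_fact m n"
     "\<And>z. Re z > 0 \<Longrightarrow> jacobi_moment z \<beta> q =
        pochhammer (\<beta> + 1) N * (\<Prod>j=1..m. pochhammer (\<alpha> j + 1 - z) (n j)) * (Gamma z * rGamma (z + of_nat N + \<beta> + 1))"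
    using jacobi_pineiro_poly[of m n \<alpha> \<beta>] unfolding N_def by blast
  define Q where "Q = jacobi_moment_poly (\<beta> + 1) N (coeff q)"
  define R where "R = smult (pochhammer (\<beta> + 1) N) (\<Prod>j=1..m. pochhammer [:\<alpha> j + 1, - 1:] (n j))"
  \<comment> \<open>beyond this real part the Gamma factors in the moments are neither zero nor infinite\<close>
  define r where "r = max 0 (- Re \<beta>)"
  have "poly (Q - R) z = 0" if z: "Re z > r" for z
  proof -
    have z0: "Re z > 0" and z1: "Re (z + of_nat N + \<beta> + 1) > 0" using z by (auto simp: r_def)
    have nz: "Gamma z * rGamma (z + of_nat N + \<beta> + 1) \<noteq> 0"
      using nonpos_Int_Re_pos[OF z0] nonpos_Int_Re_pos[OF z1] by (simp add: Gamma_eq_zero_iff rGamma_eq_zero_iff)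
    have "Gamma z * rGamma (z + of_nat N + \<beta> + 1) * poly Q z =
          Gamma z * rGamma (z + of_nat N + \<beta> + 1) *
          (pochhammer (\<beta> + 1) N * (\<Prod>j=1..m. pochhammer (\<alpha> j + 1 - z) (n j)))"
      using jacobi_moment_eq_poly[OF z0 q(1), of \<beta>] q(3)[OF z0] unfolding Q_def by (simp only: mult_ac)
    hence "poly Q z = pochhammer (\<beta> + 1) N * (\<Prod>j=1..m. pochhammer (\<alpha> j + 1 - z) (n j))"
      using nz by (simp only: mult_cancel_left) simp
    also have "\<dots> = poly R z" unfolding R_def by (simp add: poly_prod poly_pochhammer)
    finally show ?thesis by simp
  qed
  hence "(\<lambda>k. of_real (r + real (Suc k))) ` UNIV \<subseteq> {z. poly (Q - R) z = 0}" by auto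
  moreover have "infinite ((\<lambda>k. complex_of_real (r + real (Suc k))) ` UNIV)"
    by (rule range_inj_infinite) (simp add: inj_def)
  ultimately have "infinite {z. poly (Q - R) z = 0}" using finite_subset by blast
  hence "Q - R = 0" using poly_roots_finite by blast
  hence "Q = R" by simp
  thus ?thesis using that q unfolding Q_def R_def by blast
qed

text \<open>
  The Mellin transform with \<open>s = a - t + k\<close>. The Gamma factors in the kernel cancel those of the result up to
  Pochhammer symbols.
\<close>

lemma wilson_kernel_moment:
  fixes a c d t :: complex and k :: nat
  assumes cd: "Re (c + d) > 0" and t: "Re (a - t) > 0" "Re (a + t) > 0"
  defines "f \<equiv> \<lambda>u::real. of_real u ^ k *
     (jacobi_weight (a - 1) (c + d - 1) (of_real u) * wilson_kernel a 0 c d (of_real u) t)"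
  shows "f absolutely_integrable_on {0<..<1}"
    and "integral {0<..<1} f =
      rGamma (a + c + of_nat k) * rGamma (a + d + of_nat k) * (pochhammer (a - t) k * pochhammer (a + t) k)"
proof -
  define s where "s = a - t + of_nat k"
  define g where "g = (\<lambda>u::real. of_real u powr (s - 1) * (1 - of_real u) powr (c + d - 1) *
                    hyp2F1 (c - t) (d - t) (c + d) (1 - of_real u))"
  define C where "C = 1 / (Gamma (a - t) * Gamma (a + t) * Gamma (c + d))"
  have e: "s + (c + d) - (c - t) - (d - t) = a + t + of_nat k" "s + (c + d) - (c - t) = a + d + of_nat k"
    "s + (c + d) - (d - t) = a + c + of_nat k" by (simp_all add: s_def)
  have s: "Re s > 0" using t by (simp add: s_def)
  have s2: "Re (s + (c + d) - (c - t) - (d - t)) > 0" using t unfolding e by simp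
  have nz: "a - t \<notin> \<int>\<^sub>\<le>\<^sub>0" "a + t \<notin> \<int>\<^sub>\<le>\<^sub>0" "c + d \<notin> \<int>\<^sub>\<le>\<^sub>0"
    by (rule nonpos_Int_Re_pos, fact)+
  hence G: "Gamma (a - t) \<noteq> 0" "Gamma (a + t) \<noteq> 0" "Gamma (c + d) \<noteq> 0" by (simp_all add: Gamma_eq_zero_iff)
  have fg: "f u = C * g u" if u: "u \<in> {0<..<1}" for u
  proof -
    have u0: "complex_of_real u \<noteq> 0" using u by simp
    have "s - 1 = (a - 1) + (- t) + of_nat k" by (simp add: s_def)
    hence "of_real u powr (s - 1) = of_real u powr (a - 1) * of_real u powr (- t) * of_real u ^ k"
      using u0 by (simp only: powr_add powr_nat') simp
    thus ?thesis unfolding f_def g_def C_def jacobi_weight_def wilson_kernel_def by simp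
  qed
  have gi: "g absolutely_integrable_on {0<..<1}" and
    gv: "integral {0<..<1} g = Gamma s * Gamma (c + d) * Gamma (a + t + of_nat k) *
       rGamma (a + d + of_nat k) * rGamma (a + c + of_nat k)"
    using Mellin_hypergeo[OF s cd s2] unfolding e(1) unfolding e(2,3) g_def by blast+
  have "(\<lambda>u. C * g u) absolutely_integrable_on {0<..<1}"
    using gi by (rule set_integrable_mult_right)
  thus "f absolutely_integrable_on {0<..<1}"
    using set_integrable_cong[OF refl refl, of "{0<..<1}" f "\<lambda>u. C * g u" lebesgue, OF fg] by simp
  have "integral {0<..<1} f = integral {0<..<1} (\<lambda>u. C * g u)" by (rule integral_cong) (rule fg)
  also have "\<dots> = C * integral {0<..<1} g" by (rule integral_mult_right)
  also have "\<dots> = rGamma (a + c + of_nat k) * rGamma (a + d + of_nat k) * (pochhammer (a - t) k * pochhammer (a + t) k)"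
    unfolding gv s_def Gamma_shift[OF nz(1)] Gamma_shift[OF nz(2)] C_def using G by (simp add: field_simps)
  finally show "integral {0<..<1} f = \<dots>" .
qed

text \<open>
  Integrating the Jacobi-Pineiro polynomial against the kernel monomial by monomial gives an explicit combination \<open>p\<close>
  of the \<open>\<phi>\<^sub>k\<close>. The numbers \<open>x\<^sub>k\<close> that decide on its orthogonality are a constant multiple of the coefficients of the
  Jacobi-Pineiro polynomial, whose moments vanish where they should.
\<close>

lemma wilson_kernel_representation:
  fixes m :: nat and a c d :: complex and b :: "nat \<Rightarrow> complex" and n :: "nat \<Rightarrow> nat"
  assumes par: "\<And>j. j \<in> {1..m} \<Longrightarrow> wilson_params a (b j) c d"
    and ac: "a + c \<notin> \<int>\<^sub>\<le>\<^sub>0" "a + d \<notin> \<int>\<^sub>\<le>\<^sub>0" and cd: "Re (c + d) > 0"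
  defines "N \<equiv> mi_size m n"
    and "F \<equiv> \<lambda>t (u::real). jacobi_pineiro m n (\<lambda>j. a + b j - 1) (c + d - 1) (of_real u) *
           jacobi_weight (a - 1) (c + d - 1) (of_real u) * wilson_kernel a 0 c d (of_real u) t"
  shows "\<exists>p. is_type_II_mop m (\<lambda>j. wilson_functional a (b j) c d) n p \<and>
    (\<forall>t. 0 < \<bar>Re t\<bar> \<and> \<bar>Re t\<bar> < Re a \<longrightarrow> F t absolutely_integrable_on {0<..<1} \<and>
       poly p (t\<^sup>2) = mi_fact m n * Gamma (a + c + of_nat N) * Gamma (a + d + of_nat N) *
         integral {0<..<1} (F t))"
proof -
  define R where "R = smult (pochhammer (c + d) N) (\<Prod>j=1..m. pochhammer [:a + b j, - 1:] (n j))"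
  obtain q where q: "degree q \<le> N"
    "\<And>u::real. u \<in> {0<..<1} \<Longrightarrow>
       jacobi_pineiro m n (\<lambda>j. a + b j - 1) (c + d - 1) (of_real u) = poly q (of_real u) / mi_fact m n"
    and qR: "jacobi_moment_poly (c + d) N (coeff q) = R"
    using jacobi_pineiro_moments[of m n "\<lambda>j. a + b j - 1" "c + d - 1"] unfolding N_def R_def by auto
  define G where "G = Gamma (a + c + of_nat N) * Gamma (a + d + of_nat N)"
  define e where "e = (\<lambda>k. G * (coeff q k * (rGamma (a + c + of_nat k) * rGamma (a + d + of_nat k))))"
  define p where "p = (\<Sum>k\<le>N. smult (e k) (wilson_basis a k))"
  define C where "C = G * (rGamma (a + c) * rGamma (a + d))"
  have cdn: "c + d \<notin> \<int>\<^sub>\<le>\<^sub>0" by (rule nonpos_Int_Re_pos[OF cd])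
  have poch: "pochhammer z k \<noteq> 0" if "z \<notin> \<int>\<^sub>\<le>\<^sub>0" for z :: complex and k
    using that by (auto dest: pochhammer_eq_0_imp_nonpos_Int)
  have "R \<noteq> 0" using poch[OF cdn] by (simp add: R_def pochhammer_linear_nonzero)
  have "Gamma (a + c + of_nat N) \<noteq> 0" "Gamma (a + d + of_nat N) \<noteq> 0"
    using ac unfolding Gamma_shift[OF ac(1)] Gamma_shift[OF ac(2)]
    by (simp_all add: poch Gamma_eq_zero_iff)
  hence C: "C \<noteq> 0" using ac by (simp add: C_def G_def rGamma_eq_zero_iff)
  have eC: "e k * (pochhammer (a + c) k * pochhammer (a + d) k) = C * coeff q k" for k
    unfolding e_def C_def pochhammer_rGamma[of "a + c" k] pochhammer_rGamma[of "a + d" k] by (simp only: mult_ac)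
  have Qe: "jacobi_moment_poly (c + d) N (\<lambda>k. e k * (pochhammer (a + c) k * pochhammer (a + d) k)) = smult C R"
    unfolding eC qR[symmetric] poly_eq_poly_eq_iff[symmetric]
    by (rule ext) (simp add: poly_jacobi_moment_poly sum_distrib_left mult_ac)
  have mop: "is_type_II_mop m (\<lambda>j. wilson_functional a (b j) c d) n p"
    unfolding is_type_II_mop_def
  proof (intro conjI ballI)
    show "p \<noteq> 0"
    proof
      assume "p = 0"
      hence "e k = 0" if "k \<le> N" for k using wilson_basis_independent[where N = N and e = e and a = a] that unfolding p_def by blast
      hence "jacobi_moment_poly (c + d) N (\<lambda>k. e k * (pochhammer (a + c) k * pochhammer (a + d) k)) = 0"
        by (simp add: jacobi_moment_poly_def)
      thus False unfolding Qe using C \<open>R \<noteq> 0\<close> by simp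
    qed
    have "degree (smult (e k) (wilson_basis a k)) \<le> N" if "k \<le> N" for k
      using degree_smult_le[of "e k" "wilson_basis a k"] that by simp
    thus "degree p \<le> mi_size m n" unfolding p_def N_def[symmetric] by (intro degree_sum_le) auto
    fix j assume j: "j \<in> {1..m}"
    have "poly R (a + b j + of_nat l) = 0" if "l < n j" for l
    proof -
      have "pochhammer (- of_nat l :: complex) (n j) = 0" using that by (rule pochhammer_of_nat_eq_0_lemma)
      thus ?thesis using j by (auto simp: R_def poly_prod poly_pochhammer intro!: prod_zero bexI[of _ j])
    qed
    thus "\<forall>k<n j. wilson_functional a (b j) c d (p * monom 1 k) = 0"
      unfolding wilson_functional_orthogonality[OF par[OF j] p_def] Qe by simp
  qed
  have mf: "mi_fact m n \<noteq> 0" by (simp add: mi_fact_def)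
  have main: "F t absolutely_integrable_on {0<..<1} \<and>
       poly p (t\<^sup>2) = mi_fact m n * Gamma (a + c + of_nat N) * Gamma (a + d + of_nat N) * integral {0<..<1} (F t)"
    if t: "Re (a - t) > 0" "Re (a + t) > 0" for t
  proof -
    define f where "f = (\<lambda>k (u::real). of_real u ^ k *
       (jacobi_weight (a - 1) (c + d - 1) (of_real u) * wilson_kernel a 0 c d (of_real u) t))"
    define h where "h = (\<lambda>u. \<Sum>k\<le>N. (coeff q k / mi_fact m n) * f k u)"
    have fi: "f k absolutely_integrable_on {0<..<1}" and
      fv: "integral {0<..<1} (f k) =
        rGamma (a + c + of_nat k) * rGamma (a + d + of_nat k) * (pochhammer (a - t) k * pochhammer (a + t) k)" for k
      unfolding f_def using wilson_kernel_moment[OF cd t] by blast+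
    have Ff: "F t u = h u" if u: "u \<in> {0<..<1}" for u
    proof -
      have "poly q (of_real u) = (\<Sum>k\<le>N. coeff q k * of_real u ^ k)" 
        unfolding poly_altdef by (rule sum.mono_neutral_left) (use q(1) in \<open>auto simp: coeff_eq_0\<close>)
      thus ?thesis unfolding F_def q(2)[OF u] h_def f_def
        by (simp add: sum_divide_distrib sum_distrib_left sum_distrib_right mult_ac)
    qed
    have fi2: "(\<lambda>u. (coeff q k / mi_fact m n) * f k u) absolutely_integrable_on {0<..<1}" for k
      using fi by (rule set_integrable_mult_right)
    have "h absolutely_integrable_on {0<..<1}"
      unfolding h_def by (rule absolutely_integrable_sum) (use fi2 in auto)
    hence 1: "F t absolutely_integrable_on {0<..<1}"
      using set_integrable_cong[OF refl refl, of "{0<..<1}" "F t" h lebesgue, OF Ff] by simp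
    have "integral {0<..<1} (F t) = integral {0<..<1} h" by (rule integral_cong) (rule Ff)
    also have "\<dots> = (\<Sum>k\<le>N. integral {0<..<1} (\<lambda>u. (coeff q k / mi_fact m n) * f k u))"
      unfolding h_def by (rule integral_sum) (use fi2 in \<open>auto simp: absolutely_integrable_on_def\<close>)
    also have "\<dots> = (\<Sum>k\<le>N. (coeff q k / mi_fact m n) * (rGamma (a + c + of_nat k) * rGamma (a + d + of_nat k) *
        (pochhammer (a - t) k * pochhammer (a + t) k)))"
      by (simp only: integral_mult_right fv)
    finally have "mi_fact m n * G * integral {0<..<1} (F t) =
      (\<Sum>k\<le>N. mi_fact m n * G * ((coeff q k / mi_fact m n) * (rGamma (a + c + of_nat k) * rGamma (a + d + of_nat k) *
        (pochhammer (a - t) k * pochhammer (a + t) k))))" by (simp only: sum_distrib_left)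
    also have "\<dots> = (\<Sum>k\<le>N. e k * (pochhammer (a - t) k * pochhammer (a + t) k))"
      using mf by (intro sum.cong) (simp_all add: e_def)
    also have "\<dots> = poly p (t\<^sup>2)" by (simp add: p_def poly_sum poly_wilson_basis)
    finally show ?thesis using 1 by (simp add: G_def mult_ac)
  qed
  show ?thesis
  proof (intro exI[of _ p] conjI allI impI mop)
    fix t :: complex assume "0 < \<bar>Re t\<bar> \<and> \<bar>Re t\<bar> < Re a"
    hence t: "Re (a - t) > 0" "Re (a + t) > 0" by auto
    show "F t absolutely_integrable_on {0<..<1}" using main[OF t] by blast
    show "poly p (t\<^sup>2) = mi_fact m n * Gamma (a + c + of_nat N) * Gamma (a + d + of_nat N) *
        integral {0<..<1} (F t)" using main[OF t] by blast
  qed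
qed

theorem theorem3p3:
  fixes m :: nat and a c d :: complex and b :: "nat \<Rightarrow> complex"
  assumes "m \<ge> 1"
    and "\<And>x. x \<in> {2 * a, a + c, a + d, 2 * c, c + d, 2 * d} \<Longrightarrow> x \<notin> \<int>\<^sub>\<le>\<^sub>0"
    and "\<And>j x. j \<in> {1..m} \<Longrightarrow>
           x \<in> {a + b j, 2 * b j, b j + c, b j + d, a + b j + c + d} \<Longrightarrow> x \<notin> \<int>\<^sub>\<le>\<^sub>0"
    and "\<And>l k. l \<in> {1..m} \<Longrightarrow> k \<in> {1..m} \<Longrightarrow> l \<noteq> k \<Longrightarrow> b l - b k \<notin> \<int>"
  shows "perfect_system m (\<lambda>j. wilson_functional a (b j) c d) \<and>
    (Re a > 0 \<and> Re (c + d) > 0 \<longrightarrow>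
      (\<forall>n :: nat \<Rightarrow> nat. \<exists>p :: complex poly.
        is_type_II_mop m (\<lambda>j. wilson_functional a (b j) c d) n p \<and>
        (\<forall>t :: complex. 0 < \<bar>Re t\<bar> \<and> \<bar>Re t\<bar> < Re a \<longrightarrow>
          (let \<alpha> = (\<lambda>j. a + b j - 1);
               \<beta> = c + d - 1;
               k = mi_fact m n * Gamma (a + c + of_nat (mi_size m n)) *
                   Gamma (a + d + of_nat (mi_size m n));
               F = (\<lambda>u :: real. jacobi_pineiro m n \<alpha> \<beta> (of_real u) *
                     jacobi_weight (a - 1) \<beta> (of_real u) *
                     wilson_kernel a 0 c d (of_real u) t)
           in F absolutely_integrable_on {0<..<1} \<and>
              poly p (t\<^sup>2) = k * integral {0<..<1} F))))"
proof -
  have par: "wilson_params a (b j) c d" if "j \<in> {1..m}" for j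
    using assms(2) assms(3)[OF that] unfolding wilson_params_def by blast
  have nz: "a + c \<notin> \<int>\<^sub>\<le>\<^sub>0" "a + d \<notin> \<int>\<^sub>\<le>\<^sub>0" "c + d \<notin> \<int>\<^sub>\<le>\<^sub>0" using assms(2) by blast+
  show ?thesis
  proof (intro conjI impI allI, goal_cases)
    case 1
    show ?case by (rule wilson_system_perfect[OF par nz assms(4)])
  next
    case (2 n)
    thus ?case unfolding Let_def by (intro wilson_kernel_representation par nz) auto
  qed
qed

end
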